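(* Let $\mu_3$ be the group of cube roots of unity, $t\in\overline{\mathbb{Q}}\setminus\mu_3$, and let $X_t$ be the Hesse cubic curve over $\overline{\mathbb{Q}}$ with affine equation $x^3+y^3+1=3txy$. Then $\xi_{\mathrm{Hes},t}=\{x,y\}$ in $H^2_{\mathscr M}(X_t,\mathbb{Q}(2))$.
   Context: $X_t\subset\mathbb{P}^2$ is the smooth projective cubic $x_0^3+y_0^3+z_0^3=3tx_0y_0z_0$, with $x=x_0/z_0$, $y=y_0/z_0$. Motivic cohomology: for a smooth connected curve $C$ over a field, $H^2_{\mathscr M}(C,\mathbb{Q}(2))=\ker(T)\otimes\mathbb{Q}$, where $T=(T_P)_P$ is the product of tame symbols on Milnor $K_2$ of the function field, $T_P(\{f,g\})=(-1)^{\mathrm{ord}_P(f)\mathrm{ord}_P(g)}\bigl(f^{\mathrm{ord}_P(g)}/g^{\mathrm{ord}_P(f)}\bigr)(P)$. The symbol $\{x,y\}$ has vanishing tame symbols (up to torsion) and so defines an element of $H^2_{\mathscr M}(X_t,\mathbb{Q}(2))$. Hesse symbol: $\xi_{\mathrm{Hes},t}=\frac13\sum_{z\in\mu_3}\xi(\rho z)_t$, where for $z\in\mu_3$ $$\xi(\rho z)_t=\left\{-\frac{t+x+y}{z+x+z^2ty},\,-\frac{z^2+tx+zy}{t+x+y}\right\}\in H^2_{\mathscr M}(X_t,\mathbb{Q}(2)).$$ *)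

theory Defs
  imports
    "HOL-Algebra.Algebraic_Closure_Type"
    "HOL-Algebra.Free_Abelian_Groups"
    "HOL-Algebra.Coset"
    "HOL-Computational_Algebra.Computational_Algebra"
begin

section \<open>Tensor products of abelian groups\<close>

text \<open>Groups are written multiplicatively.  The tensor product is the free abelian group on
  pairs modulo the bilinear relations, so its elements are cosets of formal sums.\<close>

definition tensor_rels ::
  "('a, 'm) monoid_scheme \<Rightarrow> ('b, 'n) monoid_scheme \<Rightarrow> ('a \<times> 'b \<Rightarrow>\<^sub>0 int) set" where
  "tensor_rels G H =
     generate (free_Abelian_group (carrier G \<times> carrier H))
       ({frag_of (a \<otimes>\<^bsub>G\<^esub> a', b) - frag_of (a, b) - frag_of (a', b) | a a' b.
           a \<in> carrier G \<and> a' \<in> carrier G \<and> b \<in> carrier H}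
      \<union> {frag_of (a, b \<otimes>\<^bsub>H\<^esub> b') - frag_of (a, b) - frag_of (a, b') | a b b'.
           a \<in> carrier G \<and> b \<in> carrier H \<and> b' \<in> carrier H})"

definition tensor ::
  "('a, 'm) monoid_scheme \<Rightarrow> ('b, 'n) monoid_scheme \<Rightarrow> ('a \<times> 'b \<Rightarrow>\<^sub>0 int) set monoid" where
  "tensor G H = free_Abelian_group (carrier G \<times> carrier H) Mod tensor_rels G H"

definition pure_tensor ::
  "('a, 'm) monoid_scheme \<Rightarrow> ('b, 'n) monoid_scheme \<Rightarrow> 'a \<Rightarrow> 'b \<Rightarrow> ('a \<times> 'b \<Rightarrow>\<^sub>0 int) set" where
  "pure_tensor G H a b =
     tensor_rels G H #>\<^bsub>free_Abelian_group (carrier G \<times> carrier H)\<^esub> frag_of (a, b)"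

definition rat_group :: "rat monoid" where
  "rat_group = \<lparr>carrier = UNIV, monoid.mult = (+), one = 0\<rparr>"

text \<open>Scalar multiplication by \<open>q\<close> on the rational vector space \<open>tensor G rat_group\<close>: the map
  induced by sending \<open>(a, r)\<close> to \<open>(a, q * r)\<close>.\<close>

definition rat_scale ::
  "('a, 'm) monoid_scheme \<Rightarrow> rat \<Rightarrow> ('a \<times> rat \<Rightarrow>\<^sub>0 int) set \<Rightarrow> ('a \<times> rat \<Rightarrow>\<^sub>0 int) set" where
  "rat_scale G q c =
     tensor_rels G rat_group <#>\<^bsub>free_Abelian_group (carrier G \<times> carrier rat_group)\<^esub>
       (frag_extend (\<lambda>(a, r). frag_of (a, q * r)) ` c)"


section \<open>Milnor's \<open>K\<^sub>2\<close> of a field\<close>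

text \<open>The field is a subfield, given as a set \<open>K\<close>, of an ambient field type.\<close>

definition unit_group :: "'a::field set \<Rightarrow> 'a monoid" where
  "unit_group K = \<lparr>carrier = K - {0}, monoid.mult = (*), one = 1\<rparr>"

definition steinberg_rels :: "'a::field set \<Rightarrow> ('a \<times> 'a \<Rightarrow>\<^sub>0 int) set set" where
  "steinberg_rels K =
     generate (tensor (unit_group K) (unit_group K))
       {pure_tensor (unit_group K) (unit_group K) f (1 - f) | f. f \<in> K - {0, 1}}"

definition milnor_K2 :: "'a::field set \<Rightarrow> ('a \<times> 'a \<Rightarrow>\<^sub>0 int) set set monoid" where
  "milnor_K2 K = tensor (unit_group K) (unit_group K) Mod steinberg_rels K"

definition symbol :: "'a::field set \<Rightarrow> 'a \<Rightarrow> 'a \<Rightarrow> ('a \<times> 'a \<Rightarrow>\<^sub>0 int) set set" where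
  "symbol K f g =
     steinberg_rels K #>\<^bsub>tensor (unit_group K) (unit_group K)\<^esub>
       pure_tensor (unit_group K) (unit_group K) f g"


section \<open>The Hesse cubic and its function field\<close>

type_synonym qbar = "rat alg_closure"

text \<open>An algebraic closure of the rational function field \<open>qbar(x)\<close>, with its constants and
  the variable \<open>x\<close>.\<close>

type_synonym omega = "qbar poly fract alg_closure"

definition const :: "qbar \<Rightarrow> omega" where
  "const c = to_ac (Fraction_Field.Fract [:c:] 1)"

definition var_x :: omega where
  "var_x = to_ac (Fraction_Field.Fract [:0, 1:] 1)"

definition mu3 :: "qbar set" where
  "mu3 = {z. z ^ 3 = 1}"

text \<open>Points of \<open>X\<^sub>t(qbar)\<close> are given by their nonzero homogeneous coordinate triples, so
  that one point has many triples.  All notions at a point used below are independent of the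
  choice.\<close>

definition hesse_points :: "qbar \<Rightarrow> (qbar \<times> qbar \<times> qbar) set" where
  "hesse_points t =
     {(u, v, w). (u, v, w) \<noteq> (0, 0, 0) \<and> u ^ 3 + v ^ 3 + w ^ 3 = 3 * t * u * v * w}"

text \<open>Ternary forms of degree \<open>d\<close>; \<open>a i j\<close> is the coefficient of \<open>u^i v^j w^(d-i-j)\<close>.\<close>

fun form_eval :: "nat \<Rightarrow> (nat \<Rightarrow> nat \<Rightarrow> 'a::comm_ring_1) \<Rightarrow> 'a \<times> 'a \<times> 'a \<Rightarrow> 'a" where
  "form_eval d a (u, v, w) = (\<Sum>i\<le>d. \<Sum>j\<le>d - i. a i j * u ^ i * v ^ j * w ^ (d - i - j))"

abbreviation form_generic :: "omega \<Rightarrow> nat \<Rightarrow> (nat \<Rightarrow> nat \<Rightarrow> qbar) \<Rightarrow> omega" where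
  "form_generic y d a \<equiv> form_eval d (\<lambda>i j. const (a i j)) (var_x, y, 1)"

text \<open>If \<open>y\<close> is a root of \<open>var_x^3 + y^3 + 1 = 3 t var_x y\<close> with \<open>t\<close> outside \<open>mu3\<close>, then this cubic
  is irreducible over \<open>qbar(x)\<close> and \<open>(var_x, y)\<close> is a generic point of \<open>X\<^sub>t\<close>: a polynomial over
  \<open>qbar\<close> vanishes at it iff it vanishes on the affine curve.  Hence the quotients of forms of
  equal degree, evaluated at the generic point, are the rational functions on \<open>X\<^sub>t\<close>; together
  they form the subfield \<open>qbar(x, y)\<close>, a copy of \<open>Frac (qbar[x, y] / (x^3 + y^3 + 1 - 3txy))\<close>.\<close>

definition represents ::
  "omega \<Rightarrow> nat \<Rightarrow> (nat \<Rightarrow> nat \<Rightarrow> qbar) \<Rightarrow> (nat \<Rightarrow> nat \<Rightarrow> qbar) \<Rightarrow> omega \<Rightarrow> bool" where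
  "represents y d a b f \<longleftrightarrow>
     form_generic y d b \<noteq> 0 \<and> f = form_generic y d a / form_generic y d b"

definition function_field :: "omega \<Rightarrow> omega set" where
  "function_field y = {f. \<exists>d a b. represents y d a b f}"

definition local_ring :: "omega \<Rightarrow> qbar \<times> qbar \<times> qbar \<Rightarrow> omega set" where
  "local_ring y P = {f. \<exists>d a b. represents y d a b f \<and> form_eval d b P \<noteq> 0}"

definition value_at :: "omega \<Rightarrow> qbar \<times> qbar \<times> qbar \<Rightarrow> omega \<Rightarrow> qbar" where
  "value_at y P f =
     (THE v. \<exists>d a b. represents y d a b f \<and> form_eval d b P \<noteq> 0 \<and>
                     v = form_eval d a P / form_eval d b P)"

definition max_ideal :: "omega \<Rightarrow> qbar \<times> qbar \<times> qbar \<Rightarrow> omega set" where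
  "max_ideal y P = {f \<in> local_ring y P. value_at y P f = 0}"

text \<open>Order of vanishing at \<open>P\<close>, via a uniformizer \<open>p\<close> of the local ring; meant for \<open>f \<noteq> 0\<close>.\<close>

definition order_at :: "omega \<Rightarrow> qbar \<times> qbar \<times> qbar \<Rightarrow> omega \<Rightarrow> int" where
  "order_at y P f =
     (THE n. \<exists>p u. max_ideal y P = (\<lambda>h. p * h) ` local_ring y P \<and>
                   u \<in> local_ring y P - max_ideal y P \<and> f = u * p powi n)"


section \<open>Tame symbols and motivic cohomology\<close>

definition tame :: "omega \<Rightarrow> qbar \<times> qbar \<times> qbar \<Rightarrow> omega \<times> omega \<Rightarrow> qbar" where
  "tame y P = (\<lambda>(f, g).
     (-1) powi (order_at y P f * order_at y P g) *
     value_at y P (f powi order_at y P g / g powi order_at y P f))"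

text \<open>The homomorphism \<open>T\<^sub>P\<close> on \<open>K\<^sub>2\<close>, obtained by extending \<^const>\<open>tame\<close> to formal sums and then
  passing to the two successive quotients; a homomorphism that is trivial on the relations is
  constant on every coset.\<close>

definition tame_formal ::
  "omega \<Rightarrow> qbar \<times> qbar \<times> qbar \<Rightarrow> (omega \<times> omega \<Rightarrow>\<^sub>0 int) \<Rightarrow> qbar" where
  "tame_formal y P w =
     (\<Prod>s\<in>Poly_Mapping.keys w. tame y P s powi Poly_Mapping.lookup w s)"

definition tame_K2 ::
  "omega \<Rightarrow> qbar \<times> qbar \<times> qbar \<Rightarrow> (omega \<times> omega \<Rightarrow>\<^sub>0 int) set set \<Rightarrow> qbar" where
  "tame_K2 y P \<alpha> = the_elem ((\<lambda>c. the_elem (tame_formal y P ` c)) ` \<alpha>)"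

definition tame_kernel :: "qbar \<Rightarrow> omega \<Rightarrow> (omega \<times> omega \<Rightarrow>\<^sub>0 int) set set monoid" where
  "tame_kernel t y =
     (milnor_K2 (function_field y))
       \<lparr>carrier := {\<alpha> \<in> carrier (milnor_K2 (function_field y)).
                      \<forall>P\<in>hesse_points t. tame_K2 y P \<alpha> = 1}\<rparr>"

text \<open>\<open>H\<^sup>2(X\<^sub>t, \<rat>(2)) = ker T \<otimes> \<rat>\<close>.\<close>

definition motivic_H2 ::
  "qbar \<Rightarrow> omega \<Rightarrow> ((omega \<times> omega \<Rightarrow>\<^sub>0 int) set set \<times> rat \<Rightarrow>\<^sub>0 int) set monoid" where
  "motivic_H2 t y = tensor (tame_kernel t y) rat_group"

text \<open>An element of \<open>K\<^sub>2\<close> whose tame symbols are trivial up to torsion, i.e. some positive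
  multiple \<open>n \<alpha>\<close> of which lies in \<open>ker T\<close>, defines the class \<open>n \<alpha> \<otimes> 1/n\<close>; it does not depend on
  \<open>n\<close>, and the least \<open>n\<close> is taken.\<close>

definition tame_torsion ::
  "qbar \<Rightarrow> omega \<Rightarrow> (omega \<times> omega \<Rightarrow>\<^sub>0 int) set set \<Rightarrow> bool" where
  "tame_torsion t y \<alpha> \<longleftrightarrow>
     \<alpha> \<in> carrier (milnor_K2 (function_field y)) \<and>
     (\<exists>n>0. \<alpha> [^]\<^bsub>milnor_K2 (function_field y)\<^esub> (n::nat) \<in> carrier (tame_kernel t y))"

definition motivic_class ::
  "qbar \<Rightarrow> omega \<Rightarrow> (omega \<times> omega \<Rightarrow>\<^sub>0 int) set set
    \<Rightarrow> ((omega \<times> omega \<Rightarrow>\<^sub>0 int) set set \<times> rat \<Rightarrow>\<^sub>0 int) set" where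
  "motivic_class t y \<alpha> =
     (let n = (LEAST n::nat. n > 0 \<and>
                 \<alpha> [^]\<^bsub>milnor_K2 (function_field y)\<^esub> n \<in> carrier (tame_kernel t y))
      in pure_tensor (tame_kernel t y) rat_group
           (\<alpha> [^]\<^bsub>milnor_K2 (function_field y)\<^esub> n) (1 / of_nat n))"


section \<open>The Hesse symbol\<close>

definition xi_rho ::
  "qbar \<Rightarrow> omega \<Rightarrow> qbar \<Rightarrow> (omega \<times> omega \<Rightarrow>\<^sub>0 int) set set" where
  "xi_rho t y z =
     (let x = var_x; T = const t; \<zeta> = const z
      in symbol (function_field y)
           (- ((T + x + y) / (\<zeta> + x + \<zeta> ^ 2 * T * y)))
           (- ((\<zeta> ^ 2 + T * x + \<zeta> * y) / (T + x + y))))"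

definition xi_Hes ::
  "qbar \<Rightarrow> omega \<Rightarrow> ((omega \<times> omega \<Rightarrow>\<^sub>0 int) set set \<times> rat \<Rightarrow>\<^sub>0 int) set" where
  "xi_Hes t y =
     rat_scale (tame_kernel t y) (1 / 3)
       (\<Otimes>\<^bsub>motivic_H2 t y\<^esub>z\<in>mu3. motivic_class t y (xi_rho t y z))"

end

theory Submission
  imports Defs
begin

text \<open>Modulo torsion, all symbols involved are symbols of linear forms on the cubic, and Steinberg
  relations between them come from triples of concurrent lines.  Put \<open>A = t + x + y\<close> and, for
  \<open>z \<in> \<mu>\<^sub>3\<close>, \<open>B = z + x + z\<^sup>2ty\<close>, \<open>C = z\<^sup>2 + tx + zy\<close> and \<open>M = z + x + y\<close>.  On the cubic \<open>ABC\<close> is a constant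
  multiple of \<open>M\<^sup>3\<close>, which turns \<open>{A/B, C/A}\<close> into \<open>3{M, y} - 3{B, y} - 3{A, B}\<close> up to symbols with a constant
  entry.  The products over \<open>z\<close> of the forms \<open>B\<close> and \<open>M\<close> are \<open>(t\<^sup>3 - 1)y\<^sup>3\<close> and \<open>3xyA\<close>, so the sum over \<open>z\<close>
  is \<open>3{x, y} - 6{A, y}\<close>, and the pencils through the flexes on \<open>M\<close> give \<open>3{M, y} = {x, y}\<close>, whence
  \<open>{A, y} = 0\<close>.  All symbols with a constant entry cancel when they are kept track of.

  The tame symbols are of order dividing 6 because at each point, up to symbols \<open>{f, f}\<close>, one entry
  is a unit whose value is a root of unity.  That they are well defined on \<open>K\<^sub>2\<close> requires the local
  rings of forms to be discrete valuation rings.  In an affine chart with nonvanishing vertical partial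
  derivative every rational function is a combination of \<open>1\<close>, \<open>\<eta>\<close>, \<open>\<eta>\<^sup>2\<close> over the rational functions of \<open>\<xi>\<close>, the
  function \<open>\<xi> - a\<close> generates the maximal ideal, and norms bound the order of vanishing.\<close>

section \<open>Symbols of linear forms on the cubic\<close>

text \<open>Constants such as \<open>3\<close>, \<open>t - z\<close> and \<open>t ^ 3 - 1\<close>
  are in general not roots of unity, and then a symbol \<open>{c, f}\<close> need not be torsion,
  since its tame symbols are powers of \<open>c\<close>. This is why they are carried through every
  identity instead of being discarded at the start. Elements of \<open>K\<^sub>2\<close> are cosets
  of cosets; evaluating an arbitrary additive rational functional on formal sums turns the whole
  computation into linear arithmetic over the rationals. An element killed by all functionals that
  respect the relations is torsion, by linear algebra in the rational vector space containing the
  formal sums. This yields the relation only after multiplication by some unknown \<open>n\<close>,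
  and only in the whole of \<open>K\<^sub>2\<close>, whereas the claim lives in the tensor product
  of \<open>ker T\<close> with the rationals. Multiplying once more by 6 moves every term into
  \<open>ker T\<close>; the relation is then an equality of elements of that subgroup, and the
  factor is divided out again after tensoring.\<close>

locale subfield_set =
  fixes K :: "'a::field set"
  assumes K_one: "1 \<in> K"
    and K_add: "f \<in> K \<Longrightarrow> g \<in> K \<Longrightarrow> f + g \<in> K"
    and K_uminus: "f \<in> K \<Longrightarrow> - f \<in> K"
    and K_mult: "f \<in> K \<Longrightarrow> g \<in> K \<Longrightarrow> f * g \<in> K"
    and K_inverse: "f \<in> K \<Longrightarrow> inverse f \<in> K"
begin

lemma K_diff: "f \<in> K \<Longrightarrow> g \<in> K \<Longrightarrow> f - g \<in> K"
  using K_add[of f "- g"] K_uminus by simp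

lemma K_divide: "f \<in> K \<Longrightarrow> g \<in> K \<Longrightarrow> f / g \<in> K"
  using K_mult[of f "inverse g"] K_inverse by (simp add: divide_inverse)

lemma K_power: "f \<in> K \<Longrightarrow> f ^ n \<in> K"
  by (induction n) (auto intro: K_one K_mult)

lemma K_numeral: "numeral n \<in> K"
  by (induction n) (simp_all only: numeral.simps K_one K_add)

lemmas K_closed = K_one K_add K_uminus K_mult K_inverse K_diff K_divide K_power K_numeral

end

text \<open>Rational-valued functionals see Milnor's \<open>K\<^sub>2\<close> exactly modulo torsion; in particular signs and
  roots of unity in the entries of a symbol do not matter.\<close>

locale steinberg_functional = subfield_set K for K :: "'a::field set" +
  fixes s :: "'a \<Rightarrow> 'a \<Rightarrow> rat"
  assumes s_mult_left:
      "\<lbrakk>f \<in> K; f' \<in> K; g \<in> K; f \<noteq> 0; f' \<noteq> 0; g \<noteq> 0\<rbrakk> \<Longrightarrow> s (f * f') g = s f g + s f' g"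
    and s_mult_right:
      "\<lbrakk>f \<in> K; g \<in> K; g' \<in> K; f \<noteq> 0; g \<noteq> 0; g' \<noteq> 0\<rbrakk> \<Longrightarrow> s f (g * g') = s f g + s f g'"
    and s_steinberg: "\<lbrakk>f \<in> K; f \<noteq> 0; f \<noteq> 1\<rbrakk> \<Longrightarrow> s f (1 - f) = 0"
begin

section \<open>Calculus of symbols modulo torsion\<close>

lemma s_one_left: "g \<in> K \<Longrightarrow> g \<noteq> 0 \<Longrightarrow> s 1 g = 0"
  using s_mult_left[of 1 1 g] K_one by simp

lemma s_one_right: "f \<in> K \<Longrightarrow> f \<noteq> 0 \<Longrightarrow> s f 1 = 0"
  using s_mult_right[of f 1 1] K_one by simp

lemma s_power_left: "f \<in> K \<Longrightarrow> g \<in> K \<Longrightarrow> f \<noteq> 0 \<Longrightarrow> g \<noteq> 0 \<Longrightarrow> s (f ^ n) g = of_nat n * s f g"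
  by (induction n) (auto simp: s_one_left s_mult_left K_power algebra_simps)

lemma s_power_right: "f \<in> K \<Longrightarrow> g \<in> K \<Longrightarrow> f \<noteq> 0 \<Longrightarrow> g \<noteq> 0 \<Longrightarrow> s f (g ^ n) = of_nat n * s f g"
  by (induction n) (auto simp: s_one_right s_mult_right K_power algebra_simps)

lemma s_divide_left:
  assumes "f \<in> K" "f' \<in> K" "g \<in> K" "f \<noteq> 0" "f' \<noteq> 0" "g \<noteq> 0"
  shows "s (f / f') g = s f g - s f' g"
  using s_mult_left[of "f / f'" f' g] assms by (simp add: K_divide)

lemma s_divide_right:
  assumes "f \<in> K" "g \<in> K" "g' \<in> K" "f \<noteq> 0" "g \<noteq> 0" "g' \<noteq> 0"
  shows "s f (g / g') = s f g - s f g'"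
  using s_mult_right[of f "g / g'" g'] assms by (simp add: K_divide)

lemma s_torsion_left:
  assumes "z \<in> K" "g \<in> K" "g \<noteq> 0" "z ^ n = 1" "n > 0"
  shows "s z g = 0"
proof -
  from assms have "z \<noteq> 0" by (auto simp: power_0_left)
  hence "of_nat n * s z g = s 1 g" using s_power_left[of z g n] assms by simp
  thus ?thesis using assms by (simp add: s_one_left)
qed

lemma s_torsion_right:
  assumes "z \<in> K" "f \<in> K" "f \<noteq> 0" "z ^ n = 1" "n > 0"
  shows "s f z = 0"
proof -
  from assms have "z \<noteq> 0" by (auto simp: power_0_left)
  hence "of_nat n * s f z = s f 1" using s_power_right[of f z n] assms by simp
  thus ?thesis using assms by (simp add: s_one_right)
qed

lemma s_uminus_left: "f \<in> K \<Longrightarrow> g \<in> K \<Longrightarrow> f \<noteq> 0 \<Longrightarrow> g \<noteq> 0 \<Longrightarrow> s (- f) g = s f g"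
  using s_mult_left[of "-1" f g] s_torsion_left[of "-1" g 2] by (simp add: K_closed)

lemma s_uminus_right: "f \<in> K \<Longrightarrow> g \<in> K \<Longrightarrow> f \<noteq> 0 \<Longrightarrow> g \<noteq> 0 \<Longrightarrow> s f (- g) = s f g"
  using s_mult_right[of f "-1" g] s_torsion_right[of "-1" f 2] by (simp add: K_closed)

text \<open>Since \<open>1 - 1/f = - (1 - f)/f\<close> and signs do not count, the Steinberg
  relations for \<open>1/f\<close> and for \<open>f\<close> combine to leave
  \<open>s f f\<close>.\<close>

lemma s_self:
  assumes "f \<in> K" "f \<noteq> 0"
  shows "s f f = 0"
proof (cases "f = 1")
  case False
  have "s (inverse f) (1 - inverse f) = 0"
    using assms False by (intro s_steinberg) (auto simp: K_inverse)
  moreover have "1 - inverse f = - ((1 - f) / f)"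
    using assms by (simp add: field_simps)
  ultimately have "s (1 / f) ((1 - f) / f) = 0"
    using assms False by (simp add: s_uminus_right K_closed divide_simps flip: inverse_eq_divide)
  thus ?thesis
    using assms False s_steinberg[of f]
    by (simp add: s_divide_left s_divide_right K_closed s_one_left)
qed (use assms in \<open>simp add: s_one_left\<close>)

text \<open>Polarization of \<open>s_self\<close> at \<open>f * g\<close>.\<close>

lemma s_antisym:
  assumes "f \<in> K" "g \<in> K" "f \<noteq> 0" "g \<noteq> 0"
  shows "s g f = - s f g"
proof -
  have "s (f * g) (f * g) = s f g + s g f"
    using assms by (simp add: s_mult_left s_mult_right K_mult s_self[of f] s_self[of g])
  moreover have "s (f * g) (f * g) = 0"
    using assms by (intro s_self) (auto simp: K_mult)
  ultimately show ?thesis by simp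
qed

text \<open>For three lines of a pencil, suitably scaled, the Steinberg relation for \<open>f / h\<close> and
  \<open>- g / h\<close> expresses one symbol by the two others.\<close>

lemma s_pencil:
  assumes "f \<in> K" "g \<in> K" "f \<noteq> 0" "g \<noteq> 0" "f - g = h" "h \<noteq> 0"
  shows "s f g = s f h + s h g"
proof -
  have h: "h \<in> K" using assms K_diff by blast
  have "s (f / h) (1 - f / h) = 0"
    using assms h by (intro s_steinberg) (auto simp: K_closed)
  moreover have "1 - f / h = - (g / h)"
    using assms by (simp add: field_simps)
  ultimately show ?thesis
    using assms h
    by (simp add: s_uminus_right s_divide_left s_divide_right K_closed s_self)
qed

end

text \<open>Below, \<open>A\<close>, \<open>B z\<close> and \<open>C z\<close> are the tangents at the flexes \<open>(1 : -1 : 0)\<close>,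
  \<open>(-z : 0 : 1)\<close> and \<open>(0 : -z : 1)\<close>, and \<open>M z\<close> is the line through these three collinear
  points, which explains the relation between \<open>A * B z * C z\<close> and the cube of \<open>M z\<close>.  The other lines
  through the second and third flex and two more flexes are \<open>z + x + w ^ i * y\<close> and \<open>z + w ^ i * x + y\<close>.\<close>

locale hesse_functional = steinberg_functional K s
  for K :: "'a::field set" and s +
  fixes k :: "'a set" and x y t w :: 'a
  assumes k_K: "k \<subseteq> K"
    and k_one: "1 \<in> k"
    and k_add: "a \<in> k \<Longrightarrow> b \<in> k \<Longrightarrow> a + b \<in> k"
    and k_uminus: "a \<in> k \<Longrightarrow> - a \<in> k"
    and k_mult: "a \<in> k \<Longrightarrow> b \<in> k \<Longrightarrow> a * b \<in> k"
    and x_K: "x \<in> K" and y_K: "y \<in> K" and t_k: "t \<in> k" and w_k: "w \<in> k"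
    and w: "w ^ 2 + w + 1 = 0" and three: "(3::'a) \<noteq> 0"
    and cubic: "x ^ 3 + y ^ 3 + 1 = 3 * t * x * y"
    and x_nz: "x \<noteq> 0" and y_nz: "y \<noteq> 0"
    and lin_x: "a \<in> k \<Longrightarrow> b \<in> k \<Longrightarrow> c \<in> k \<Longrightarrow> b \<noteq> 0 \<Longrightarrow> a + b * x + c * y \<noteq> 0"
    and lin_y: "a \<in> k \<Longrightarrow> b \<in> k \<Longrightarrow> c \<in> k \<Longrightarrow> c \<noteq> 0 \<Longrightarrow> a + b * x + c * y \<noteq> 0"
    and t_mu3: "t ^ 3 \<noteq> 1"
begin

lemma k_power: "a \<in> k \<Longrightarrow> a ^ n \<in> k"
  by (induction n) (auto intro: k_one k_mult)

lemmas k_closed = k_one k_add k_uminus k_mult k_power t_k w_k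

lemma k_imp_K: "a \<in> k \<Longrightarrow> a \<in> K"
  using k_K by blast

abbreviation "A \<equiv> t + x + y"
abbreviation "B z \<equiv> z + x + z ^ 2 * t * y"
abbreviation "C z \<equiv> z ^ 2 + t * x + z * y"
abbreviation "M z \<equiv> z + x + y"

lemma nz:
  assumes "z \<in> k" "z ^ 3 = 1"
  shows "z \<noteq> 0" "t - z \<noteq> 0" "A \<noteq> 0" "B z \<noteq> 0" "C z \<noteq> 0" "M z \<noteq> 0"
    "z + x + w * y \<noteq> 0" "z + x + w ^ 2 * y \<noteq> 0" "z + w * x + y \<noteq> 0" "z + w ^ 2 * x + y \<noteq> 0"
proof -
  show z: "z \<noteq> 0" using assms by auto
  show "t - z \<noteq> 0" using assms t_mu3 by auto
  show "A \<noteq> 0" using lin_x[of t 1 1] by (simp add: k_closed)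
  show "B z \<noteq> 0" using lin_x[of z 1 "z ^ 2 * t"] assms by (simp add: k_closed)
  show "C z \<noteq> 0" using lin_y[of "z ^ 2" t z] assms z by (simp add: k_closed)
  show "M z \<noteq> 0" using lin_x[of z 1 1] assms by (simp add: k_closed)
  show "z + x + w * y \<noteq> 0" using lin_x[of z 1 w] assms by (simp add: k_closed)
  show "z + x + w ^ 2 * y \<noteq> 0" using lin_x[of z 1 "w ^ 2"] assms by (simp add: k_closed)
  show "z + w * x + y \<noteq> 0" using lin_y[of z w 1] assms by (simp add: k_closed)
  show "z + w ^ 2 * x + y \<noteq> 0" using lin_y[of z "w ^ 2" 1] assms by (simp add: k_closed)
qed

section \<open>Identities between lines on the cubic\<close>

lemma w_sq: "w * w = - 1 - w"
proof -
  have "w * w - (- 1 - w) = w ^ 2 + w + 1" by (simp add: power2_eq_square)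
  thus ?thesis using w by simp
qed

lemma w3: "w ^ 3 = 1"
proof -
  have "w ^ 3 - 1 = (w - 1) * (w ^ 2 + w + 1)" by (simp add: power2_eq_square power3_eq_cube algebra_simps)
  thus ?thesis using w by simp
qed

lemma s_unit_left: "z \<in> k \<Longrightarrow> z ^ 3 = 1 \<Longrightarrow> f \<in> K \<Longrightarrow> g \<in> K \<Longrightarrow> f \<noteq> 0 \<Longrightarrow> g \<noteq> 0 \<Longrightarrow> s (z * f) g = s f g"
  by (subst s_mult_left) (auto simp: k_imp_K nz s_torsion_left[where n = 3])

lemma s_unit_right: "z \<in> k \<Longrightarrow> z ^ 3 = 1 \<Longrightarrow> f \<in> K \<Longrightarrow> g \<in> K \<Longrightarrow> f \<noteq> 0 \<Longrightarrow> g \<noteq> 0 \<Longrightarrow> s f (z * g) = s f g"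
  by (subst s_mult_right) (auto simp: k_imp_K nz s_torsion_right[where n = 3])

text \<open>Rewrite rules towards a normal form of \<open>w\<close>-degree below 2 and
  \<open>x\<close>-degree below 3, by which polynomial identities modulo the cubic are checked. The
  variants with \<open>a\<close> are there because sorted products nest to the right, so that a
  power may be followed by further factors.\<close>

lemma reduce:
  shows "w * w = - 1 - w" "w * (w * a) = - a - w * a"
    "x * (x * x) = 3 * t * x * y - y * (y * y) - 1"
    "x * (x * (x * a)) = (3 * t * x * y - y * (y * y) - 1) * a"
proof -
  show 1: "w * w = - 1 - w" by (rule w_sq)
  show "w * (w * a) = - a - w * a"
    by (simp only: mult.assoc[symmetric] 1) (simp add: left_diff_distrib)
  have "x * (x * x) + y * (y * y) + 1 = 3 * t * x * y"
    using cubic by (simp add: power3_eq_cube mult.assoc)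
  thus 2: "x * (x * x) = 3 * t * x * y - y * (y * y) - 1"
    by (simp add: algebra_simps)
  show "x * (x * (x * a)) = (3 * t * x * y - y * (y * y) - 1) * a"
    by (subst 2[symmetric]) (simp only: mult.assoc)
qed

lemma one_minus_w: "1 - w \<noteq> 0" "1 - w ^ 2 = - (w ^ 2) * (1 - w)" "(1 - w) * (1 - w ^ 2) = 3"
proof -
  show "1 - w \<noteq> 0"
  proof
    assume "1 - w = 0"
    hence "w = 1" by simp
    with w three show False by simp
  qed
  show "1 - w ^ 2 = - (w ^ 2) * (1 - w)" "(1 - w) * (1 - w ^ 2) = 3"
    by (simp_all add: power2_eq_square algebra_simps reduce)
qed

text \<open>The two factors of \<open>3 = (1 - w) * (1 - w ^ 2)\<close> differ by the root of unity
  \<open>- w ^ 2\<close>, so each contributes half of what \<open>3\<close> does. Doubling leaves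
  \<open>3\<close> as the only constant of this kind.\<close>

lemma s_one_minus_w2:
  assumes "f \<in> K" "f \<noteq> 0"
  shows "2 * s f (1 - w) = s f 3" "2 * s (1 - w) f = s 3 f"
    "2 * s f (1 - w ^ 2) = s f 3" "2 * s (1 - w ^ 2) f = s 3 f"
proof -
  have e: "1 - w \<in> K" "1 - w ^ 2 \<in> K" "w ^ 2 \<in> K" "w ^ 2 \<in> k"
    using k_K by (auto intro!: K_closed k_closed)
  have e2: "1 - w ^ 2 \<noteq> 0" using one_minus_w three by (metis mult_zero_right)
  have w6: "(w ^ 2) ^ 3 = 1" using w3 by (metis power_mult mult.commute power_one)
  have "s f (1 - w ^ 2) = s f (1 - w)"
    using s_unit_right[of "w ^ 2" f "1 - w"] s_uminus_right[of f "w ^ 2 * (1 - w)"] e assms w6 one_minus_w e2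
    by (simp add: K_closed)
  moreover have "s f 3 = s f (1 - w) + s f (1 - w ^ 2)"
    using s_mult_right[of f "1 - w" "1 - w ^ 2"] e e2 one_minus_w assms by simp
  ultimately show 1: "2 * s f (1 - w) = s f 3" "2 * s f (1 - w ^ 2) = s f 3" by auto
  show "2 * s (1 - w) f = s 3 f" "2 * s (1 - w ^ 2) f = s 3 f"
    using 1 s_antisym[of f "1 - w"] s_antisym[of f "1 - w ^ 2"] s_antisym[of f 3] e e2 one_minus_w three assms
    by (auto simp: K_closed)
qed


text \<open>In the first two, the left sides are \<open>(z + x) ^ 3 + y ^ 3\<close> and
  \<open>(z + y) ^ 3 + x ^ 3\<close>, and the cubic replaces the sum of cubes by
  \<open>3 * t * x * y\<close>. In the third, both sides vanish triply at each of the three flexes,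
  so only the constant carries information.\<close>

lemma flex_relations:
  assumes z: "z ^ 3 = 1"
  shows prod_M: "M z * (z + x + w * y) * (z + x + w ^ 2 * y) = 3 * z * x * B z"
    and prod_M': "M z * (z + w * x + y) * (z + w ^ 2 * x + y) = 3 * y * C z"
    and prod_ABC: "3 * (t - z) * A * B z * C z = z ^ 2 * (t ^ 3 - 1) * M z ^ 3"
proof -
  have z3: "z * (z * z) = 1" "z * (z * (z * a)) = a" for a
    using z by (simp_all add: power3_eq_cube flip: mult.assoc)
  show "M z * (z + x + w * y) * (z + x + w ^ 2 * y) = 3 * z * x * B z"
    by (simp add: power2_eq_square power3_eq_cube algebra_simps reduce z3)
  show "M z * (z + w * x + y) * (z + w ^ 2 * x + y) = 3 * y * C z"
    by (simp add: power2_eq_square power3_eq_cube algebra_simps reduce z3)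
  show "3 * (t - z) * A * B z * C z = z ^ 2 * (t ^ 3 - 1) * M z ^ 3"
    by (simp add: power2_eq_square power3_eq_cube algebra_simps reduce z3)
qed

text \<open>The \<open>B z\<close> are the linear factors of
  \<open>1 + x ^ 3 + (t * y) ^ 3 - 3 * x * (t * y)\<close>, and the \<open>M z\<close> multiply to
  \<open>1 + (x + y) ^ 3\<close>; the cubic does the rest.\<close>

lemma global_relations:
  shows prod_B: "B 1 * B w * B (w ^ 2) = (t ^ 3 - 1) * y ^ 3"
    and prod_M3: "M 1 * M w * M (w ^ 2) = 3 * x * y * A"
    and prod_d: "(t - 1) * (t - w) * (t - w ^ 2) = t ^ 3 - 1"
  by (simp_all add: power2_eq_square power3_eq_cube algebra_simps reduce)

lemma disc_nz: "t ^ 3 - 1 \<noteq> 0"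
  using t_mu3 by simp

lemma mu3_square:
  fixes z :: 'a
  assumes "z ^ 3 = 1"
  shows "(z ^ 2) ^ 3 = 1"
proof -
  have "(z ^ 2) ^ 3 = z ^ (3 * 2)" by (subst power_mult [symmetric]) simp
  also have "\<dots> = (z ^ 3) ^ 2" by (rule power_mult)
  finally show ?thesis using assms by simp
qed

lemma t_neq: "z ^ 3 = 1 \<Longrightarrow> t \<noteq> z"
  using t_mu3 by auto

section \<open>Symbol relations from products and pencils of lines\<close>

lemma s_prod3_left:
  assumes "f \<in> K" "g \<in> K" "h \<in> K" "u \<in> K" "f \<noteq> 0" "g \<noteq> 0" "h \<noteq> 0" "u \<noteq> 0"
  shows "s (f * g * h) u = s f u + s g u + s h u"
  using assms by (simp add: s_mult_left K_mult)

lemma s_prod_left: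
  assumes z: "z \<in> k" "z ^ 3 = 1" and g: "g \<in> K" "g \<noteq> 0"
  shows s_prod_M: "s (M z) g + s (z + x + w * y) g + s (z + x + w ^ 2 * y) g = s 3 g + s x g + s (B z) g"
    and s_prod_M': "s (M z) g + s (z + w * x + y) g + s (z + w ^ 2 * x + y) g = s 3 g + s y g + s (C z) g"
    and s_prod_ABC: "s 3 g + s (t - z) g + s A g + s (B z) g + s (C z) g = s (t ^ 3 - 1) g + 3 * s (M z) g"
proof -
  have K: "x \<in> K" "y \<in> K" "z \<in> K" "w \<in> K" "t \<in> K"
    using z x_K y_K t_k w_k k_imp_K by auto
  note simps = K K_closed g nz[OF z] x_nz y_nz three disc_nz
  have "s (M z * (z + x + w * y) * (z + x + w ^ 2 * y)) g = s (z * (3 * x * B z)) g"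
    using prod_M[OF z(2)] by (simp add: mult_ac)
  also have "\<dots> = s (3 * x * B z) g"
    using z by (intro s_unit_left) (auto simp: simps)
  finally show "s (M z) g + s (z + x + w * y) g + s (z + x + w ^ 2 * y) g = s 3 g + s x g + s (B z) g"
    by (simp add: s_prod3_left simps)
  have "s (M z * (z + w * x + y) * (z + w ^ 2 * x + y)) g = s (3 * y * C z) g"
    using prod_M'[OF z(2)] by simp
  thus "s (M z) g + s (z + w * x + y) g + s (z + w ^ 2 * x + y) g = s 3 g + s y g + s (C z) g"
    by (simp add: s_prod3_left simps)
  have "s (3 * (t - z) * A * B z * C z) g = s (z ^ 2 * ((t ^ 3 - 1) * M z ^ 3)) g"
    using prod_ABC[OF z(2)] by (simp add: mult_ac)
  also have "\<dots> = s ((t ^ 3 - 1) * M z ^ 3) g"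
    using z mu3_square[OF z(2)] t_mu3 by (intro s_unit_left) (auto simp: simps k_closed)
  finally show "s 3 g + s (t - z) g + s A g + s (B z) g + s (C z) g = s (t ^ 3 - 1) g + 3 * s (M z) g"
    using t_neq[OF z(2)] t_mu3
    by (simp add: s_mult_left s_power_left simps del: left_diff_distrib_numeral right_diff_distrib_numeral)
qed

text \<open>Each tangent shares a pencil with \<open>M z\<close> and a simpler line:
  \<open>A - M z = t - z\<close>, \<open>B z - M z = z ^ 2 * (t - z) * y\<close> and
  \<open>C z - z * M z = (t - z) * x\<close>.\<close>

lemma s_flex_pencil:
  assumes z: "z \<in> k" "z ^ 3 = 1"
  shows s_A_M: "s A (M z) = s A (t - z) + s (t - z) (M z)"
    and s_B_M: "s (B z) (M z) = s (B z) (t - z) + s (B z) y + s (t - z) (M z) + s y (M z)"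
    and s_C_M: "s (C z) (M z) = s (C z) (t - z) + s (C z) x + s (t - z) (M z) + s x (M z)"
proof -
  have K: "x \<in> K" "y \<in> K" "z \<in> K" "w \<in> K" "t \<in> K"
    using z x_K y_K t_k w_k k_imp_K by auto
  note simps = K K_closed nz[OF z] x_nz y_nz three disc_nz
  have z3: "z * (z * z) = 1" "z * (z * (z * a)) = a" for a
    using z by (simp_all add: power3_eq_cube flip: mult.assoc)
  have z2: "z ^ 2 \<in> k" "(z ^ 2) ^ 3 = 1"
    using z mu3_square[OF z(2)] by (auto simp: k_closed simp del: power_mult_numeral)
  show "s A (M z) = s A (t - z) + s (t - z) (M z)"
    by (intro s_pencil) (use t_neq[OF z(2)] in \<open>auto simp: simps\<close>)
  have "s (B z) (M z) = s (B z) (z ^ 2 * ((t - z) * y)) + s (z ^ 2 * ((t - z) * y)) (M z)"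
    by (intro s_pencil; (simp add: simps z2 t_neq[OF z(2)]; fail | simp add: z3 power2_eq_square algebra_simps))
  also have "\<dots> = s (B z) ((t - z) * y) + s ((t - z) * y) (M z)"
    using z2 t_neq[OF z(2)] by (subst s_unit_right, simp_all add: simps) (subst s_unit_left; simp add: simps)
  finally show "s (B z) (M z) = s (B z) (t - z) + s (B z) y + s (t - z) (M z) + s y (M z)"
    using t_neq[OF z(2)] by (simp add: s_mult_left s_mult_right simps)
  have "s (C z) (z * M z) = s (C z) ((t - z) * x) + s ((t - z) * x) (z * M z)"
    by (intro s_pencil; (simp add: simps t_neq[OF z(2)]; fail | simp add: power2_eq_square algebra_simps))
  thus "s (C z) (M z) = s (C z) (t - z) + s (C z) x + s (t - z) (M z) + s x (M z)"
    using t_neq[OF z(2)] by (simp add: s_unit_left s_unit_right z s_mult_left s_mult_right simps)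
qed

text \<open>\<open>M z\<close> minus the other line is \<open>1 - w\<close> or
  \<open>1 - w ^ 2\<close> times a coordinate; doubling turns these constants into \<open>3\<close>
  by \<open>s_one_minus_w2\<close>.\<close>

lemma s_M_pencil:
  assumes z: "z \<in> k" "z ^ 3 = 1"
  shows "2 * s (M z) (z + x + w * y) = s (M z) 3 + 2 * s (M z) y + s 3 (z + x + w * y) + 2 * s y (z + x + w * y)"
    and "2 * s (M z) (z + x + w ^ 2 * y) = s (M z) 3 + 2 * s (M z) y + s 3 (z + x + w ^ 2 * y) + 2 * s y (z + x + w ^ 2 * y)"
    and "2 * s (M z) (z + w * x + y) = s (M z) 3 + 2 * s (M z) x + s 3 (z + w * x + y) + 2 * s x (z + w * x + y)"
    and "2 * s (M z) (z + w ^ 2 * x + y) = s (M z) 3 + 2 * s (M z) x + s 3 (z + w ^ 2 * x + y) + 2 * s x (z + w ^ 2 * x + y)"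
proof -
  have K: "x \<in> K" "y \<in> K" "z \<in> K" "w \<in> K" "t \<in> K"
    using z x_K y_K t_k w_k k_imp_K by auto
  have e: "1 - w ^ 2 \<noteq> 0" using one_minus_w three by (metis mult_zero_right)
  note simps = K K_closed nz[OF z] x_nz y_nz three disc_nz e one_minus_w(1)
  have *: "2 * s (M z) f = s (M z) 3 + 2 * s (M z) v + s 3 f + 2 * s v f"
    if "f \<in> K" "f \<noteq> 0" "v \<in> K" "v \<noteq> 0" "M z - f = u * v" "u \<in> {1 - w, 1 - w ^ 2}" for f u v
  proof -
    have "u \<noteq> 0" "u \<in> K" using that e one_minus_w(1) K by (auto simp: K_closed)
    have "s (M z) f = s (M z) (u * v) + s (u * v) f"
      using that \<open>u \<noteq> 0\<close> by (intro s_pencil) (auto simp: simps)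
    thus ?thesis
      using that \<open>u \<noteq> 0\<close> \<open>u \<in> K\<close>
      using s_one_minus_w2[of "M z"] s_one_minus_w2[of f] by (auto simp: s_mult_left s_mult_right simps)
  qed
  show "2 * s (M z) (z + x + w * y) = s (M z) 3 + 2 * s (M z) y + s 3 (z + x + w * y) + 2 * s y (z + x + w * y)"
    by (rule *[of _ _ "1 - w"]; (simp add: simps; fail | simp add: algebra_simps))
  show "2 * s (M z) (z + x + w ^ 2 * y) = s (M z) 3 + 2 * s (M z) y + s 3 (z + x + w ^ 2 * y) + 2 * s y (z + x + w ^ 2 * y)"
    by (rule *[of _ _ "1 - w ^ 2"]; (simp add: simps; fail | simp add: algebra_simps))
  show "2 * s (M z) (z + w * x + y) = s (M z) 3 + 2 * s (M z) x + s 3 (z + w * x + y) + 2 * s x (z + w * x + y)"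
    by (rule *[of _ _ "1 - w"]; (simp add: simps; fail | simp add: algebra_simps))
  show "2 * s (M z) (z + w ^ 2 * x + y) = s (M z) 3 + 2 * s (M z) x + s 3 (z + w ^ 2 * x + y) + 2 * s x (z + w ^ 2 * x + y)"
    by (rule *[of _ _ "1 - w ^ 2"]; (simp add: simps; fail | simp add: algebra_simps))
qed

text \<open>The two pencils through \<open>(-z : 0 : 1)\<close> and \<open>(0 : -z : 1)\<close> compute \<open>s (M z) x - 2 * s (M z) y\<close> and
  \<open>s (M z) y - 2 * s (M z) x\<close>, hence \<open>s (M z) y\<close>.\<close>

lemma s_M_y:
  assumes z: "z \<in> k" "z ^ 3 = 1"
  shows "- 6 * s (M z) y = - 3 * s 3 y - 2 * s x y - s (B z) 3 +
    s (t - z) 3 + s A 3 - s (t ^ 3 - 1) 3 + 2 * s (B z) (t - z) + 2 * s (t ^ 3 - 1) (t - z)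
    - 2 * s 3 (t - z) - 2 * s A (t - z)"
proof -
  have K: "x \<in> K" "y \<in> K" "z \<in> K" "w \<in> K" "t \<in> K"
    using z x_K y_K t_k w_k k_imp_K by auto
  note simps = K K_closed nz[OF z] x_nz y_nz three disc_nz
  have self: "s (M z) (M z) = 0" "s x x = 0" "s y y = 0" "s 3 3 = 0" "s (t - z) (t - z) = 0"
    by (intro s_self; simp add: simps t_neq[OF z(2)])+
  let ?p = "z + x + w * y" and ?q = "z + x + w ^ 2 * y"
  let ?p' = "z + w * x + y" and ?q' = "z + w ^ 2 * x + y"
  have anti: "s ?p (M z) = - s (M z) ?p" "s ?q (M z) = - s (M z) ?q"
    "s ?p' (M z) = - s (M z) ?p'" "s ?q' (M z) = - s (M z) ?q'"
    "s ?p 3 = - s 3 ?p" "s ?q 3 = - s 3 ?q" "s ?p' 3 = - s 3 ?p'" "s ?q' 3 = - s 3 ?q'"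
    "s ?p y = - s y ?p" "s ?q y = - s y ?q" "s ?p' x = - s x ?p'" "s ?q' x = - s x ?q'"
    "s x (M z) = - s (M z) x" "s y (M z) = - s (M z) y" "s 3 (M z) = - s (M z) 3" "s x 3 = - s 3 x"
    "s y 3 = - s 3 y" "s y x = - s x y" "s (M z) (t - z) = - s (t - z) (M z)"
    "s 3 (t - z) = - s (t - z) 3"
    by (intro s_antisym; simp add: simps t_neq[OF z(2)])+
  have inK: "M z \<in> K" "3 \<in> K" "t - z \<in> K" using K by (auto simp: K_closed)
  \<comment> \<open>The sum of the symbols of \<open>M z\<close> with \<open>?p\<close> and
    \<open>?q\<close> is computed twice, by pencils in \<open>1\<close> and by the product relation
    in \<open>2\<close>; \<open>3\<close> and \<open>4\<close> then remove \<open>?p\<close> and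
    \<open>?q\<close> from the former.\<close>
  have 1: "2 * s (M z) ?p + 2 * s (M z) ?q = 2 * s (M z) 3 + 4 * s (M z) y
      + s 3 ?p + s 3 ?q + 2 * s y ?p + 2 * s y ?q"
    using s_M_pencil(1,2)[OF z] by linarith
  have 2: "- (s (M z) ?p + s (M z) ?q) = s 3 (M z) + s x (M z) + s (B z) (M z)"
    using s_prod_M[OF z, of "M z", OF inK(1) nz(6)[OF z]] self(1) anti(1,2) by linarith
  have 3: "s 3 ?p + s 3 ?q = s (M z) 3 - s x 3 - s (B z) 3"
    using s_prod_M[OF z, of 3, OF inK(2) three] self(4) anti(5,6) by linarith
  have 4: "s y ?p + s y ?q = s (M z) y - s 3 y - s x y - s (B z) y"
    using s_prod_M[OF z, of y, OF y_K y_nz] self(3) anti(9,10) by linarith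
  have a1: "2 * s (M z) ?p' + 2 * s (M z) ?q' = 2 * s (M z) 3 + 4 * s (M z) x
      + s 3 ?p' + s 3 ?q' + 2 * s x ?p' + 2 * s x ?q'"
    using s_M_pencil(3,4)[OF z] by linarith
  have a2: "- (s (M z) ?p' + s (M z) ?q') = s 3 (M z) + s y (M z) + s (C z) (M z)"
    using s_prod_M'[OF z, of "M z", OF inK(1) nz(6)[OF z]] self(1) anti(3,4) by linarith
  have a3: "s 3 ?p' + s 3 ?q' = s (M z) 3 - s y 3 - s (C z) 3"
    using s_prod_M'[OF z, of 3, OF inK(2) three] self(4) anti(7,8) by linarith
  have a4: "s x ?p' + s x ?q' = s (M z) x - s 3 x - s y x - s (C z) x"
    using s_prod_M'[OF z, of x, OF x_K x_nz] self(2) anti(11,12) by linarith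
  have "2 * s (M z) x - 4 * s (M z) y = - 2 * s 3 y - 2 * s x y + s 3 x - s (B z) 3
      + s (M z) 3 + 2 * s (t - z) (M z) + 2 * s (B z) (t - z)"
    using 1 2 3 4 s_B_M[OF z] anti(13-16) by linarith
  moreover have "2 * s (M z) y - 4 * s (M z) x = - 2 * s 3 x + 2 * s x y + s 3 y - s (C z) 3
      + s (M z) 3 + 2 * s (t - z) (M z) + 2 * s (C z) (t - z)"
    using a1 a2 a3 a4 s_C_M[OF z] anti(13-18) by linarith
  \<comment> \<open>Twice the first relation plus the second, which eliminates
    \<open>s (M z) x\<close>.\<close>
  ultimately have "- 6 * s (M z) y = - 3 * s 3 y - 2 * s x y - 2 * s (B z) 3 - s (C z) 3
      + 3 * s (M z) 3 + 6 * s (t - z) (M z) + 4 * s (B z) (t - z) + 2 * s (C z) (t - z)"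
    by linarith
  \<comment> \<open>Pairing \<open>prod_ABC\<close> with the constants \<open>3\<close> and
    \<open>t - z\<close> removes \<open>C z\<close> and \<open>M z\<close> from the symbols with a
    constant entry.\<close>
  moreover have "s (t - z) 3 + s A 3 + s (B z) 3 + s (C z) 3 = s (t ^ 3 - 1) 3 + 3 * s (M z) 3"
    using s_prod_ABC[OF z, of 3, OF inK(2) three] self(4) by linarith
  moreover have "s 3 (t - z) + s A (t - z) + s (B z) (t - z) + s (C z) (t - z)
      = s (t ^ 3 - 1) (t - z) + 3 * s (M z) (t - z)"
    using s_prod_ABC[OF z, of "t - z", OF inK(3) nz(2)[OF z]] self(5) by linarith
  ultimately show ?thesis
    using anti(19,20) by linarith
qed

text \<open>\<open>C z\<close> is eliminated by pairing \<open>prod_ABC\<close> with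
  \<open>A\<close> and with \<open>B z\<close>, and the symbols of \<open>M z\<close> with
  \<open>A\<close> and \<open>B z\<close> by their pencils. The term \<open>3 * s (B z) A\<close> is
  kept, since it becomes computable through \<open>prod_B\<close> after summation over
  \<open>z\<close>.\<close>

lemma s_xi:
  assumes z: "z \<in> k" "z ^ 3 = 1"
  shows "s (- (A / B z)) (- (C z / A)) =
    s 3 A - 2 * s (t - z) A - s (t ^ 3 - 1) A + s (t ^ 3 - 1) (B z) - s 3 (B z)
    - 2 * s (B z) (t - z) - 3 * s (B z) y + 3 * s (M z) y + 3 * s (B z) A"
proof -
  have K: "x \<in> K" "y \<in> K" "z \<in> K" "w \<in> K" "t \<in> K"
    using z x_K y_K t_k w_k k_imp_K by auto
  note simps = K K_closed nz[OF z] x_nz y_nz three disc_nz t_neq[OF z(2)]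
  have "s (- (A / B z)) (- (C z / A)) = s (A / B z) (C z / A)"
    by (subst s_uminus_left, simp_all add: simps del: minus_divide_left) (subst s_uminus_right; simp add: simps)
  also have "\<dots> = s A (C z) - s A A - (s (B z) (C z) - s (B z) A)"
    by (simp add: s_divide_left s_divide_right simps)
  finally have "s (- (A / B z)) (- (C z / A)) = s A (C z) - s (B z) (C z) + s (B z) A"
    by (simp add: s_self simps)
  moreover have anti: "s A (C z) = - s (C z) A" "s (B z) (C z) = - s (C z) (B z)"
    "s A (B z) = - s (B z) A" "s (M z) A = - s A (M z)" "s (M z) (B z) = - s (B z) (M z)"
    "s (t - z) A = - s A (t - z)" "s (t - z) (B z) = - s (B z) (t - z)" "s y (M z) = - s (M z) y"
    by (intro s_antisym; (simp add: simps; fail))+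
  moreover have "s 3 A + s (t - z) A + s (B z) A + s (C z) A = s (t ^ 3 - 1) A + 3 * s (M z) A"
    using s_prod_ABC[OF z, of A] s_self[of A] by (simp add: simps)
  moreover have "s 3 (B z) + s (t - z) (B z) + s A (B z) + s (C z) (B z)
      = s (t ^ 3 - 1) (B z) + 3 * s (M z) (B z)"
    using s_prod_ABC[OF z, of "B z"] s_self[of "B z"] by (simp add: simps)
  ultimately show ?thesis
    using s_A_M[OF z] s_B_M[OF z] by linarith
qed

lemma mu3_in_k: "1 \<in> k" "w \<in> k" "w ^ 2 \<in> k" "w ^ 3 = 1" "(w ^ 2) ^ 3 = 1" "(1::'a) ^ 3 = 1"
  using mu3_square[OF w3] by (auto simp: k_closed w3 simp del: power_mult_numeral)

text \<open>The sum of \<open>s_M_y\<close> over \<open>z\<close> expresses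
  \<open>- 6 * s A y\<close> by symbols with a constant entry. The sum of \<open>s_xi\<close>
  consists of \<open>3 * s x y\<close>, of \<open>- 6 * s A y\<close> and of the negatives of just
  these symbols.\<close>

lemma s_xi_sum:
  "s (- (A / B 1)) (- (C 1 / A)) + s (- (A / B w)) (- (C w / A)) +
     s (- (A / B (w ^ 2))) (- (C (w ^ 2) / A)) = 3 * s x y"
proof -
  note z1 = mu3_in_k(1,6) and zw = mu3_in_k(2,4) and zw2 = mu3_in_k(3,5)
  have K: "x \<in> K" "y \<in> K" "w \<in> K" "t \<in> K" "w ^ 2 \<in> K"
    using x_K y_K t_k w_k k_imp_K by (auto simp: k_closed)
  have BK: "B 1 \<in> K" "B w \<in> K" "B (w ^ 2) \<in> K" "M 1 \<in> K" "M w \<in> K" "M (w ^ 2) \<in> K"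
    "t - 1 \<in> K" "t - w \<in> K" "t - w ^ 2 \<in> K" "t ^ 3 - 1 \<in> K" "A \<in> K" "3 \<in> K"
    using K by (auto simp: K_closed)
  note nzs = nz(1-6)[OF z1] nz(1-6)[OF zw] nz(1-6)[OF zw2]
  have B_sum: "s (B 1) g + s (B w) g + s (B (w ^ 2)) g = s (t ^ 3 - 1) g + 3 * s y g"
    if g: "g \<in> K" "g \<noteq> 0" for g
  proof -
    have "s (B 1 * B w * B (w ^ 2)) g = s ((t ^ 3 - 1) * y ^ 3) g" by (simp only: prod_B)
    moreover have "s ((t ^ 3 - 1) * y ^ 3) g = s (t ^ 3 - 1) g + 3 * s y g"
      using g BK(10) disc_nz y_nz y_K by (subst s_mult_left) (auto simp: s_power_left K_power)
    moreover have "s (B 1 * B w * B (w ^ 2)) g = s (B 1) g + s (B w) g + s (B (w ^ 2)) g"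
      using g BK nzs by (intro s_prod3_left)
    ultimately show ?thesis by simp
  qed
  have M_sum: "s (M 1) y + s (M w) y + s (M (w ^ 2)) y = s 3 y + s x y + s A y"
  proof -
    have "s (M 1 * M w * M (w ^ 2)) y = s (3 * x * y * A) y" by (simp only: prod_M3)
    moreover have "s (3 * x * y * A) y = s 3 y + s x y + s A y"
      using K BK nzs x_nz y_nz three by (simp add: s_mult_left K_mult s_self)
    moreover have "s (M 1 * M w * M (w ^ 2)) y = s (M 1) y + s (M w) y + s (M (w ^ 2)) y"
      using y_K y_nz BK nzs by (intro s_prod3_left)
    ultimately show ?thesis by simp
  qed
  have d_sum: "s (t - 1) g + s (t - w) g + s (t - w ^ 2) g = s (t ^ 3 - 1) g"
    if g: "g \<in> K" "g \<noteq> 0" for g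
  proof -
    have "s ((t - 1) * (t - w) * (t - w ^ 2)) g = s (t ^ 3 - 1) g" by (simp only: prod_d)
    moreover have "s ((t - 1) * (t - w) * (t - w ^ 2)) g = s (t - 1) g + s (t - w) g + s (t - w ^ 2) g"
      using g BK nzs by (intro s_prod3_left)
    ultimately show ?thesis by simp
  qed
  let ?D = "t ^ 3 - 1"
  \<comment> \<open>Both entries vary with \<open>z\<close> here, so no product formula applies.
    \<open>U\<close> stays unevaluated and cancels, entering with \<open>+ 2\<close> through
    \<open>s_M_y\<close> and with \<open>- 2\<close> through \<open>s_xi\<close>.\<close>
  define U where "U = s (B 1) (t - 1) + s (B w) (t - w) + s (B (w ^ 2)) (t - w ^ 2)"
  have self: "s ?D ?D = 0" "s y y = 0"
    using BK disc_nz y_K y_nz by (auto intro: s_self)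
  have anti: "s A (t - 1) = - s (t - 1) A" "s A (t - w) = - s (t - w) A" "s A (t - w ^ 2) = - s (t - w ^ 2) A"
    "s 3 (t - 1) = - s (t - 1) 3" "s 3 (t - w) = - s (t - w) 3" "s 3 (t - w ^ 2) = - s (t - w ^ 2) 3"
    "s ?D (t - 1) = - s (t - 1) ?D" "s ?D (t - w) = - s (t - w) ?D" "s ?D (t - w ^ 2) = - s (t - w ^ 2) ?D"
    "s ?D (B 1) = - s (B 1) ?D" "s ?D (B w) = - s (B w) ?D" "s ?D (B (w ^ 2)) = - s (B (w ^ 2)) ?D"
    "s 3 (B 1) = - s (B 1) 3" "s 3 (B w) = - s (B w) 3" "s 3 (B (w ^ 2)) = - s (B (w ^ 2)) 3"
    "s ?D y = - s y ?D" "s 3 A = - s A 3" "s 3 y = - s y 3" "s y A = - s A y"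
    by (rule s_antisym; rule BK K nzs three disc_nz y_nz)+
  have dA: "s (t - 1) A + s (t - w) A + s (t - w ^ 2) A = s ?D A"
    using d_sum[OF BK(11) nzs(3)] .
  have Ad: "s A (t - 1) + s A (t - w) + s A (t - w ^ 2) = - s ?D A"
    using dA anti(1-3) by linarith
  have d3: "s (t - 1) 3 + s (t - w) 3 + s (t - w ^ 2) 3 = s ?D 3"
    using d_sum[OF BK(12) three] .
  have td: "s 3 (t - 1) + s 3 (t - w) + s 3 (t - w ^ 2) = - s ?D 3"
    using d3 anti(4-6) by linarith
  have Dd: "s ?D (t - 1) + s ?D (t - w) + s ?D (t - w ^ 2) = 0"
    using d_sum[OF BK(10) disc_nz] anti(7-9) self by linarith
  have DB: "s ?D (B 1) + s ?D (B w) + s ?D (B (w ^ 2)) = 3 * s ?D y"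
    using B_sum[OF BK(10) disc_nz] anti(10-12,16) self by linarith
  have B3: "s (B 1) 3 + s (B w) 3 + s (B (w ^ 2)) 3 = s ?D 3 + 3 * s y 3"
    using B_sum[OF BK(12) three] .
  have tB: "s 3 (B 1) + s 3 (B w) + s 3 (B (w ^ 2)) = - s ?D 3 - 3 * s y 3"
    using B3 anti(13-15) by linarith
  have By: "s (B 1) y + s (B w) y + s (B (w ^ 2)) y = s ?D y"
    using B_sum[OF y_K y_nz] self by linarith
  have BA: "s (B 1) A + s (B w) A + s (B (w ^ 2)) A = s ?D A + 3 * s y A"
    using B_sum[OF BK(11) nzs(3)] .
  have "- 6 * s 3 y - 6 * s x y - 6 * s A y = - 9 * s 3 y - 6 * s x y - s ?D 3 - 3 * s y 3
     + s ?D 3 + 3 * s A 3 - 3 * s ?D 3 + 2 * U + 2 * s ?D 3 + 2 * s ?D A"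
    using U_def s_M_y[OF z1] s_M_y[OF zw] s_M_y[OF zw2] M_sum B3 d3 Dd td Ad by linarith
  hence U_eq: "- 6 * s A y = 3 * s A 3 - s ?D 3 + 2 * s ?D A + 2 * U"
    using anti(17-19) by linarith
  have "s (- (A / B 1)) (- (C 1 / A)) + s (- (A / B w)) (- (C w / A)) +
     s (- (A / B (w ^ 2))) (- (C (w ^ 2) / A)) =
     3 * s 3 A - 2 * s ?D A - 3 * s ?D A + 3 * s ?D y + s ?D 3 + 3 * s y 3
     - 2 * U - 3 * s ?D y + 3 * s 3 y + 3 * s x y + 3 * s A y + 3 * s ?D A + 9 * s y A"
    using U_def s_xi[OF z1] s_xi[OF zw] s_xi[OF zw2] dA DB tB By M_sum BA by linarith
  also have "\<dots> = 3 * s x y"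
    using U_eq anti(17-19) by linarith
  finally show ?thesis .
qed

end

section \<open>Torsion and rational functionals\<close>

definition rat_smult :: "rat \<Rightarrow> ('b \<Rightarrow>\<^sub>0 rat) \<Rightarrow> ('b \<Rightarrow>\<^sub>0 rat)" where
  "rat_smult q p = Poly_Mapping.map ((*) q) p"

definition rat_frag :: "('b \<Rightarrow>\<^sub>0 int) \<Rightarrow> ('b \<Rightarrow>\<^sub>0 rat)" where
  "rat_frag p = Poly_Mapping.map of_int p"

lemma lookup_rat_smult [simp]: "Poly_Mapping.lookup (rat_smult q p) k = q * Poly_Mapping.lookup p k"
  by (simp add: rat_smult_def Poly_Mapping.map.rep_eq when_def)

lemma lookup_rat_frag [simp]: "Poly_Mapping.lookup (rat_frag p) k = of_int (Poly_Mapping.lookup p k)"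
  by (simp add: rat_frag_def Poly_Mapping.map.rep_eq when_def)

lemma rat_frag_add: "rat_frag (p + q) = rat_frag p + rat_frag q"
  by (rule poly_mapping_eqI) (simp add: Poly_Mapping.lookup_add)

lemma rat_frag_eq_iff: "rat_frag p = rat_frag q \<longleftrightarrow> p = q"
  by (metis lookup_rat_frag of_int_eq_iff poly_mapping_eqI)

lemma rat_smult_of_int_frag: "rat_smult (of_int n) (rat_frag p) = rat_frag (frag_cmul n p)"
  by (rule poly_mapping_eqI) simp

lemma rat_smult_one: "rat_smult 1 u = u"
  by (rule poly_mapping_eqI) simp

lemma rat_smult_smult: "rat_smult a (rat_smult b u) = rat_smult (a * b) u"
  by (rule poly_mapping_eqI) simp

lemma rat_smult_mult_add:
  "rat_smult (a * b) (u + v) = rat_smult b (rat_smult a u) + rat_smult a (rat_smult b v)"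
  by (rule poly_mapping_eqI) (simp add: Poly_Mapping.lookup_add algebra_simps)

lemma vector_space_rat_smult: "vector_space rat_smult"
  by unfold_locales (auto intro!: poly_mapping_eqI simp: Poly_Mapping.lookup_add algebra_simps)

lemma vector_space_pair_rat_smult: "vector_space_pair rat_smult ((*) :: rat \<Rightarrow> rat \<Rightarrow> rat)"
  by (intro vector_space_pair.intro vector_space_rat_smult) (unfold_locales, auto simp: algebra_simps)

text \<open>A basis of the span of \<open>S\<close> stays independent when \<open>w\<close> is
  added, so the values \<open>1\<close> at \<open>w\<close> and \<open>0\<close> on the basis may be
  prescribed.\<close>

lemma separating_functional:
  fixes w :: "'b \<Rightarrow>\<^sub>0 rat"
  assumes "w \<notin> module.span rat_smult S"
  shows "\<exists>\<phi>. Vector_Spaces.linear rat_smult (*) \<phi> \<and> (\<forall>v\<in>S. \<phi> v = 0) \<and> \<phi> w = (1::rat)"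
proof -
  interpret V: vector_space rat_smult by (rule vector_space_rat_smult)
  interpret P: vector_space_pair rat_smult "(*) :: rat \<Rightarrow> rat \<Rightarrow> rat" by (rule vector_space_pair_rat_smult)
  obtain B where B: "B \<subseteq> S" "\<not> V.dependent B" "S \<subseteq> V.span B"
    using V.maximal_independent_subset[of S] by blast
  have wB: "w \<notin> V.span B"
    using assms V.span_mono[OF B(1)] by blast
  have "\<not> V.dependent (insert w B)"
    using B(2) wB by (metis V.independent_insertI)
  then obtain \<phi> where \<phi>: "Vector_Spaces.linear rat_smult (*) \<phi>"
    "\<forall>x\<in>insert w B. \<phi> x = (if x = w then 1 else 0)"
    using P.linear_independent_extend[of "insert w B" "\<lambda>x. if x = w then 1 else 0"] by blast
  have "\<phi> v = 0" if "v \<in> S" for v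
  proof (rule P.linear_eq_0_on_span[OF \<phi>(1)])
    show "v \<in> V.span B" using that B(3) by blast
    show "\<phi> x = 0" if "x \<in> B" for x
      using that \<phi>(2) wB V.span_base by (metis insertI2)
  qed
  with \<phi> show ?thesis by auto
qed

text \<open>If \<open>w\<close> were outside the rational span of \<open>R\<close>, a functional
  vanishing on \<open>R\<close> would detect it. Inside the span, clearing denominators gives a
  multiple in \<open>R\<close>.\<close>

lemma torsion_modulo_subgroup:
  fixes R :: "('b \<Rightarrow>\<^sub>0 int) set"
  assumes zero: "0 \<in> R" and diff: "\<And>u v. u \<in> R \<Longrightarrow> v \<in> R \<Longrightarrow> u - v \<in> R"
    and functionals: "\<And>\<phi> :: ('b \<Rightarrow>\<^sub>0 int) \<Rightarrow> rat.
      \<lbrakk>\<And>u v. \<phi> (u + v) = \<phi> u + \<phi> v; \<And>u. u \<in> R \<Longrightarrow> \<phi> u = 0\<rbrakk> \<Longrightarrow> \<phi> w = 0"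
  obtains n :: nat where "n > 0" "frag_cmul (int n) w \<in> R"
proof -
  interpret V: vector_space "rat_smult :: rat \<Rightarrow> ('b \<Rightarrow>\<^sub>0 rat) \<Rightarrow> ('b \<Rightarrow>\<^sub>0 rat)" by (rule vector_space_rat_smult)
  have minus: "- u \<in> R" if "u \<in> R" for u using diff[OF zero that] by simp
  have add: "u + v \<in> R" if "u \<in> R" "v \<in> R" for u v using diff[OF that(1) minus[OF that(2)]] by simp
  have cmul_nat: "frag_cmul (int n) u \<in> R" if "u \<in> R" for n u
    by (induction n) (auto simp: zero frag_cmul_distrib intro: add that)
  have cmul: "frag_cmul n u \<in> R" if "u \<in> R" for n u
  proof (cases "n \<ge> 0")
    case True
    thus ?thesis using cmul_nat[OF that, of "nat n"] by simp
  next
    case False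
    hence "frag_cmul n u = - frag_cmul (int (nat (- n))) u"
      by simp
    thus ?thesis using minus[OF cmul_nat[OF that, of "nat (- n)"]] by simp
  qed
  \<comment> \<open>The saturation of \<open>R\<close>: a subspace containing \<open>R\<close>,
    hence containing its span.\<close>
  define S where "S = {v. \<exists>n::nat. n > 0 \<and> rat_smult (of_nat n) v \<in> rat_frag ` R}"
  have S_D: "\<exists>n r. n > 0 \<and> r \<in> R \<and> rat_smult (of_nat n) v = rat_frag r" if "v \<in> S" for v
    using that by (auto simp: S_def image_iff)
  have "rat_frag w \<in> V.span (rat_frag ` R)"
  proof (rule ccontr)
    assume "rat_frag w \<notin> V.span (rat_frag ` R)"
    hence "\<exists>\<phi>. Vector_Spaces.linear rat_smult (*) \<phi> \<and> (\<forall>v\<in>rat_frag ` R. \<phi> v = 0) \<and>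
        \<phi> (rat_frag w) = (1::rat)"
      by (rule separating_functional)
    then obtain \<phi> where \<phi>: "Vector_Spaces.linear rat_smult (*) \<phi>"
      "\<forall>v\<in>rat_frag ` R. \<phi> v = 0" "\<phi> (rat_frag w) = (1::rat)"
      by blast
    interpret \<phi>: Vector_Spaces.linear rat_smult "(*)" \<phi> by (rule \<phi>)
    have "\<phi> (rat_frag w) = 0"
      by (rule functionals[of "\<lambda>u. \<phi> (rat_frag u)"]) (use \<phi> in \<open>auto simp: rat_frag_add \<phi>.add\<close>)
    with \<phi> show False by simp
  qed
  also have "V.span (rat_frag ` R) \<subseteq> S"
  proof (rule V.span_minimal)
    show "rat_frag ` R \<subseteq> S"
      unfolding S_def by (auto intro!: exI[of _ "1::nat"] simp: rat_smult_one)
    show "V.subspace S"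
    proof (rule V.subspaceI)
      have "rat_smult (of_nat 1) 0 = rat_frag 0" by (rule poly_mapping_eqI) simp
      hence "rat_smult (of_nat 1) 0 \<in> rat_frag ` R" using zero by (metis imageI)
      thus "0 \<in> S" unfolding S_def by (metis (mono_tags, lifting) mem_Collect_eq zero_less_one)
    next
      fix u v assume "u \<in> S" "v \<in> S"
      from S_D[OF this(1)] S_D[OF this(2)] obtain m n p q where *: "m > 0" "n > 0" "p \<in> R" "q \<in> R"
        "rat_smult (of_nat m) u = rat_frag p" "rat_smult (of_nat n) v = rat_frag q"
        by blast
      have "rat_smult (of_nat (m * n)) (u + v) =
          rat_smult (of_nat n) (rat_smult (of_nat m) u) + rat_smult (of_nat m) (rat_smult (of_nat n) v)"
        by (simp only: of_nat_mult rat_smult_mult_add)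
      also have "\<dots> = rat_frag (frag_cmul (int n) p + frag_cmul (int m) q)"
        using * rat_smult_of_int_frag[of "int n" p] rat_smult_of_int_frag[of "int m" q]
        by (simp add: rat_frag_add)
      finally have eq: "rat_smult (of_nat (m * n)) (u + v) = rat_frag (frag_cmul (int n) p + frag_cmul (int m) q)" .
      have "frag_cmul (int n) p + frag_cmul (int m) q \<in> R"
        using * by (intro add cmul) auto
      with eq have "rat_smult (of_nat (m * n)) (u + v) \<in> rat_frag ` R" by simp
      moreover have "m * n > 0" using * by simp
      ultimately show "u + v \<in> S" unfolding S_def by (intro CollectI exI conjI)
    next
      fix c u assume "u \<in> S"
      from S_D[OF this] obtain m p where *: "m > 0" "p \<in> R" "rat_smult (of_nat m) u = rat_frag p"
        by blast
      obtain a b where ab: "quotient_of c = (a, b)" by fastforce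
      hence b: "b > 0" and c: "c = of_int a / of_int b"
        using quotient_of_denom_pos quotient_of_div by auto
      have "rat_smult (of_nat (m * nat b)) (rat_smult c u) = rat_smult (of_int a) (rat_smult (of_nat m) u)"
        using b by (simp add: c rat_smult_smult del: V.scale_scale)
      also have "\<dots> = rat_frag (frag_cmul a p)"
        using * by (simp add: rat_smult_of_int_frag)
      finally have "rat_smult (of_nat (m * nat b)) (rat_smult c u) \<in> rat_frag ` R"
        using cmul[OF *(2)] by simp
      moreover have "m * nat b > 0" using * b by simp
      ultimately show "rat_smult c u \<in> S" unfolding S_def by (intro CollectI exI conjI)
    qed
  qed
  finally have "rat_frag w \<in> S" .
  from S_D[OF this] obtain n r where "n > 0" "r \<in> R" "rat_smult (of_nat n) (rat_frag w) = rat_frag r"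
    by blast
  with rat_smult_of_int_frag[of "int n" w] show ?thesis
    using that by (simp add: rat_frag_eq_iff)
qed

section \<open>Characters of quotient groups\<close>

text \<open>Values are nonzero elements of a field instead of elements of a unit group, to match the
  type of \<open>tame\<close>.\<close>

locale multiplicative_character = group G for G (structure) +
  fixes h :: "'a \<Rightarrow> 'k::field"
  assumes h_mult: "\<lbrakk>x \<in> carrier G; y \<in> carrier G\<rbrakk> \<Longrightarrow> h (x \<otimes> y) = h x * h y"
    and h_nonzero: "x \<in> carrier G \<Longrightarrow> h x \<noteq> 0"
begin

lemma h_one: "h \<one> = 1"
proof -
  have "h \<one> * h \<one> = h \<one> * 1" using h_mult[of \<one> \<one>] by simp
  thus ?thesis using h_nonzero[of \<one>] by simp
qed

lemma h_inv: "x \<in> carrier G \<Longrightarrow> h (inv x) = inverse (h x)"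
  using h_mult[of "inv x" x] h_one by (simp add: l_inv inverse_unique[symmetric] mult.commute)

lemma h_generate:
  assumes S: "S \<subseteq> carrier G" "\<And>x. x \<in> S \<Longrightarrow> h x = 1" and g: "g \<in> generate G S"
  shows "h g = 1"
  using g
proof (induction rule: generate.induct)
  case (eng g1 g2)
  thus ?case using generate_in_carrier[OF S(1)] by (simp add: h_mult)
qed (use S h_one h_inv in auto)

text \<open>A character trivial on \<open>N\<close> is constant on the nonempty coset, so its image
  is a singleton; this gives meaning to the nested \<open>the_elem\<close> in
  \<open>tame_K2\<close>.\<close>

lemma the_elem_rcoset:
  assumes N: "subgroup N G" "\<And>n. n \<in> N \<Longrightarrow> h n = 1" and x: "x \<in> carrier G"
  shows "the_elem (h ` (N #> x)) = h x"
proof -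
  have "h ` (N #> x) = {h x}"
  proof
    show "h ` (N #> x) \<subseteq> {h x}"
      using N x by (auto simp: r_coset_def h_mult subgroup.mem_carrier)
    show "{h x} \<subseteq> h ` (N #> x)"
      using rcos_self[OF x N(1)] by blast
  qed
  thus ?thesis by simp
qed

text \<open>Applied twice, for the bilinear and for the Steinberg relations, as
  \<open>milnor_K2\<close> is formed by two successive quotients.\<close>

lemma quotient_character:
  assumes N: "N \<lhd> G" "\<And>n. n \<in> N \<Longrightarrow> h n = 1"
  shows "multiplicative_character (G Mod N) (\<lambda>c. the_elem (h ` c))"
proof -
  interpret N: normal N G by (rule N)
  have *: "the_elem (h ` (N #> x)) = h x" if "x \<in> carrier G" for x
    using that N by (intro the_elem_rcoset N.subgroup_axioms)
  show ?thesis
  proof (intro multiplicative_character.intro multiplicative_character_axioms.intro N.factorgroup_is_group)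
    fix c d assume "c \<in> carrier (G Mod N)" "d \<in> carrier (G Mod N)"
    then obtain x y where xy: "x \<in> carrier G" "y \<in> carrier G" "c = N #> x" "d = N #> y"
      by (auto simp: carrier_FactGroup)
    have "c \<otimes>\<^bsub>G Mod N\<^esub> d = N #> (x \<otimes> y)"
      using xy by (simp add: N.rcos_sum)
    thus "the_elem (h ` (c \<otimes>\<^bsub>G Mod N\<^esub> d)) = the_elem (h ` c) * the_elem (h ` d)"
      using xy * by (simp add: h_mult)
  next
    fix c assume "c \<in> carrier (G Mod N)"
    then obtain x where "x \<in> carrier G" "c = N #> x" by (auto simp: carrier_FactGroup)
    thus "the_elem (h ` c) \<noteq> 0" using * h_nonzero by auto
  qed
qed

end

section \<open>Tensor products\<close>

text \<open>Extends \<open>pure_tensor\<close> from generators to all formal sums, so that relations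
  can be handled before passing to the quotient.\<close>

definition tensor_class ::
  "('a, 'm) monoid_scheme \<Rightarrow> ('b, 'n) monoid_scheme \<Rightarrow> ('a \<times> 'b \<Rightarrow>\<^sub>0 int) \<Rightarrow> ('a \<times> 'b \<Rightarrow>\<^sub>0 int) set" where
  "tensor_class G H w = tensor_rels G H #>\<^bsub>free_Abelian_group (carrier G \<times> carrier H)\<^esub> w"

definition tensor_relators ::
  "('a, 'm) monoid_scheme \<Rightarrow> ('b, 'n) monoid_scheme \<Rightarrow> ('a \<times> 'b \<Rightarrow>\<^sub>0 int) set" where
  "tensor_relators G H =
       {frag_of (a \<otimes>\<^bsub>G\<^esub> a', b) - frag_of (a, b) - frag_of (a', b) | a a' b.
           a \<in> carrier G \<and> a' \<in> carrier G \<and> b \<in> carrier H}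
      \<union> {frag_of (a, b \<otimes>\<^bsub>H\<^esub> b') - frag_of (a, b) - frag_of (a, b') | a b b'.
           a \<in> carrier G \<and> b \<in> carrier H \<and> b' \<in> carrier H}"

lemma tensor_rels_eq:
  "tensor_rels G H = generate (free_Abelian_group (carrier G \<times> carrier H)) (tensor_relators G H)"
  by (simp add: tensor_rels_def tensor_relators_def)

lemma pure_tensor_eq: "pure_tensor G H a b = tensor_class G H (frag_of (a, b))"
  by (simp add: pure_tensor_def tensor_class_def)

locale tensor_product = G: comm_group G + H: comm_group H
  for G :: "('a, 'm) monoid_scheme" and H :: "('b, 'n) monoid_scheme"
begin

abbreviation "F \<equiv> free_Abelian_group (carrier G \<times> carrier H)"

sublocale F: comm_group F
  by (rule abelian_free_Abelian_group)

lemma frag_of_in_F: "a \<in> carrier G \<Longrightarrow> b \<in> carrier H \<Longrightarrow> frag_of (a, b) \<in> carrier F"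
  by simp

lemma diff_in_F: "u \<in> carrier F \<Longrightarrow> v \<in> carrier F \<Longrightarrow> u - v \<in> carrier F"
  using keys_diff[of u v] by (auto simp del: keys_diff)

lemma tensor_relators_carrier: "tensor_relators G H \<subseteq> carrier F"
proof -
  have "frag_of (a \<otimes>\<^bsub>G\<^esub> a', b) - frag_of (a, b) - frag_of (a', b) \<in> carrier F"
    if "a \<in> carrier G" "a' \<in> carrier G" "b \<in> carrier H" for a a' b
    using that by (intro diff_in_F frag_of_in_F) auto
  moreover have "frag_of (a, b \<otimes>\<^bsub>H\<^esub> b') - frag_of (a, b) - frag_of (a, b') \<in> carrier F"
    if "a \<in> carrier G" "b \<in> carrier H" "b' \<in> carrier H" for a b b'
    using that by (intro diff_in_F frag_of_in_F) auto
  ultimately show ?thesis unfolding tensor_relators_def by blast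
qed

lemma rels_subgroup: "subgroup (tensor_rels G H) F"
  unfolding tensor_rels_eq by (intro F.generate_is_subgroup tensor_relators_carrier)

sublocale R: normal "tensor_rels G H" F
  by (intro F.subgroup_imp_normal rels_subgroup)

sublocale T: comm_group "tensor G H"
  unfolding tensor_def by (intro F.abelian_FactGroup rels_subgroup)

lemma class_in_carrier: "u \<in> carrier F \<Longrightarrow> tensor_class G H u \<in> carrier (tensor G H)"
  unfolding tensor_class_def tensor_def carrier_FactGroup by blast

lemma class_add:
  assumes "u \<in> carrier F" "v \<in> carrier F"
  shows "tensor_class G H (u + v) = tensor_class G H u \<otimes>\<^bsub>tensor G H\<^esub> tensor_class G H v"
  using R.rcos_sum[OF assms] by (simp add: tensor_class_def tensor_def)

lemma class_eqI:
  assumes "u \<in> carrier F" "v \<in> carrier F" "u - v \<in> tensor_rels G H"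
  shows "tensor_class G H u = tensor_class G H v"
proof -
  have "u = (u - v) \<otimes>\<^bsub>F\<^esub> v" by simp
  hence "u \<in> tensor_rels G H #>\<^bsub>F\<^esub> v"
    using assms(3) unfolding r_coset_def by blast
  thus ?thesis
    unfolding tensor_class_def using F.repr_independence[OF _ assms(2) rels_subgroup] by metis
qed

lemma class_relator:
  assumes "u - v - w \<in> tensor_relators G H" "u \<in> carrier F" "v \<in> carrier F" "w \<in> carrier F"
  shows "tensor_class G H u = tensor_class G H v \<otimes>\<^bsub>tensor G H\<^esub> tensor_class G H w"
proof -
  have "u - (v + w) \<in> tensor_rels G H"
    using assms(1) unfolding tensor_rels_eq by (auto intro: generate.incl simp: diff_diff_eq)
  moreover have "v + w \<in> carrier F" using F.m_closed[OF assms(3,4)] by simp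
  ultimately have "tensor_class G H u = tensor_class G H (v + w)"
    using assms(2) by (intro class_eqI)
  thus ?thesis using class_add[OF assms(3,4)] by simp
qed

lemma pure_in_carrier: "a \<in> carrier G \<Longrightarrow> b \<in> carrier H \<Longrightarrow> pure_tensor G H a b \<in> carrier (tensor G H)"
  unfolding pure_tensor_eq by (intro class_in_carrier frag_of_in_F)

lemma pure_mult_left:
  assumes "a \<in> carrier G" "a' \<in> carrier G" "b \<in> carrier H"
  shows "pure_tensor G H (a \<otimes>\<^bsub>G\<^esub> a') b = pure_tensor G H a b \<otimes>\<^bsub>tensor G H\<^esub> pure_tensor G H a' b"
  unfolding pure_tensor_eq
proof (rule class_relator)
  show "frag_of (a \<otimes>\<^bsub>G\<^esub> a', b) - frag_of (a, b) - frag_of (a', b) \<in> tensor_relators G H"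
    using assms unfolding tensor_relators_def by blast
qed (use assms in \<open>intro frag_of_in_F; simp\<close>)+

lemma pure_mult_right:
  assumes "a \<in> carrier G" "b \<in> carrier H" "b' \<in> carrier H"
  shows "pure_tensor G H a (b \<otimes>\<^bsub>H\<^esub> b') = pure_tensor G H a b \<otimes>\<^bsub>tensor G H\<^esub> pure_tensor G H a b'"
  unfolding pure_tensor_eq
proof (rule class_relator)
  show "frag_of (a, b \<otimes>\<^bsub>H\<^esub> b') - frag_of (a, b) - frag_of (a, b') \<in> tensor_relators G H"
    using assms unfolding tensor_relators_def by blast
qed (use assms in \<open>intro frag_of_in_F; simp\<close>)+

lemma pure_one_left: "b \<in> carrier H \<Longrightarrow> pure_tensor G H \<one>\<^bsub>G\<^esub> b = \<one>\<^bsub>tensor G H\<^esub>"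
  using pure_mult_left[of "\<one>\<^bsub>G\<^esub>" "\<one>\<^bsub>G\<^esub>" b] pure_in_carrier[of "\<one>\<^bsub>G\<^esub>" b]
  by (simp add: T.l_cancel_one')

lemma pure_one_right: "a \<in> carrier G \<Longrightarrow> pure_tensor G H a \<one>\<^bsub>H\<^esub> = \<one>\<^bsub>tensor G H\<^esub>"
  using pure_mult_right[of a "\<one>\<^bsub>H\<^esub>" "\<one>\<^bsub>H\<^esub>"] pure_in_carrier[of a "\<one>\<^bsub>H\<^esub>"]
  by (simp add: T.l_cancel_one')

text \<open>Both sides are the \<open>n\<close>-th power of one pure tensor. With a rational second
  factor this is how denominators are absorbed.\<close>

lemma pure_pow:
  assumes "a \<in> carrier G" "b \<in> carrier H"
  shows "pure_tensor G H (a [^]\<^bsub>G\<^esub> (n::nat)) b = pure_tensor G H a (b [^]\<^bsub>H\<^esub> n)"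
proof -
  have "pure_tensor G H (a [^]\<^bsub>G\<^esub> n) b = pure_tensor G H a b [^]\<^bsub>tensor G H\<^esub> n"
    using assms by (induction n) (simp_all add: pure_one_left pure_mult_left)
  moreover have "pure_tensor G H a (b [^]\<^bsub>H\<^esub> n) = pure_tensor G H a b [^]\<^bsub>tensor G H\<^esub> n"
    using assms by (induction n) (simp_all add: pure_one_right pure_mult_right)
  ultimately show ?thesis by simp
qed

end


section \<open>Tensoring with the rationals\<close>

lemma comm_group_rat_group: "comm_group rat_group"
proof (rule comm_groupI)
  show "\<exists>y\<in>carrier rat_group. y \<otimes>\<^bsub>rat_group\<^esub> x = \<one>\<^bsub>rat_group\<^esub>" for x
    by (auto simp: rat_group_def intro!: exI[of _ "- x"])
qed (auto simp: rat_group_def)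

lemma carrier_rat_group [simp]: "q \<in> carrier rat_group"
  by (simp add: rat_group_def)

lemma pow_rat_group: "q [^]\<^bsub>rat_group\<^esub> (n::nat) = of_nat n * q"
proof -
  interpret comm_group rat_group by (rule comm_group_rat_group)
  show ?thesis
  proof (induction n)
    case 0
    show ?case by (simp add: nat_pow_0) (simp add: rat_group_def)
  next
    case (Suc n)
    thus ?case by (simp add: nat_pow_Suc) (simp add: rat_group_def algebra_simps)
  qed
qed

locale rational_tensor = G: comm_group G for G :: "('a, 'm) monoid_scheme"
begin

sublocale tensor_product G rat_group
  by (intro tensor_product.intro G.comm_group_axioms comm_group_rat_group)

abbreviation scale_frag :: "rat \<Rightarrow> ('a \<times> rat \<Rightarrow>\<^sub>0 int) \<Rightarrow> ('a \<times> rat \<Rightarrow>\<^sub>0 int)" where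
  "scale_frag q \<equiv> frag_extend (\<lambda>(a, r). frag_of (a, q * r))"

lemma scale_frag_relators:
  assumes "w \<in> tensor_relators G rat_group"
  shows "scale_frag q w \<in> tensor_relators G rat_group"
proof -
  consider a a' b where "w = frag_of (a \<otimes>\<^bsub>G\<^esub> a', b) - frag_of (a, b) - frag_of (a', b)"
      "a \<in> carrier G" "a' \<in> carrier G"
    | a b b' where "w = frag_of (a, b \<otimes>\<^bsub>rat_group\<^esub> b') - frag_of (a, b) - frag_of (a, b')" "a \<in> carrier G"
    using assms unfolding tensor_relators_def by blast
  thus ?thesis
  proof cases
    case 1
    hence "scale_frag q w = frag_of (a \<otimes>\<^bsub>G\<^esub> a', q * b) - frag_of (a, q * b) - frag_of (a', q * b)"
      by (simp add: frag_extend_diff)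
    thus ?thesis unfolding tensor_relators_def using 1 carrier_rat_group by blast
  next
    case 2
    hence "scale_frag q w = frag_of (a, (q * b) \<otimes>\<^bsub>rat_group\<^esub> (q * b')) - frag_of (a, q * b) - frag_of (a, q * b')"
      by (simp add: frag_extend_diff rat_group_def distrib_left)
    thus ?thesis unfolding tensor_relators_def using 2 carrier_rat_group by blast
  qed
qed

text \<open>Makes multiplication by \<open>q\<close> descend to the quotient.\<close>

lemma scale_frag_rels:
  assumes "w \<in> tensor_rels G rat_group"
  shows "scale_frag q w \<in> tensor_rels G rat_group"
  using assms unfolding tensor_rels_eq
proof (induction rule: generate.induct)
  case one
  show ?case using generate.one[of F] by simp
next
  case (incl w)
  thus ?case by (intro generate.incl scale_frag_relators)
next
  case (inv w)
  have "w \<in> carrier F" "scale_frag q w \<in> carrier F"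
    using inv scale_frag_relators[OF inv, of q] tensor_relators_carrier by blast+
  hence "Poly_Mapping.keys w \<subseteq> carrier G \<times> carrier rat_group"
    "Poly_Mapping.keys (scale_frag q w) \<subseteq> carrier G \<times> carrier rat_group"
    by (simp_all only: carrier_free_Abelian_group_iff)
  thus ?case using generate.inv[OF scale_frag_relators[OF inv, of q], of F]
    by (simp add: frag_extend_minus)
next
  case (eng u v)
  thus ?case using generate.eng[OF eng.IH] by (simp add: frag_extend_add)
qed

text \<open>\<open>rat_scale\<close> maps a coset elementwise and then multiplies by the relations
  again; since \<open>scale_frag q\<close> preserves the relations, the result is exactly one
  coset.\<close>

lemma rat_scale_pure:
  assumes a: "a \<in> carrier G"
  shows "rat_scale G q (pure_tensor G rat_group a r) = pure_tensor G rat_group a (q * r)"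
proof -
  let ?R = "tensor_rels G rat_group"
  have add: "u + v \<in> ?R" if "u \<in> ?R" "v \<in> ?R" for u v
    using R.m_closed[OF that] by simp
  have zero: "0 \<in> ?R" using R.one_closed by simp
  have "scale_frag q ` pure_tensor G rat_group a r = (\<lambda>u. scale_frag q u + frag_of (a, q * r)) ` ?R"
    unfolding pure_tensor_def r_coset_def by (auto simp: frag_extend_add image_iff)
  hence "rat_scale G q (pure_tensor G rat_group a r) =
      {v + (scale_frag q u + frag_of (a, q * r)) | u v. u \<in> ?R \<and> v \<in> ?R}"
    unfolding rat_scale_def set_mult_def by auto
  also have "\<dots> = {v + frag_of (a, q * r) | v. v \<in> ?R}"
  proof safe
    fix u v assume "u \<in> ?R" "v \<in> ?R"
    thus "\<exists>v'. v + (scale_frag q u + frag_of (a, q * r)) = v' + frag_of (a, q * r) \<and> v' \<in> ?R"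
      by (intro exI[of _ "v + scale_frag q u"]) (auto simp: add.assoc intro: add scale_frag_rels)
  next
    fix v assume "v \<in> ?R"
    thus "\<exists>u v'. v + frag_of (a, q * r) = v' + (scale_frag q u + frag_of (a, q * r)) \<and> u \<in> ?R \<and> v' \<in> ?R"
      using zero by (intro exI[of _ 0] exI[of _ v]) auto
  qed
  also have "\<dots> = pure_tensor G rat_group a (q * r)"
    unfolding pure_tensor_def r_coset_def by auto
  finally show ?thesis .
qed

text \<open>Gives both the independence of \<open>motivic_class\<close> from the exponent and the
  removal of the factor \<open>1 / 3\<close>.\<close>

lemma pure_pow_cancel:
  assumes "a \<in> carrier G" "n > 0"
  shows "pure_tensor G rat_group (a [^]\<^bsub>G\<^esub> n) (1 / of_nat (n * m)) = pure_tensor G rat_group a (1 / of_nat m)"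
  using assms by (simp add: pure_pow pow_rat_group)

lemma finprod_pure:
  assumes "finite Z" "\<And>z. z \<in> Z \<Longrightarrow> f z \<in> carrier G"
  shows "(\<Otimes>\<^bsub>tensor G rat_group\<^esub>z\<in>Z. pure_tensor G rat_group (f z) q) =
    pure_tensor G rat_group (\<Otimes>\<^bsub>G\<^esub>z\<in>Z. f z) q"
  using assms
proof (induction Z rule: finite_induct)
  case empty
  show ?case by (simp add: pure_one_left)
next
  case (insert z Z)
  have "f \<in> Z \<rightarrow> carrier G" using insert by auto
  moreover have "(\<lambda>z. pure_tensor G rat_group (f z) q) \<in> Z \<rightarrow> carrier (tensor G rat_group)"
    using insert by (auto intro!: pure_in_carrier)
  ultimately show ?case
    using insert by (simp add: T.finprod_insert G.finprod_insert pure_in_carrier pure_mult_left)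
qed

end

section \<open>Milnor's \<open>K\<^sub>2\<close>\<close>

text \<open>The composite of both quotient maps, a homomorphism whose kernel is studied inside a
  free abelian group.\<close>

definition K2_class :: "'a::field set \<Rightarrow> ('a \<times> 'a \<Rightarrow>\<^sub>0 int) \<Rightarrow> ('a \<times> 'a \<Rightarrow>\<^sub>0 int) set set" where
  "K2_class K w = steinberg_rels K #>\<^bsub>tensor (unit_group K) (unit_group K)\<^esub>
     tensor_class (unit_group K) (unit_group K) w"

lemma symbol_eq: "symbol K f g = K2_class K (frag_of (f, g))"
  by (simp add: symbol_def K2_class_def pure_tensor_eq)

context subfield_set
begin

lemma carrier_unit_group [simp]: "carrier (unit_group K) = K - {0}"
  and mult_unit_group [simp]: "x \<otimes>\<^bsub>unit_group K\<^esub> y = x * y"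
  and one_unit_group [simp]: "\<one>\<^bsub>unit_group K\<^esub> = 1"
  by (simp_all add: unit_group_def)

lemma comm_group_unit_group: "comm_group (unit_group K)"
proof (rule comm_groupI)
  fix x assume "x \<in> carrier (unit_group K)"
  thus "\<exists>y\<in>carrier (unit_group K). y \<otimes>\<^bsub>unit_group K\<^esub> x = \<one>\<^bsub>unit_group K\<^esub>"
    by (intro bexI[of _ "inverse x"]) (auto simp: K_inverse)
qed (auto simp: K_one K_mult mult.commute mult.left_commute)

sublocale U: tensor_product "unit_group K" "unit_group K"
  by (intro tensor_product.intro comm_group_unit_group)

abbreviation "TK \<equiv> tensor (unit_group K) (unit_group K)"

definition steinberg_generators where
  "steinberg_generators = {pure_tensor (unit_group K) (unit_group K) f (1 - f) | f. f \<in> K - {0, 1}}"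

lemma steinberg_rels_eq: "steinberg_rels K = generate TK steinberg_generators"
  by (simp add: steinberg_rels_def steinberg_generators_def)

lemma steinberg_generators_carrier: "steinberg_generators \<subseteq> carrier TK"
  unfolding steinberg_generators_def by (auto intro!: U.pure_in_carrier K_diff K_one)

lemma steinberg_subgroup: "subgroup (steinberg_rels K) TK"
  unfolding steinberg_rels_eq by (intro U.T.generate_is_subgroup steinberg_generators_carrier)

sublocale S: normal "steinberg_rels K" TK
  by (intro U.T.subgroup_imp_normal steinberg_subgroup)

sublocale K2: comm_group "milnor_K2 K"
  unfolding milnor_K2_def by (intro U.T.abelian_FactGroup steinberg_subgroup)

lemma K2_class_in_carrier: "u \<in> carrier U.F \<Longrightarrow> K2_class K u \<in> carrier (milnor_K2 K)"
  unfolding K2_class_def milnor_K2_def carrier_FactGroup using U.class_in_carrier by blast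

lemma K2_class_add:
  assumes "u \<in> carrier U.F" "v \<in> carrier U.F"
  shows "K2_class K (u + v) = K2_class K u \<otimes>\<^bsub>milnor_K2 K\<^esub> K2_class K v"
  using assms S.rcos_sum[of "tensor_class (unit_group K) (unit_group K) u" "tensor_class (unit_group K) (unit_group K) v"]
  by (simp add: K2_class_def milnor_K2_def U.class_add U.class_in_carrier del: carrier_free_Abelian_group_iff)

lemma K2_class_zero: "K2_class K 0 = \<one>\<^bsub>milnor_K2 K\<^esub>"
proof -
  have 0: "0 \<in> carrier U.F" by simp
  show ?thesis
    using K2_class_add[OF 0 0] K2_class_in_carrier[OF 0] by (simp add: K2.l_cancel_one')
qed

lemma K2_class_cmul: "u \<in> carrier U.F \<Longrightarrow> K2_class K (frag_cmul (int n) u) = K2_class K u [^]\<^bsub>milnor_K2 K\<^esub> n"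
proof (induction n)
  case 0
  thus ?case by (simp add: K2_class_zero)
next
  case (Suc n)
  have "frag_cmul (int n) u \<in> carrier U.F"
    using Suc.prems keys_cmul[of "int n" u] by auto
  thus ?case
    using Suc by (simp add: frag_cmul_distrib K2_class_add K2.m_comm K2_class_in_carrier del: carrier_free_Abelian_group_iff)
qed

lemma K2_class_tensor_rel:
  assumes "u \<in> tensor_rels (unit_group K) (unit_group K)"
  shows "K2_class K u = \<one>\<^bsub>milnor_K2 K\<^esub>"
proof -
  have "tensor_class (unit_group K) (unit_group K) u = tensor_class (unit_group K) (unit_group K) 0"
    using assms U.R.mem_carrier[OF assms] by (intro U.class_eqI) auto
  thus ?thesis using K2_class_zero by (simp add: K2_class_def)
qed

lemma K2_class_steinberg:
  assumes "f \<in> K - {0, 1}"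
  shows "K2_class K (frag_of (f, 1 - f)) = \<one>\<^bsub>milnor_K2 K\<^esub>"
proof -
  have "pure_tensor (unit_group K) (unit_group K) f (1 - f) \<in> steinberg_rels K"
    using assms unfolding steinberg_rels_eq steinberg_generators_def by (blast intro: generate.incl)
  thus ?thesis
    by (simp add: K2_class_def milnor_K2_def S.rcos_const flip: pure_tensor_eq)
qed

text \<open>\<open>torsion_modulo_subgroup\<close> for the kernel of \<open>K2_class\<close>: an
  additive functional vanishing there kills the bilinear relators and the Steinberg elements, hence
  defines a \<open>steinberg_functional\<close>.\<close>

lemma K2_torsion:
  assumes w: "w \<in> carrier U.F"
    and functionals: "\<And>\<phi>. \<lbrakk>\<And>u v. \<phi> (u + v) = \<phi> u + \<phi> v; steinberg_functional K (\<lambda>f g. \<phi> (frag_of (f, g)))\<rbrakk>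
      \<Longrightarrow> \<phi> w = 0"
  obtains n :: nat where "n > 0" "K2_class K w [^]\<^bsub>milnor_K2 K\<^esub> n = \<one>\<^bsub>milnor_K2 K\<^esub>"
proof -
  define R where "R = {u \<in> carrier U.F. K2_class K u = \<one>\<^bsub>milnor_K2 K\<^esub>}"
  have diff: "u - v \<in> R" if "u \<in> R" "v \<in> R" for u v
  proof -
    have uv: "u \<in> carrier U.F" "v \<in> carrier U.F" "u - v \<in> carrier U.F"
      using that U.diff_in_F unfolding R_def by blast+
    have "K2_class K (u - v) \<otimes>\<^bsub>milnor_K2 K\<^esub> K2_class K v = K2_class K u"
      using K2_class_add[OF uv(3,2)] by simp
    thus ?thesis
      using that uv K2_class_in_carrier[OF uv(3)] by (simp add: R_def)
  qed
  have "\<phi> w = 0" if add: "\<And>u v. \<phi> (u + v) = \<phi> u + \<phi> v" and R: "\<And>u. u \<in> R \<Longrightarrow> \<phi> u = 0"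
    for \<phi> :: "('a \<times> 'a \<Rightarrow>\<^sub>0 int) \<Rightarrow> rat"
  proof (rule functionals[OF add])
    have "\<phi> (u - v) + \<phi> v = \<phi> u" for u v
      by (metis add diff_add_cancel)
    hence sub: "\<phi> (u - v) = \<phi> u - \<phi> v" for u v
      by (simp add: eq_diff_eq)
    have rel: "\<phi> u = 0" if "u \<in> tensor_relators (unit_group K) (unit_group K)" for u
    proof (rule R)
      show "u \<in> R"
        using that U.tensor_relators_carrier K2_class_tensor_rel[of u] generate.incl[OF that, of U.F]
        unfolding R_def tensor_rels_eq by blast
    qed
    show "steinberg_functional K (\<lambda>f g. \<phi> (frag_of (f, g)))"
    proof (intro steinberg_functional.intro subfield_set_axioms steinberg_functional_axioms.intro)
      fix f f' g assume "f \<in> K" "f' \<in> K" "g \<in> K" "f \<noteq> 0" "f' \<noteq> 0" "g \<noteq> 0"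
      hence "frag_of (f * f', g) - frag_of (f, g) - frag_of (f', g) \<in> tensor_relators (unit_group K) (unit_group K)"
        unfolding tensor_relators_def by auto
      from rel[OF this] show "\<phi> (frag_of (f * f', g)) = \<phi> (frag_of (f, g)) + \<phi> (frag_of (f', g))"
        by (simp add: sub)
    next
      fix f g g' assume "f \<in> K" "g \<in> K" "g' \<in> K" "f \<noteq> 0" "g \<noteq> 0" "g' \<noteq> 0"
      hence "frag_of (f, g * g') - frag_of (f, g) - frag_of (f, g') \<in> tensor_relators (unit_group K) (unit_group K)"
        unfolding tensor_relators_def by auto
      from rel[OF this] show "\<phi> (frag_of (f, g * g')) = \<phi> (frag_of (f, g)) + \<phi> (frag_of (f, g'))"
        by (simp add: sub)
    next
      fix f assume "f \<in> K" "f \<noteq> 0" "f \<noteq> 1"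
      thus "\<phi> (frag_of (f, 1 - f)) = 0"
        by (intro R) (simp add: R_def K2_class_steinberg K_closed)
    qed
  qed
  moreover have "0 \<in> R" by (simp add: R_def K2_class_zero)
  ultimately obtain n :: nat where "n > 0" "frag_cmul (int n) w \<in> R"
    using torsion_modulo_subgroup[of R w] diff by metis
  thus ?thesis using that w K2_class_cmul[of w n] by (simp add: R_def)
qed

end

text \<open>\<open>tame_formal\<close> with an arbitrary \<open>\<tau>\<close> in place of
  \<open>tame y P\<close>.\<close>

definition frag_prod :: "('b \<Rightarrow> 'k::field) \<Rightarrow> ('b \<Rightarrow>\<^sub>0 int) \<Rightarrow> 'k" where
  "frag_prod \<tau> w = (\<Prod>s\<in>Poly_Mapping.keys w. \<tau> s powi Poly_Mapping.lookup w s)"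

lemma frag_prod_superset:
  assumes "finite S" "Poly_Mapping.keys w \<subseteq> S"
  shows "frag_prod \<tau> w = (\<Prod>s\<in>S. \<tau> s powi Poly_Mapping.lookup w s)"
  unfolding frag_prod_def using assms
  by (intro prod.mono_neutral_left) (auto simp: in_keys_iff)

lemma frag_prod_of [simp]: "frag_prod \<tau> (frag_of s) = \<tau> s"
  by (simp add: frag_prod_def)

text \<open>Nonvanishing matters because exponents of opposite sign may cancel, where a power of
  \<open>0\<close> does not split.\<close>

lemma frag_prod_add:
  assumes "\<And>s. s \<in> Poly_Mapping.keys u \<union> Poly_Mapping.keys v \<Longrightarrow> \<tau> s \<noteq> 0"
  shows "frag_prod \<tau> (u + v) = frag_prod \<tau> u * frag_prod \<tau> v"
proof -
  let ?S = "Poly_Mapping.keys u \<union> Poly_Mapping.keys v"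
  have "frag_prod \<tau> (u + v) = (\<Prod>s\<in>?S. \<tau> s powi Poly_Mapping.lookup (u + v) s)"
    by (intro frag_prod_superset) (auto simp: keys_add)
  also have "\<dots> = (\<Prod>s\<in>?S. \<tau> s powi Poly_Mapping.lookup u s * \<tau> s powi Poly_Mapping.lookup v s)"
    using assms by (intro prod.cong) (auto simp: Poly_Mapping.lookup_add power_int_add)
  also have "\<dots> = frag_prod \<tau> u * frag_prod \<tau> v"
    using frag_prod_superset[of ?S u \<tau>] frag_prod_superset[of ?S v \<tau>] by (simp add: prod.distrib)
  finally show ?thesis by blast
qed

text \<open>The universal property of \<open>K\<^sub>2\<close>: a Steinberg symbol factors through
  it. The induced map is written as in \<open>tame_K2\<close>, so that it is recognized by
  unfolding.\<close>

lemma (in subfield_set) K2_character: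
  assumes nz: "\<And>f g. f \<in> K - {0} \<Longrightarrow> g \<in> K - {0} \<Longrightarrow> \<tau> (f, g) \<noteq> (0::'k::field)"
    and left: "\<And>f f' g. f \<in> K - {0} \<Longrightarrow> f' \<in> K - {0} \<Longrightarrow> g \<in> K - {0} \<Longrightarrow> \<tau> (f * f', g) = \<tau> (f, g) * \<tau> (f', g)"
    and right: "\<And>f g g'. f \<in> K - {0} \<Longrightarrow> g \<in> K - {0} \<Longrightarrow> g' \<in> K - {0} \<Longrightarrow> \<tau> (f, g * g') = \<tau> (f, g) * \<tau> (f, g')"
    and steinberg: "\<And>f. f \<in> K - {0, 1} \<Longrightarrow> \<tau> (f, 1 - f) = 1"
  defines "\<chi> \<equiv> \<lambda>\<alpha>. the_elem ((\<lambda>c. the_elem (frag_prod \<tau> ` c)) ` \<alpha>)"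
  shows "multiplicative_character (milnor_K2 K) \<chi>"
    and "f \<in> K - {0} \<Longrightarrow> g \<in> K - {0} \<Longrightarrow> \<chi> (symbol K f g) = \<tau> (f, g)"
proof -
  interpret F: multiplicative_character U.F "frag_prod \<tau>"
  proof
    fix u v assume "u \<in> carrier U.F" "v \<in> carrier U.F"
    hence "\<tau> s \<noteq> 0" if "s \<in> Poly_Mapping.keys u \<union> Poly_Mapping.keys v" for s
      using that nz by (cases s) auto
    thus "frag_prod \<tau> (u \<otimes>\<^bsub>U.F\<^esub> v) = frag_prod \<tau> u * frag_prod \<tau> v"
      unfolding mult_free_Abelian_group by (rule frag_prod_add)
  next
    fix u assume u: "u \<in> carrier U.F"
    have "\<tau> s \<noteq> 0" if "s \<in> Poly_Mapping.keys u" for s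
      using that u nz by (cases s) auto
    thus "frag_prod \<tau> u \<noteq> 0"
      by (simp add: frag_prod_def)
  qed
  have sub: "frag_prod \<tau> (u - v) = frag_prod \<tau> u / frag_prod \<tau> v"
    if "u \<in> carrier U.F" "v \<in> carrier U.F" for u v
  proof -
    have "frag_prod \<tau> ((u - v) + v) = frag_prod \<tau> (u - v) * frag_prod \<tau> v"
      using F.h_mult[OF U.diff_in_F[OF that] that(2)] by simp
    thus ?thesis using F.h_nonzero[OF that(2)] by (simp add: field_simps)
  qed
  have rel: "frag_prod \<tau> u = 1" if u: "u \<in> tensor_rels (unit_group K) (unit_group K)" for u
  proof (rule F.h_generate[OF U.tensor_relators_carrier])
    fix v assume "v \<in> tensor_relators (unit_group K) (unit_group K)"
    then consider a a' b where "v = frag_of (a * a', b) - frag_of (a, b) - frag_of (a', b)"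
        "a \<in> K - {0}" "a' \<in> K - {0}" "b \<in> K - {0}"
      | a b b' where "v = frag_of (a, b * b') - frag_of (a, b) - frag_of (a, b')"
        "a \<in> K - {0}" "b \<in> K - {0}" "b' \<in> K - {0}"
      unfolding tensor_relators_def carrier_unit_group mult_unit_group by blast
    thus "frag_prod \<tau> v = 1"
    proof cases
      case 1
      hence mem: "frag_of (a * a', b) \<in> carrier U.F" "frag_of (a, b) \<in> carrier U.F" "frag_of (a', b) \<in> carrier U.F"
        by (auto simp: K_mult)
      show ?thesis
        using 1 left[of a a' b] nz[of a b] nz[of a' b]
        unfolding 1 sub[OF U.diff_in_F[OF mem(1,2)] mem(3)] sub[OF mem(1,2)] by simp
    next
      case 2
      hence mem: "frag_of (a, b * b') \<in> carrier U.F" "frag_of (a, b) \<in> carrier U.F" "frag_of (a, b') \<in> carrier U.F"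
        by (auto simp: K_mult)
      show ?thesis
        using 2 right[of a b b'] nz[of a b] nz[of a b']
        unfolding 2 sub[OF U.diff_in_F[OF mem(1,2)] mem(3)] sub[OF mem(1,2)] by simp
    qed
  next
    show "u \<in> generate U.F (tensor_relators (unit_group K) (unit_group K))"
      using u by (simp add: tensor_rels_eq)
  qed
  define \<psi> where "\<psi> = (\<lambda>c. the_elem (frag_prod \<tau> ` c))"
  have \<psi>_class: "\<psi> (tensor_class (unit_group K) (unit_group K) u) = frag_prod \<tau> u" if "u \<in> carrier U.F" for u
    unfolding \<psi>_def tensor_class_def by (intro F.the_elem_rcoset U.rels_subgroup rel that)
  interpret T: multiplicative_character TK \<psi>
    unfolding tensor_def \<psi>_def by (intro F.quotient_character U.R.normal_axioms rel)
  have srel: "\<psi> c = 1" if c: "c \<in> steinberg_rels K" for c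
  proof (rule T.h_generate[OF steinberg_generators_carrier])
    fix c assume "c \<in> steinberg_generators"
    then obtain f where f: "f \<in> K - {0, 1}" "c = tensor_class (unit_group K) (unit_group K) (frag_of (f, 1 - f))"
      by (auto simp: steinberg_generators_def pure_tensor_eq)
    have "frag_of (f, 1 - f) \<in> carrier U.F" using f by (auto simp: K_closed)
    thus "\<psi> c = 1" using f steinberg[of f] \<psi>_class by simp
  next
    show "c \<in> generate TK steinberg_generators" using c by (simp add: steinberg_rels_eq)
  qed
  show "multiplicative_character (milnor_K2 K) \<chi>"
    using T.quotient_character[OF S.normal_axioms srel] unfolding milnor_K2_def \<chi>_def \<psi>_def .
  show "\<chi> (symbol K f g) = \<tau> (f, g)" if "f \<in> K - {0}" "g \<in> K - {0}"
  proof -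
    have mem: "frag_of (f, g) \<in> carrier U.F" using that by simp
    have "\<chi> (symbol K f g) = \<psi> (tensor_class (unit_group K) (unit_group K) (frag_of (f, g)))"
      unfolding \<chi>_def \<psi>_def[symmetric] symbol_eq K2_class_def
      by (intro T.the_elem_rcoset steinberg_subgroup srel U.class_in_carrier mem)
    thus ?thesis using \<psi>_class[OF mem] by simp
  qed
qed

section \<open>Tame symbols of a discrete valuation\<close>

text \<open>Here \<open>val\<close> is the residue map and not the valuation, \<open>R\<close> is
  the valuation ring and \<open>p\<close> a uniformizer. The order is derived from the factorization
  property, which is what a chart supplies.\<close>

locale discrete_valuation = subfield_set K for K :: "'a::field set" +
  fixes R :: "'a set" and val :: "'a \<Rightarrow> 'k::field" and p :: 'a
  assumes R_K: "R \<subseteq> K"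
    and R_one: "1 \<in> R" and R_diff: "f \<in> R \<Longrightarrow> g \<in> R \<Longrightarrow> f - g \<in> R"
    and R_mult: "f \<in> R \<Longrightarrow> g \<in> R \<Longrightarrow> f * g \<in> R"
    and R_inverse: "f \<in> R \<Longrightarrow> val f \<noteq> 0 \<Longrightarrow> inverse f \<in> R"
    and val_one: "val 1 = 1" and val_diff: "f \<in> R \<Longrightarrow> g \<in> R \<Longrightarrow> val (f - g) = val f - val g"
    and val_mult: "f \<in> R \<Longrightarrow> g \<in> R \<Longrightarrow> val (f * g) = val f * val g"
    and p_R: "p \<in> R" and val_p: "val p = 0" and p_nz: "p \<noteq> 0"
    and factor: "f \<in> K \<Longrightarrow> f \<noteq> 0 \<Longrightarrow> \<exists>n u. u \<in> R \<and> val u \<noteq> 0 \<and> f = u * p powi n"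
begin

definition units :: "'a set" where
  "units = {u \<in> R. val u \<noteq> 0}"

lemma val_zero: "val 0 = 0"
  using val_diff[OF R_one R_one] by simp

lemma R_zero: "0 \<in> R"
  using R_diff[OF R_one R_one] by simp

lemma unitsD: "u \<in> units \<Longrightarrow> u \<in> R" "u \<in> units \<Longrightarrow> val u \<noteq> 0" "u \<in> units \<Longrightarrow> u \<noteq> 0" "u \<in> units \<Longrightarrow> u \<in> K"
  using R_K val_zero by (auto simp: units_def)

lemma unitsI: "u \<in> R \<Longrightarrow> val u \<noteq> 0 \<Longrightarrow> u \<in> units"
  by (simp add: units_def)

lemma units_mult: "u \<in> units \<Longrightarrow> v \<in> units \<Longrightarrow> u * v \<in> units"
  by (simp add: units_def R_mult val_mult)

lemma val_inverse: "u \<in> units \<Longrightarrow> val (inverse u) = inverse (val u)"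
  using val_mult[of "inverse u" u] unitsD[of u] R_inverse[of u] val_one
  by (simp add: inverse_unique[symmetric] mult.commute)

lemma units_inverse: "u \<in> units \<Longrightarrow> inverse u \<in> units"
  using val_inverse[of u] by (auto simp: units_def R_inverse)

lemma units_powi: "u \<in> units \<Longrightarrow> u powi n \<in> units \<and> val (u powi n) = val u powi n"
proof -
  have nat: "u ^ m \<in> units \<and> val (u ^ m) = val u ^ m" if "u \<in> units" for u m
  proof (induction m)
    case 0
    show ?case by (simp add: units_def R_one val_one)
  next
    case (Suc m)
    thus ?case using that by (simp add: units_mult val_mult unitsD)
  qed
  assume u: "u \<in> units"
  show ?thesis
    using nat[OF u, of "nat n"] nat[OF units_inverse[OF u], of "nat (- n)"] val_inverse[OF u]
    by (simp add: power_int_def)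
qed

lemma units_uminus_one: "- 1 \<in> units" "val (- 1) = - 1"
  using R_diff[OF R_zero R_one] val_diff[OF R_zero R_one] by (simp_all add: units_def val_zero val_one)

lemma val_p_mult: "f \<in> R \<Longrightarrow> n > 0 \<Longrightarrow> f * p powi n \<in> R \<and> val (f * p powi n) = 0"
proof -
  assume f: "f \<in> R" "n > 0"
  have "p ^ m \<in> R" for m
    by (induction m) (auto simp: R_one R_mult p_R)
  moreover have "p powi n = p * p ^ (nat n - 1)"
    using f by (cases "nat n") (auto simp: power_int_def)
  ultimately show ?thesis using f by (simp add: R_mult p_R val_mult val_p)
qed

text \<open>Otherwise one of \<open>u\<close>, \<open>v\<close> would be the other times a positive
  power of \<open>p\<close> and have residue \<open>0\<close>.\<close>

lemma powi_unique:
  assumes "u \<in> units" "v \<in> units" "u * p powi m = v * p powi n"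
  shows "m = n"
proof -
  have *: "\<not> m < n" if "u \<in> units" "v \<in> units" "u * p powi m = v * p powi n" for u v m n
  proof
    assume "m < n"
    have "p powi n = p powi (n - m) * p powi m"
      using p_nz by (simp flip: power_int_add)
    hence "u = v * p powi (n - m)"
      using that(3) p_nz by simp
    thus False using val_p_mult[of v "n - m"] \<open>m < n\<close> that unitsD by auto
  qed
  show ?thesis using *[OF assms] *[OF assms(2,1) assms(3)[symmetric]] by simp
qed

definition maximal :: "'a set" where
  "maximal = {f \<in> R. val f = 0}"

lemma maximal_eq: "maximal = (\<lambda>h. p * h) ` R"
proof
  show "(\<lambda>h. p * h) ` R \<subseteq> maximal"
    by (auto simp: maximal_def R_mult p_R val_mult val_p)
  show "maximal \<subseteq> (\<lambda>h. p * h) ` R"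
  proof
    fix f assume f: "f \<in> maximal"
    show "f \<in> (\<lambda>h. p * h) ` R"
    proof (cases "f = 0")
      case True
      thus ?thesis using R_zero by (metis image_eqI mult_zero_right)
    next
      case False
      moreover have "f \<in> K" using f R_K by (auto simp: maximal_def)
      ultimately obtain n u where u: "u \<in> units" "f = u * p powi n"
        using factor unfolding units_def by blast
      have "n > 0"
      proof (rule ccontr)
        assume "\<not> n > 0"
        have "u = f * p powi (- n)"
          using u(2) p_nz by (simp add: power_int_minus)
        moreover have "val (f * p powi (- n)) = 0"
          using f \<open>\<not> n > 0\<close> val_p_mult[of f "- n"] by (cases "n = 0") (auto simp: maximal_def)
        ultimately show False using unitsD(2)[OF u(1)] by metis
      qed
      have "p powi n = p * p ^ (nat n - 1)"
        using \<open>n > 0\<close> by (cases "nat n") (auto simp: power_int_def)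
      moreover have "p ^ m \<in> R" for m
        by (induction m) (auto simp: R_one R_mult p_R)
      ultimately show ?thesis
        using u unitsD by (intro image_eqI[of _ _ "u * p ^ (nat n - 1)"]) (auto simp: R_mult)
    qed
  qed
qed

text \<open>Copies the formula of \<open>order_at\<close>, so that \<open>tame_eq\<close> is mere
  unfolding. The bound \<open>p\<close> shadows the fixed uniformizer, hence \<open>ord_eq\<close>
  must show independence of the choice.\<close>

definition ord :: "'a \<Rightarrow> int" where
  "ord f = (THE n. \<exists>p u. maximal = (\<lambda>h. p * h) ` R \<and> u \<in> R - maximal \<and> f = u * p powi n)"

lemma ord_eq:
  assumes "u \<in> units"
  shows "ord (u * p powi n) = n"
  unfolding ord_def
proof (rule the_equality)
  show "\<exists>q w. maximal = (\<lambda>h. q * h) ` R \<and> w \<in> R - maximal \<and> u * p powi n = w * q powi n"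
    using assms maximal_eq by (intro exI[of _ p] exI[of _ u]) (auto simp: units_def maximal_def)
next
  fix m assume "\<exists>q w. maximal = (\<lambda>h. q * h) ` R \<and> w \<in> R - maximal \<and> u * p powi n = w * q powi m"
  then obtain q w where q: "maximal = (\<lambda>h. q * h) ` R" "w \<in> units" "u * p powi n = w * q powi m"
    by (auto simp: units_def maximal_def)
  \<comment> \<open>Two generators of the maximal ideal divide each other, so they differ by the
    unit \<open>e\<close>.\<close>
  have "p \<in> (\<lambda>h. q * h) ` R" "q \<in> (\<lambda>h. p * h) ` R"
    using q(1) maximal_eq R_one by (metis image_eqI mult.right_neutral)+
  then obtain d e where de: "d \<in> R" "e \<in> R" "p = q * d" "q = p * e" by blast
  hence "e * d = 1" using p_nz by simp
  hence "e \<in> units" using de val_mult[of e d] val_one by (intro unitsI) auto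
  have "u * p powi n = (w * e powi m) * p powi m"
    using q(3) de(4) by (simp add: power_int_mult_distrib mult_ac)
  thus "m = n"
    using powi_unique[of u "w * e powi m" n m] assms q(2) \<open>e \<in> units\<close> units_mult units_powi by auto
qed

lemma factor_ord:
  assumes "f \<in> K - {0}"
  obtains u where "u \<in> units" "f = u * p powi ord f"
proof -
  from assms factor[of f] obtain n u where "u \<in> units" "f = u * p powi n"
    unfolding units_def by blast
  thus ?thesis using that[of u] ord_eq[of u n] by simp
qed

lemma ord_mult:
  assumes "f \<in> K - {0}" "g \<in> K - {0}"
  shows "ord (f * g) = ord f + ord g"
proof -
  obtain u v where uv: "u \<in> units" "f = u * p powi ord f" "v \<in> units" "g = v * p powi ord g"
    using factor_ord assms by metis
  have "f * g = (u * v) * p powi (ord f + ord g)"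
    using p_nz by (subst (1) uv(2), subst (1) uv(4)) (simp add: power_int_add mult_ac)
  thus ?thesis using ord_eq[OF units_mult[OF uv(1,3)]] by simp
qed

lemma ord_unit: "u \<in> units \<Longrightarrow> ord u = 0"
  using ord_eq[of u 0] by simp

definition tame_symbol :: "'a \<times> 'a \<Rightarrow> 'k" where
  "tame_symbol = (\<lambda>(f, g). (-1) powi (ord f * ord g) * val (f powi ord g / g powi ord f))"

text \<open>Both powers contain \<open>p powi (ord f * ord g)\<close>, which cancels.\<close>

lemma tame_symbol_quotient:
  assumes "f \<in> K - {0}" "g \<in> K - {0}"
  shows "f powi ord g / g powi ord f \<in> units"
proof -
  obtain u v where uv: "u \<in> units" "f = u * p powi ord f" "v \<in> units" "g = v * p powi ord g"
    using factor_ord assms by metis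
  have "f powi ord g / g powi ord f = u powi ord g * inverse (v powi ord f)"
    using p_nz
    by (subst (1) uv(2), subst (2) uv(4))
      (simp add: power_int_mult_distrib divide_inverse mult_ac flip: power_int_mult)
  thus ?thesis using units_mult units_powi units_inverse uv by metis
qed

lemma tame_symbol_nonzero:
  assumes "f \<in> K - {0}" "g \<in> K - {0}"
  shows "tame_symbol (f, g) \<noteq> 0"
  using unitsD(2)[OF tame_symbol_quotient[OF assms]] by (simp add: tame_symbol_def)

lemma tame_symbol_antisym:
  assumes "f \<in> K - {0}" "g \<in> K - {0}"
  shows "tame_symbol (g, f) = inverse (tame_symbol (f, g))"
proof -
  have "g powi ord f / f powi ord g = inverse (f powi ord g / g powi ord f)" by simp
  moreover have "inverse ((- 1 :: 'k) powi n) = (- 1) powi n" for n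
    by (simp flip: power_int_inverse)
  ultimately show ?thesis
    using val_inverse[OF tame_symbol_quotient[OF assms]]
    by (simp add: tame_symbol_def mult.commute)
qed

lemma tame_symbol_mult_left:
  assumes f: "f \<in> K - {0}" "f' \<in> K - {0}" and g: "g \<in> K - {0}"
  shows "tame_symbol (f * f', g) = tame_symbol (f, g) * tame_symbol (f', g)"
proof -
  have nz: "g \<noteq> 0" using g by simp
  have "(f * f') powi ord g / g powi ord (f * f') =
      (f powi ord g / g powi ord f) * (f' powi ord g / g powi ord f')"
    using nz by (simp add: ord_mult[OF f] power_int_mult_distrib power_int_add)
  moreover have "(- 1 :: 'k) powi (ord (f * f') * ord g) =
      (- 1) powi (ord f * ord g) * (- 1) powi (ord f' * ord g)"
    by (simp add: ord_mult[OF f] distrib_right power_int_add)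
  ultimately show ?thesis
    using val_mult[OF unitsD(1)[OF tame_symbol_quotient[OF f(1) g]] unitsD(1)[OF tame_symbol_quotient[OF f(2) g]]]
    by (simp add: tame_symbol_def mult_ac)
qed

lemma tame_symbol_mult_right:
  assumes "f \<in> K - {0}" "g \<in> K - {0}" "g' \<in> K - {0}"
  shows "tame_symbol (f, g * g') = tame_symbol (f, g) * tame_symbol (f, g')"
proof -
  have gg: "g * g' \<in> K - {0}" using assms K_mult by auto
  show ?thesis
    using tame_symbol_antisym[OF gg assms(1)] tame_symbol_antisym[OF assms(2,1)]
      tame_symbol_antisym[OF assms(3,1)] tame_symbol_mult_left[OF assms(2,3,1)]
    by simp
qed

lemma tame_symbol_unit_left:
  assumes "u \<in> units" "g \<in> K - {0}"
  shows "tame_symbol (u, g) = val u powi ord g"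
  using units_powi[OF assms(1)] by (simp add: tame_symbol_def ord_unit[OF assms(1)])

lemma tame_symbol_unit_right:
  assumes "f \<in> K - {0}" "u \<in> units"
  shows "tame_symbol (f, u) = val u powi (- ord f)"
  using tame_symbol_antisym[of u f] tame_symbol_unit_left[OF assms(2,1)] assms unitsD[OF assms(2)]
  by (simp add: power_int_minus)

lemma tame_symbol_self:
  assumes "f \<in> K - {0}"
  shows "tame_symbol (f, f) ^ 2 = 1"
proof -
  have "f powi ord f / f powi ord f = 1" using assms by simp
  moreover have "((- 1 :: 'k) powi n) ^ 2 = 1" for n
    by (cases "even n") (auto simp: power_int_minus_left)
  ultimately show ?thesis
    using assms by (simp add: tame_symbol_def val_one)
qed

text \<open>For positive order \<open>1 - f\<close> has residue \<open>1\<close>. For order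
  \<open>0\<close> either \<open>f\<close> has residue \<open>1\<close> or \<open>1 - f\<close> is a
  unit too. For negative order \<open>1 - f = - f * e\<close> with \<open>e = 1 - 1/f\<close> of
  residue \<open>1\<close>, and only signs remain.\<close>

lemma tame_symbol_steinberg:
  assumes f: "f \<in> K - {0, 1}"
  shows "tame_symbol (f, 1 - f) = 1"
proof -
  have fK: "f \<in> K - {0}" and gK: "1 - f \<in> K - {0}" using f K_closed by auto
  obtain u where u: "u \<in> units" "f = u * p powi ord f" using factor_ord[OF fK] .
  consider "ord f > 0" | "ord f = 0" | "ord f < 0" by linarith
  thus ?thesis
  proof cases
    case 1
    hence "f \<in> R" "val f = 0" using val_p_mult[of u "ord f"] u unitsD by metis+
    hence "1 - f \<in> units" "val (1 - f) = 1"
      using R_diff[OF R_one] val_diff[OF R_one] val_one by (auto intro: unitsI)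
    thus ?thesis using tame_symbol_unit_right[OF fK] by simp
  next
    case 2
    hence fu: "f \<in> units" using u by simp
    show ?thesis
    proof (cases "val f = 1")
      case True
      thus ?thesis using tame_symbol_unit_left[OF fu gK] by simp
    next
      case False
      have "1 - f \<in> units"
        using R_diff[OF R_one] val_diff[OF R_one] val_one unitsD[OF fu] False by (auto intro: unitsI)
      thus ?thesis using tame_symbol_unit_right[OF fK] 2 by simp
    qed
  next
    case 3
    have "inverse f = inverse u * p powi (- ord f)"
      by (subst u(2)) (simp add: power_int_minus)
    hence inv: "inverse f \<in> R" "val (inverse f) = 0"
      using val_p_mult[of "inverse u" "- ord f"] units_inverse[OF u(1)] unitsD 3 by auto
    define e where "e = 1 - inverse f"
    have e: "e \<in> units" "val e = 1"
      using inv R_diff[OF R_one] val_diff[OF R_one] val_one by (auto simp: e_def intro: unitsI)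
    have m1: "- 1 \<in> units" by (rule units_uminus_one)
    have g: "1 - f = (- 1) * f * e" using fK by (simp add: e_def field_simps)
    have mem: "- 1 \<in> K - {0}" "(- 1) * f \<in> K - {0}" "e \<in> K - {0}"
      using fK unitsD[OF e(1)] unitsD[OF m1] K_uminus by auto
    have self: "tame_symbol (f, f) = (- 1) powi (ord f * ord f)"
      using fK by (simp add: tame_symbol_def val_one)
    \<comment> \<open>The signs come from the entry \<open>- 1\<close> and from the symbol of
      \<open>f\<close> with itself; they agree because \<open>n ^ 2 - n\<close> is even for
      \<open>n = ord f\<close>.\<close>
    have parity: "(- 1 :: 'k) powi (- ord f) * (- 1) powi (ord f * ord f) = 1"
    proof -
      have "even (- ord f + ord f * ord f)" by simp
      hence "(- 1 :: 'k) powi (- ord f + ord f * ord f) = 1"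
        by (simp only: power_int_minus_left if_True power_int_1_left)
      thus ?thesis by (subst (asm) power_int_add) auto
    qed
    have "tame_symbol (f, 1 - f) = tame_symbol (f, - 1) * tame_symbol (f, f) * tame_symbol (f, e)"
      unfolding g using tame_symbol_mult_right[OF fK mem(2,3)] tame_symbol_mult_right[OF fK mem(1) fK] by simp
    also have "\<dots> = (- 1) powi (- ord f) * (- 1) powi (ord f * ord f)"
      using tame_symbol_unit_right[OF fK m1] tame_symbol_unit_right[OF fK e(1)] e(2) units_uminus_one(2) self by simp
    finally show ?thesis using parity by simp
  qed
qed

end

section \<open>Evaluation of polynomials at elements of the ambient field\<close>

lemma const_0 [simp]: "const 0 = 0"
  and const_1 [simp]: "const 1 = 1"
  and const_add: "const (a + b) = const a + const b"
  and const_mult: "const (a * b) = const a * const b"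
  and const_uminus: "const (- a) = - const a"
  and const_diff: "const (a - b) = const a - const b"
  and const_eq_iff [simp]: "const a = const b \<longleftrightarrow> a = b"
proof -
  show "const 0 = 0" by (simp add: const_def flip: Zero_fract_def)
  show "const 1 = 1" by (simp add: const_def flip: One_fract_def one_pCons)
  show "const (a + b) = const a + const b" by (simp add: const_def flip: to_ac_add)
  show "const (a * b) = const a * const b" by (simp add: const_def mult.commute flip: to_ac_mult)
  show "const (- a) = - const a" by (simp add: const_def flip: to_ac_minus)
  show "const (a - b) = const a - const b" by (simp add: const_def flip: to_ac_diff)
  show "const a = const b \<longleftrightarrow> a = b" by (simp add: const_def eq_fract)
qed

lemma const_eq_0_iff [simp]: "const a = 0 \<longleftrightarrow> a = 0"
  using const_eq_iff[of a 0] by (simp del: const_eq_iff)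

lemma const_power: "const (a ^ n) = const a ^ n"
  by (induction n) (auto simp: const_mult)

lemma const_numeral: "const (numeral n) = numeral n"
  by (induction n) (simp_all only: numeral.simps const_1 const_add)

lemma const_inverse: "const (inverse a) = inverse (const a)"
  by (cases "a = 0") (auto intro!: inverse_unique[symmetric] simp flip: const_mult)

lemma const_divide: "const (a / b) = const a / const b"
  by (simp add: divide_inverse const_mult const_inverse)

definition peval :: "omega \<Rightarrow> qbar poly \<Rightarrow> omega" where
  "peval \<xi> p = poly (map_poly const p) \<xi>"

lemma peval_0 [simp]: "peval \<xi> 0 = 0"
  by (simp add: peval_def)

lemma peval_pCons [simp]: "peval \<xi> (pCons c p) = const c + \<xi> * peval \<xi> p"
  by (simp add: peval_def map_poly_pCons)

lemma peval_1 [simp]: "peval \<xi> 1 = 1"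
  by (simp add: one_pCons)

lemma peval_add: "peval \<xi> (p + q) = peval \<xi> p + peval \<xi> q"
  by (induction p q rule: poly_induct2) (auto simp: const_add algebra_simps)

lemma peval_smult: "peval \<xi> (smult c p) = const c * peval \<xi> p"
  by (induction p) (auto simp: const_mult algebra_simps)

lemma peval_mult: "peval \<xi> (p * q) = peval \<xi> p * peval \<xi> q"
  by (induction p) (auto simp: peval_add peval_smult algebra_simps)

lemma peval_uminus: "peval \<xi> (- p) = - peval \<xi> p"
  using peval_smult[of \<xi> "- 1" p] by (simp add: const_uminus)

lemma peval_diff: "peval \<xi> (p - q) = peval \<xi> p - peval \<xi> q"
  using peval_add[of \<xi> p "- q"] by (simp add: peval_uminus)

lemma peval_power: "peval \<xi> (p ^ n) = peval \<xi> p ^ n"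
  by (induction n) (auto simp: peval_mult)

text \<open>Over the algebraically closed \<open>qbar\<close> a polynomial splits, so its root
  \<open>\<xi>\<close> is a root of a linear factor. Hence every element outside
  \<open>range const\<close> is transcendental.\<close>

lemma const_algebraically_closed:
  assumes "peval \<xi> p = 0" "p \<noteq> 0"
  shows "\<xi> \<in> range const"
  using assms
proof (induction "degree p" arbitrary: p rule: less_induct)
  case less
  have "degree p > 0"
  proof (rule ccontr)
    assume "\<not> degree p > 0"
    then obtain c where "p = [:c:]" by (metis degree_eq_zeroE gr0I)
    thus False using less by simp
  qed
  then obtain c where "poly p c = 0"
    using alg_closed_imp_poly_has_root by blast
  then obtain q where q: "p = [:- c, 1:] * q"
    by (metis dvdE poly_eq_0_iff_dvd)
  with less(3) have "q \<noteq> 0" by auto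
  have "(\<xi> - const c) * peval \<xi> q = 0"
    using less(2) unfolding q peval_mult by (simp add: const_uminus)
  moreover have "degree q < degree p"
    unfolding q using \<open>q \<noteq> 0\<close> degree_mult_eq[of "[:- c, 1:]" q] by (simp del: mult_pCons_left)
  ultimately show ?case
    using less(1)[of q] \<open>q \<noteq> 0\<close> by (cases "\<xi> = const c") auto
qed

lemma var_x_not_const: "var_x \<notin> range const"
  by (auto simp: var_x_def const_def eq_fract)

section \<open>The cubic has no rational parametrization\<close>

context
  fixes t :: qbar
  assumes t_mu3: "t ^ 3 \<noteq> 1"
begin

text \<open>\<open>\<beta>\<close> stands for \<open>- y\<close>. Comparing degrees forces
  \<open>\<beta> = [:e, f:]\<close>, and the coefficients give \<open>e ^ 3 = 1\<close>,
  \<open>f ^ 3 = 1\<close> and \<open>f * e = t\<close>, against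
  \<open>t ^ 3 \<noteq> 1\<close>.\<close>

lemma cubic_no_polynomial_root:
  fixes \<beta> :: "qbar poly"
  shows "\<beta> ^ 3 \<noteq> [:0, 3 * t:] * \<beta> + [:1, 0, 0, 1:]"
proof
  assume eq: "\<beta> ^ 3 = [:0, 3 * t:] * \<beta> + [:1, 0, 0, 1:]"
  have "degree \<beta> \<le> 1"
  proof (rule ccontr)
    assume deg: "\<not> degree \<beta> \<le> 1"
    hence "degree (\<beta> ^ 3) = 3 * degree \<beta>"
      by (subst degree_power_eq) auto
    moreover have "degree ([:0, 3 * t:] * \<beta>) \<le> 1 + degree \<beta>"
      using degree_mult_le[of "[:0, 3 * t:]" \<beta>] by (rule order.trans) simp
    hence "degree ([:0, 3 * t:] * \<beta> + [:1, 0, 0, 1:]) \<le> max (1 + degree \<beta>) 3"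
      by (intro degree_add_le_max[THEN order.trans] max.mono) auto
    ultimately show False using eq deg by (auto simp: max_def split: if_splits)
  qed
  hence "\<beta> = [:Polynomial.coeff \<beta> 0, Polynomial.coeff \<beta> 1:]"
    by (intro poly_eqI) (auto simp: coeff_pCons coeff_eq_0 split: nat.splits)
  then obtain e f where \<beta>: "\<beta> = [:e, f:]" by blast
  have "e ^ 3 = 1" "f ^ 3 = 1" "f ^ 2 * e = t * f"
    using eq unfolding \<beta> by (auto simp: power3_eq_cube power2_eq_square algebra_simps)
  moreover from this have "f \<noteq> 0" by auto
  moreover have "f * (f * e) = f * t"
    using \<open>f ^ 2 * e = t * f\<close> by (simp add: power2_eq_square mult_ac)
  ultimately have "f * e = t" by simp
  hence "t ^ 3 = 1"
    using \<open>e ^ 3 = 1\<close> \<open>f ^ 3 = 1\<close> power_mult_distrib[of f e 3] by simp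
  with t_mu3 show False by simp
qed

text \<open>Descent for the fraction \<open>\<beta> / \<alpha>\<close>: at a zero of
  \<open>\<alpha>\<close> the equation makes \<open>\<beta>\<close> vanish too, and by homogeneity
  the common linear factor cancels, until \<open>\<alpha>\<close> is constant. In degree three this
  amounts to irreducibility over the rational functions.\<close>

lemma cubic_no_rational_root:
  fixes \<alpha> \<beta> :: "qbar poly"
  assumes "\<alpha> \<noteq> 0"
  shows "\<beta> ^ 3 \<noteq> [:0, 3 * t:] * \<alpha> ^ 2 * \<beta> + [:1, 0, 0, 1:] * \<alpha> ^ 3"
  using assms
proof (induction "degree \<alpha>" arbitrary: \<alpha> \<beta> rule: less_induct)
  case less
  show ?case
  proof
    assume eq: "\<beta> ^ 3 = [:0, 3 * t:] * \<alpha> ^ 2 * \<beta> + [:1, 0, 0, 1:] * \<alpha> ^ 3"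
    show False
    proof (cases "degree \<alpha> = 0")
      case True
      then obtain c where \<alpha>: "\<alpha> = [:c:]" by (metis degree_eq_zeroE)
      with less have c: "c \<noteq> 0" by auto
      define \<gamma> where "\<gamma> = smult (inverse c) \<beta>"
      have \<beta>: "\<beta> = smult c \<gamma>" using c by (simp add: \<gamma>_def)
      have "smult (c ^ 3) (\<gamma> ^ 3) = smult (c ^ 3) ([:0, 3 * t:] * \<gamma> + [:1, 0, 0, 1:])"
        using eq unfolding \<alpha> \<beta> by (simp add: smult_power power3_eq_cube power2_eq_square smult_add_right algebra_simps)
      hence "\<gamma> ^ 3 = [:0, 3 * t:] * \<gamma> + [:1, 0, 0, 1:]"
        using c by (metis smult_cancel power_not_zero smult_eq_iff)
      thus False using cubic_no_polynomial_root by blast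
    next
      case False
      then obtain c where c: "poly \<alpha> c = 0"
        using alg_closed_imp_poly_has_root[of \<alpha>] by blast
      have "poly (\<beta> ^ 3) c = 0" unfolding eq using c by simp
      hence "poly \<beta> c = 0" by simp
      with c obtain \<alpha>' \<beta>' where ab: "\<alpha> = [:- c, 1:] * \<alpha>'" "\<beta> = [:- c, 1:] * \<beta>'"
        by (metis dvdE poly_eq_0_iff_dvd)
      with less have "\<alpha>' \<noteq> 0" by auto
      have "[:- c, 1:] ^ 3 * \<beta>' ^ 3 = [:- c, 1:] ^ 3 * ([:0, 3 * t:] * \<alpha>' ^ 2 * \<beta>' + [:1, 0, 0, 1:] * \<alpha>' ^ 3)"
      proof -
        define l where "l = [:- c, 1:]"
        define P where "P = [:0, 3 * t:]"
        define Q where "Q = ([:1, 0, 0, 1:] :: qbar poly)"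
        show ?thesis
          using eq unfolding ab l_def[symmetric] P_def[symmetric] Q_def[symmetric]
          by (simp add: power_mult_distrib algebra_simps power3_eq_cube power2_eq_square)
      qed
      hence "\<beta>' ^ 3 = [:0, 3 * t:] * \<alpha>' ^ 2 * \<beta>' + [:1, 0, 0, 1:] * \<alpha>' ^ 3"
        by (subst (asm) mult_left_cancel) auto
      moreover have "degree \<alpha>' < degree \<alpha>"
        unfolding ab using \<open>\<alpha>' \<noteq> 0\<close> degree_mult_eq[of "[:- c, 1:]" \<alpha>'] by (simp del: mult_pCons_left)
      ultimately show False using less(1)[of \<alpha>' \<beta>'] \<open>\<alpha>' \<noteq> 0\<close> by blast
    qed
  qed
qed

end


section \<open>An affine chart of the cubic\<close>

text \<open>The chart is given by a generic point \<open>(\<xi>, \<eta>)\<close> and a closed point \<open>(a, b)\<close> at which the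
  vertical partial derivative of the cubic does not vanish, so that \<open>\<xi> - a\<close> is a uniformizer.\<close>

locale chart =
  fixes t :: qbar and \<xi> \<eta> :: omega and a b :: qbar
  assumes t_mu3: "t ^ 3 \<noteq> 1"
    and \<xi>_generic: "\<xi> \<notin> range const"
    and generic_cubic: "\<xi> ^ 3 + \<eta> ^ 3 + 1 = 3 * const t * \<xi> * \<eta>"
    and point_cubic: "a ^ 3 + b ^ 3 + 1 = 3 * t * a * b"
    and smooth: "b ^ 2 \<noteq> t * a"
begin

section \<open>Independence of \<open>1\<close>, \<open>\<eta>\<close>,
  \<open>\<eta>\<^sup>2\<close> over the polynomials in \<open>\<xi>\<close>\<close>

lemma peval_eq_0_iff [simp]: "peval \<xi> p = 0 \<longleftrightarrow> p = 0"
  using const_algebraically_closed \<xi>_generic by auto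

definition ev :: "qbar poly \<Rightarrow> qbar poly \<Rightarrow> qbar poly \<Rightarrow> omega" where
  "ev r0 r1 r2 = peval \<xi> r0 + peval \<xi> r1 * \<eta> + peval \<xi> r2 * \<eta> ^ 2"

definition pv :: "qbar poly \<Rightarrow> qbar poly \<Rightarrow> qbar poly \<Rightarrow> qbar" where
  "pv r0 r1 r2 = poly r0 a + poly r1 a * b + poly r2 a * b ^ 2"

text \<open>Chosen so that the cubic reads \<open>\<eta> ^ 3 = P * \<eta> + Q\<close>.\<close>

abbreviation "P \<equiv> ([:0, 3 * t:] :: qbar poly)"
abbreviation "Q \<equiv> ([:- 1, 0, 0, - 1:] :: qbar poly)"

lemma peval_P: "peval \<xi> P = 3 * const t * \<xi>"
  and peval_Q: "peval \<xi> Q = - 1 - \<xi> ^ 3"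
  by (simp_all add: const_mult const_numeral const_uminus power3_eq_cube algebra_simps)

lemma \<eta>_cubed: "\<eta> * (\<eta> * \<eta>) = peval \<xi> P * \<eta> + peval \<xi> Q"
  using generic_cubic unfolding peval_P peval_Q by (simp add: power3_eq_cube algebra_simps)

lemma b_cubed: "b * (b * b) = poly P a * b + poly Q a"
  using point_cubic by (simp add: power3_eq_cube algebra_simps)

lemma no_root: "\<alpha> \<noteq> 0 \<Longrightarrow> \<beta> ^ 3 \<noteq> P * \<alpha> ^ 2 * \<beta> - Q * \<alpha> ^ 3"
proof -
  assume "\<alpha> \<noteq> 0"
  moreover have "Q = - [:1, 0, 0, 1:]" by simp
  hence "P * \<alpha> ^ 2 * \<beta> - Q * \<alpha> ^ 3 = P * \<alpha> ^ 2 * \<beta> + [:1, 0, 0, 1:] * \<alpha> ^ 3"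
    by (simp only: minus_mult_left[symmetric] diff_minus_eq_add)
  ultimately show ?thesis using cubic_no_rational_root[OF t_mu3, of \<alpha> \<beta>] by metis
qed


text \<open>The hypotheses would make \<open>r1 / r2\<close> a rational root of
  \<open>Y ^ 3 = P * Y + Q\<close>. They express that the linear remainder vanishes when a quadratic
  relation for \<open>\<eta>\<close> is reduced by the cubic.\<close>

lemma no_degenerate:
  assumes "r1 ^ 2 - r0 * r2 = P * r2 ^ 2" "r0 * r1 = Q * r2 ^ 2"
  shows "r2 = 0"
proof (rule ccontr)
  assume "r2 \<noteq> 0"
  have "r1 ^ 3 = r1 * (r1 ^ 2 - r0 * r2) + r2 * (r0 * r1)"
    by (simp add: power3_eq_cube power2_eq_square algebra_simps)
  also have "\<dots> = P * r2 ^ 2 * r1 + Q * r2 ^ 3"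
    unfolding assms by (simp only: power3_eq_cube power2_eq_square mult_ac)
  finally have r1: "r1 ^ 3 = P * r2 ^ 2 * r1 + Q * r2 ^ 3" .
  have "- (u * r1 + v) = u * (- r1) - v" for u v by simp
  note this[of "P * r2 ^ 2" "Q * r2 ^ 3"]
  moreover have "(- r1) ^ 3 = - (r1 ^ 3)" by simp
  ultimately have "(- r1) ^ 3 = P * r2 ^ 2 * (- r1) - Q * r2 ^ 3"
    unfolding r1[symmetric] by (rule trans[rotated])
  thus False using no_root[OF \<open>r2 \<noteq> 0\<close>, of "- r1"] by blast
qed

text \<open>A nontrivial relation would make \<open>\<eta>\<close> a rational function of
  \<open>\<xi>\<close> solving the cubic.\<close>

lemma linear_independent:
  assumes "peval \<xi> \<alpha> * \<eta> + peval \<xi> \<beta> = 0"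
  shows "\<alpha> = 0 \<and> \<beta> = 0"
proof (rule ccontr)
  assume "\<not> (\<alpha> = 0 \<and> \<beta> = 0)"
  with assms have \<alpha>: "\<alpha> \<noteq> 0" by auto
  define A where "A = peval \<xi> \<alpha>"
  define p where "p = peval \<xi> P"
  define q where "q = peval \<xi> Q"
  have \<beta>: "peval \<xi> \<beta> = - (A * \<eta>)" using assms by (simp add: A_def eq_neg_iff_add_eq_0 add.commute)
  have "peval \<xi> (\<beta> ^ 3) = - (A ^ 3 * (\<eta> * (\<eta> * \<eta>)))"
    unfolding peval_power \<beta> by (simp add: power3_eq_cube mult_ac)
  also have "\<dots> = - (A ^ 3 * (p * \<eta> + q))" unfolding \<eta>_cubed p_def q_def ..
  also have "\<dots> = p * A ^ 2 * (- (A * \<eta>)) - q * A ^ 3"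
    by (simp add: power3_eq_cube power2_eq_square algebra_simps)
  also have "\<dots> = peval \<xi> (P * \<alpha> ^ 2 * \<beta> - Q * \<alpha> ^ 3)"
    unfolding peval_diff peval_mult peval_power \<beta> A_def p_def q_def ..
  finally have "peval \<xi> (\<beta> ^ 3 - (P * \<alpha> ^ 2 * \<beta> - Q * \<alpha> ^ 3)) = 0"
    by (simp only: peval_diff diff_self)
  hence "\<beta> ^ 3 = P * \<alpha> ^ 2 * \<beta> - Q * \<alpha> ^ 3" by (simp only: peval_eq_0_iff right_minus_eq)
  with no_root[OF \<alpha>] show False by blast
qed

lemma ev_eq_0D:
  assumes "ev r0 r1 r2 = 0"
  shows "r0 = 0 \<and> r1 = 0 \<and> r2 = 0"
proof -
  define A B C p q where "A = peval \<xi> r0" and "B = peval \<xi> r1" and "C = peval \<xi> r2"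
    and "p = peval \<xi> P" and "q = peval \<xi> Q"
  note defs = A_def B_def C_def p_def q_def
  have 0: "A + B * \<eta> + C * \<eta> ^ 2 = 0" using assms by (simp add: ev_def defs)
  \<comment> \<open>The factor \<open>B - C * \<eta>\<close> is chosen to cancel the quadratic
    terms; reducing the cubic term leaves a linear relation.\<close>
  have "(B ^ 2 - A * C - p * C ^ 2) * \<eta> + (A * B - q * C ^ 2) =
      (A + B * \<eta> + C * \<eta> ^ 2) * (B - C * \<eta>) + C ^ 2 * (\<eta> * (\<eta> * \<eta>) - (p * \<eta> + q))"
    by (simp add: power2_eq_square algebra_simps)
  also have "\<dots> = 0" unfolding 0 using \<eta>_cubed by (simp add: defs)
  finally have "peval \<xi> (r1 ^ 2 - r0 * r2 - P * r2 ^ 2) * \<eta> + peval \<xi> (r0 * r1 - Q * r2 ^ 2) = 0"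
    unfolding peval_diff peval_mult peval_power defs .
  from linear_independent[OF this] have "r1 ^ 2 - r0 * r2 = P * r2 ^ 2" "r0 * r1 = Q * r2 ^ 2"
    by (simp_all only: right_minus_eq)
  hence "r2 = 0" by (rule no_degenerate)
  moreover from this have "peval \<xi> r1 * \<eta> + peval \<xi> r0 = 0"
    using 0 by (simp add: defs add.commute)
  ultimately show ?thesis using linear_independent by blast
qed

text \<open>The cofactor is read off the first row of the adjugate of the matrix of multiplication by
  \<open>ev r0 r1 r2\<close> on the basis \<open>1\<close>, \<open>\<eta>\<close>, \<open>\<eta>\<^sup>2\<close>, and \<open>N\<close> is its determinant.\<close>

lemma ev_norm:
  assumes "ev r0 r1 r2 \<noteq> 0"
  obtains g0 g1 g2 N where "N \<noteq> 0" "ev r0 r1 r2 * ev g0 g1 g2 = peval \<xi> N"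
proof -
  define g0 where "g0 = (r0 + r2 * P) ^ 2 - r1 * (r1 * P + r2 * Q)"
  define g1 where "g1 = r2 ^ 2 * Q - r0 * r1"
  define g2 where "g2 = r1 ^ 2 - r2 * (r0 + r2 * P)"
  define N where "N = r0 * g0 + Q * (r2 * g1 + r1 * g2)"
  have eq: "ev r0 r1 r2 * ev g0 g1 g2 = peval \<xi> N"
  proof -
    define A B C p q where "A = peval \<xi> r0" and "B = peval \<xi> r1" and "C = peval \<xi> r2"
      and "p = peval \<xi> P" and "q = peval \<xi> Q"
    note defs = A_def B_def C_def p_def q_def
    have \<eta>3: "\<eta> * (\<eta> * \<eta>) = p * \<eta> + q" using \<eta>_cubed by (simp only: defs)
    have \<eta>4: "\<eta> * (\<eta> * (\<eta> * u)) = (p * \<eta> + q) * u" for u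
      using \<eta>3 by (metis mult.assoc)
    show ?thesis
      unfolding ev_def N_def g0_def g1_def g2_def peval_add peval_diff peval_mult peval_power defs[symmetric]
      by (simp add: power2_eq_square algebra_simps \<eta>3 \<eta>4)
  qed
  have "N \<noteq> 0"
  proof
    assume "N = 0"
    hence "ev g0 g1 g2 = 0" using eq assms by simp
    hence g: "g0 = 0" "g1 = 0" "g2 = 0" using ev_eq_0D by auto
    \<comment> \<open>The vanishing of \<open>g1\<close> and \<open>g2\<close> is the situation of
      \<open>no_degenerate\<close>.\<close>
    have "r1 ^ 2 - r0 * r2 = P * r2 ^ 2" "r0 * r1 = Q * r2 ^ 2"
      using g(2,3) unfolding g1_def g2_def by (simp_all only: right_minus_eq) (simp_all add: power2_eq_square algebra_simps del: mult_pCons_left mult_pCons_right)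
    hence "r2 = 0" by (rule no_degenerate)
    with g have "r1 = 0" "r0 = 0" by (auto simp: g2_def g0_def)
    with \<open>r2 = 0\<close> assms show False by (simp add: ev_def)
  qed
  with eq show ?thesis by (rule that[rotated])
qed

text \<open>\<open>aff F \<alpha>\<close>: some polynomial has value \<open>F\<close> at the generic and \<open>\<alpha>\<close> at the closed point.\<close>

definition aff :: "omega \<Rightarrow> qbar \<Rightarrow> bool" where
  "aff F \<alpha> \<longleftrightarrow> (\<exists>r0 r1 r2. F = ev r0 r1 r2 \<and> \<alpha> = pv r0 r1 r2)"

lemma aff_const: "aff (const c) c"
  unfolding aff_def by (intro exI[of _ "[:c:]"] exI[of _ 0]) (auto simp: ev_def pv_def)

lemma aff_\<xi>: "aff \<xi> a"
  unfolding aff_def by (intro exI[of _ "[:0, 1:]"] exI[of _ 0]) (auto simp: ev_def pv_def)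

lemma aff_add: "aff F \<alpha> \<Longrightarrow> aff G \<beta> \<Longrightarrow> aff (F + G) (\<alpha> + \<beta>)"
proof -
  assume "aff F \<alpha>" "aff G \<beta>"
  then obtain r0 r1 r2 s0 s1 s2 where "F = ev r0 r1 r2" "\<alpha> = pv r0 r1 r2" "G = ev s0 s1 s2" "\<beta> = pv s0 s1 s2"
    unfolding aff_def by blast
  thus ?thesis unfolding aff_def
    by (intro exI[of _ "r0 + s0"] exI[of _ "r1 + s1"] exI[of _ "r2 + s2"])
      (simp add: ev_def pv_def peval_add algebra_simps)
qed

lemma aff_peval_mult: "aff F \<alpha> \<Longrightarrow> aff (peval \<xi> r * F) (poly r a * \<alpha>)"
proof -
  assume "aff F \<alpha>"
  then obtain r0 r1 r2 where "F = ev r0 r1 r2" "\<alpha> = pv r0 r1 r2"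
    unfolding aff_def by blast
  thus ?thesis unfolding aff_def
    by (intro exI[of _ "r * r0"] exI[of _ "r * r1"] exI[of _ "r * r2"])
      (simp add: ev_def pv_def peval_mult algebra_simps)
qed

lemma aff_\<eta>_mult: "aff F \<alpha> \<Longrightarrow> aff (\<eta> * F) (b * \<alpha>)"
proof -
  assume "aff F \<alpha>"
  then obtain r0 r1 r2 where r: "F = ev r0 r1 r2" "\<alpha> = pv r0 r1 r2"
    unfolding aff_def by blast
  have "\<eta> * F = peval \<xi> r0 * \<eta> + peval \<xi> r1 * \<eta> ^ 2 + peval \<xi> r2 * (\<eta> * (\<eta> * \<eta>))"
    unfolding r ev_def by (simp add: power2_eq_square algebra_simps)
  also have "\<dots> = ev (Q * r2) (r0 + P * r2) r1"
    unfolding \<eta>_cubed ev_def peval_add peval_mult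
    by (simp add: algebra_simps del: peval_pCons)
  finally have 1: "\<eta> * F = ev (Q * r2) (r0 + P * r2) r1" .
  have "b * \<alpha> = poly r0 a * b + poly r1 a * b ^ 2 + poly r2 a * (b * (b * b))"
    unfolding r pv_def by (simp add: power2_eq_square algebra_simps)
  also have "\<dots> = pv (Q * r2) (r0 + P * r2) r1"
    unfolding b_cubed pv_def poly_add poly_mult
    by (simp add: algebra_simps del: poly_pCons)
  finally show ?thesis using 1 unfolding aff_def by blast
qed

lemma aff_\<eta>: "aff \<eta> b"
  using aff_\<eta>_mult[OF aff_const[of 1]] by simp

lemma aff_peval: "aff (peval \<xi> r) (poly r a)"
  using aff_peval_mult[OF aff_const[of 1], of r] by simp

lemma aff_mult: "aff F \<alpha> \<Longrightarrow> aff G \<beta> \<Longrightarrow> aff (F * G) (\<alpha> * \<beta>)"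
proof -
  assume F: "aff F \<alpha>" and G: "aff G \<beta>"
  then obtain r0 r1 r2 where r: "F = ev r0 r1 r2" "\<alpha> = pv r0 r1 r2"
    unfolding aff_def by blast
  have "aff (peval \<xi> r0 * G + peval \<xi> r1 * (\<eta> * G) + peval \<xi> r2 * (\<eta> * (\<eta> * G)))
      (poly r0 a * \<beta> + poly r1 a * (b * \<beta>) + poly r2 a * (b * (b * \<beta>)))"
    by (intro aff_add aff_peval_mult aff_\<eta>_mult G)
  thus ?thesis unfolding r ev_def pv_def by (simp add: power2_eq_square algebra_simps)
qed

lemma aff_uminus: "aff F \<alpha> \<Longrightarrow> aff (- F) (- \<alpha>)"
  using aff_mult[OF aff_const[of "- 1"]] by (simp add: const_uminus)

lemma aff_diff: "aff F \<alpha> \<Longrightarrow> aff G \<beta> \<Longrightarrow> aff (F - G) (\<alpha> - \<beta>)"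
  using aff_add[OF _ aff_uminus, of F \<alpha> G \<beta>] by simp

lemma aff_power: "aff F \<alpha> \<Longrightarrow> aff (F ^ n) (\<alpha> ^ n)"
  using aff_const[of 1] by (induction n) (auto intro: aff_mult)

text \<open>By \<open>ev_eq_0D\<close> a reduced polynomial vanishing at the generic point has zero
  coefficients, hence vanishes at the closed point as well. This makes specialization well
  defined.\<close>

lemma aff_unique: "aff F \<alpha> \<Longrightarrow> aff F \<beta> \<Longrightarrow> \<alpha> = \<beta>"
proof -
  assume "aff F \<alpha>" "aff F \<beta>"
  hence "aff 0 (\<alpha> - \<beta>)" using aff_diff by fastforce
  then obtain r0 r1 r2 where "0 = ev r0 r1 r2" "\<alpha> - \<beta> = pv r0 r1 r2"
    unfolding aff_def by blast
  thus ?thesis using ev_eq_0D[of r0 r1 r2] by (simp add: pv_def)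
qed

lemma aff_nonzero: "aff F \<alpha> \<Longrightarrow> \<alpha> \<noteq> 0 \<Longrightarrow> F \<noteq> 0"
  using aff_unique[OF _ aff_const[of 0]] by auto

text \<open>Modulo \<open>\<xi> - a\<close> the cubic, minus its value at the closed point, is \<open>\<eta> - b\<close> times this function,
  whose value there is the vertical partial derivative.\<close>

definition transversal :: omega where
  "transversal = \<eta> ^ 2 + \<eta> * const b + const (b ^ 2 - 3 * t * a)"

lemma aff_transversal: "aff transversal (3 * (b ^ 2 - t * a))"
proof -
  have "aff transversal (b ^ 2 + b * b + (b ^ 2 - 3 * t * a))"
    unfolding transversal_def by (intro aff_add aff_mult aff_power aff_\<eta> aff_const)
  thus ?thesis by (simp add: power2_eq_square algebra_simps)
qed

text \<open>Modulo \<open>\<xi> - a\<close> the function \<open>F\<close> is a multiple of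
  \<open>\<eta> - b\<close>, and \<open>\<eta> - b\<close> times \<open>transversal\<close> is a
  multiple of \<open>\<xi> - a\<close>. Multiplying by \<open>transversal\<close>, instead of
  inverting it at the point, keeps \<open>G\<close> polynomial.\<close>

lemma uniformizer_divides:
  assumes "aff F 0"
  obtains G \<gamma> where "aff G \<gamma>" "F * transversal = (\<xi> - const a) * G"
proof -
  obtain r0 r1 r2 where r: "F = ev r0 r1 r2" "0 = pv r0 r1 r2"
    using assms unfolding aff_def by blast
  have split: "\<exists>s. peval \<xi> r = const (poly r a) + (\<xi> - const a) * peval \<xi> s" for r
  proof -
    have "poly (r - [:poly r a:]) a = 0" by simp
    then obtain s where "r - [:poly r a:] = [:- a, 1:] * s"
      by (metis dvdE poly_eq_0_iff_dvd)
    hence "peval \<xi> (r - [:poly r a:]) = peval \<xi> ([:- a, 1:] * s)" by simp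
    hence "peval \<xi> r - const (poly r a) = (\<xi> - const a) * peval \<xi> s"
      unfolding peval_diff peval_mult by (simp add: const_uminus)
    thus ?thesis by (metis add.commute diff_add_cancel)
  qed
  obtain s0 s1 s2 where s: "peval \<xi> r0 = const (poly r0 a) + (\<xi> - const a) * peval \<xi> s0"
    "peval \<xi> r1 = const (poly r1 a) + (\<xi> - const a) * peval \<xi> s1"
    "peval \<xi> r2 = const (poly r2 a) + (\<xi> - const a) * peval \<xi> s2"
    using split by metis
  define A B C where "A = const (poly r0 a)" and "B = const (poly r1 a)" and "C = const (poly r2 a)"
  have "const (pv r0 r1 r2) = 0" using r(2) by simp
  hence A: "A = - B * const b - C * const b ^ 2"
    unfolding A_def B_def C_def pv_def by (simp add: const_add const_mult const_power algebra_simps eq_neg_iff_add_eq_0)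
  have "F = ev s0 s1 s2 * (\<xi> - const a) + (\<eta> - const b) * (B + C * (\<eta> + const b))"
    unfolding r(1) ev_def s A_def[symmetric] B_def[symmetric] C_def[symmetric] A
    by (simp add: power2_eq_square algebra_simps)
  \<comment> \<open>The difference of the cubic equations at the generic and at the closed point,
    rearranged.\<close>
  moreover have "(\<eta> - const b) * transversal = (\<xi> - const a) * (const (3 * t) * \<eta> - (\<xi> ^ 2 + const a * \<xi> + const (a ^ 2)))"
  proof -
    have "const (a ^ 3 + b ^ 3 + 1) = const (3 * t * a * b)" using point_cubic by simp
    hence point: "const a ^ 3 + const b ^ 3 + 1 = 3 * const t * const a * const b"
      by (simp add: const_add const_mult const_power const_numeral)
    have "const a ^ 3 + const b ^ 3 - 3 * const t * const a * const b = - 1"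
      unfolding point[symmetric] by simp
    moreover have "\<xi> ^ 3 + \<eta> ^ 3 - 3 * const t * \<xi> * \<eta> = - 1"
      unfolding generic_cubic[symmetric] by simp
    ultimately have "\<xi> ^ 3 + \<eta> ^ 3 - 3 * const t * \<xi> * \<eta> = const a ^ 3 + const b ^ 3 - 3 * const t * const a * const b"
      by (simp only:)
    moreover have "(\<eta> - const b) * transversal - (\<xi> - const a) * (const (3 * t) * \<eta> - (\<xi> ^ 2 + const a * \<xi> + const (a ^ 2)))
      = (\<xi> ^ 3 + \<eta> ^ 3 - 3 * const t * \<xi> * \<eta>) - (const a ^ 3 + const b ^ 3 - 3 * const t * const a * const b)"
      unfolding transversal_def const_diff const_mult const_power const_numeral
      by (simp add: power3_eq_cube power2_eq_square algebra_simps)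
    ultimately show ?thesis by simp
  qed
  ultimately have "F * transversal = (\<xi> - const a) * (ev s0 s1 s2 * transversal +
      (const (3 * t) * \<eta> - (\<xi> ^ 2 + const a * \<xi> + const (a ^ 2))) * (B + C * (\<eta> + const b)))"
    by (simp add: distrib_right distrib_left mult_ac)
  moreover have "aff (ev s0 s1 s2) (pv s0 s1 s2)" unfolding aff_def by blast
  hence "aff (ev s0 s1 s2 * transversal + (const (3 * t) * \<eta> - (\<xi> ^ 2 + const a * \<xi> + const (a ^ 2))) * (B + C * (\<eta> + const b)))
      (pv s0 s1 s2 * (3 * (b ^ 2 - t * a)) + (3 * t * b - (a ^ 2 + a * a + a ^ 2)) * (poly r1 a + poly r2 a * (b + b)))"
    unfolding B_def C_def
    by (intro aff_add aff_mult aff_diff aff_power aff_transversal aff_const aff_\<eta> aff_\<xi>)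
  ultimately show ?thesis using that by blast
qed

text \<open>The order of the norm of \<open>F\<close> at \<open>a\<close> bounds how often \<open>\<xi> - a\<close> can be split off.\<close>

lemma aff_factor:
  assumes F: "aff F \<alpha>" "F \<noteq> 0"
  obtains n :: nat and j :: nat and G \<gamma> where "aff G \<gamma>" "\<gamma> \<noteq> 0"
    "F * transversal ^ j = (\<xi> - const a) ^ n * G"
proof -
  let ?p = "\<xi> - const a"
  have "aff ?p (a - a)" by (intro aff_diff aff_\<xi> aff_const)
  hence p: "aff ?p 0" by simp
  have p_nz: "?p \<noteq> 0" using \<xi>_generic by auto
  let ?\<delta> = "3 * (b ^ 2 - t * a)"
  have \<delta>: "?\<delta> \<noteq> 0" using smooth by simp
  have T: "aff (transversal ^ j) (?\<delta> ^ j)" for j by (intro aff_power aff_transversal)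
  have "\<exists>n j G \<gamma>. aff G \<gamma> \<and> \<gamma> \<noteq> 0 \<and> F * transversal ^ j = ?p ^ n * G"
  proof (rule ccontr)
    assume contra: "\<not> ?thesis"
    \<comment> \<open>If every cofactor vanished at the point, \<open>\<xi> - a\<close> could be
      split off indefinitely.\<close>
    have divides: "\<exists>G \<gamma>. aff G \<gamma> \<and> F * transversal ^ n = ?p ^ n * G" for n
    proof (induction n)
      case 0
      show ?case using F by auto
    next
      case (Suc n)
      then obtain G \<gamma> where G: "aff G \<gamma>" "F * transversal ^ n = ?p ^ n * G" by blast
      hence "\<gamma> = 0" using contra by blast
      with G obtain H \<delta> where "aff H \<delta>" "G * transversal = ?p * H"
        using uniformizer_divides by blast
      moreover have "F * transversal ^ Suc n = ?p ^ n * (G * transversal)"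
        using G(2) by (simp add: mult_ac)
      ultimately show ?case by (intro exI[of _ H] exI[of _ \<delta>]) (simp add: mult_ac)
    qed
    obtain r0 r1 r2 where r: "F = ev r0 r1 r2" using F(1) unfolding aff_def by blast
    with F(2) obtain g0 g1 g2 N where N: "N \<noteq> 0" "F * ev g0 g1 g2 = peval \<xi> N"
      using ev_norm by metis
    define k where "k = Polynomial.order a N"
    obtain L where L: "N = [:- a, 1:] ^ k * L" "poly L a \<noteq> 0"
      using order_decomp[OF N(1), of a] unfolding k_def by (metis poly_eq_0_iff_dvd)
    have pN: "peval \<xi> N = ?p ^ k * peval \<xi> L"
      unfolding L(1) peval_mult peval_power by (simp add: const_uminus)
    \<comment> \<open>One factor more than the norm allows: after cancelling \<open>?p ^ k\<close>
      the side with the remaining \<open>?p\<close> vanishes at the point, while the other does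
      not.\<close>
    obtain G \<gamma> where G: "aff G \<gamma>" "F * transversal ^ Suc k = ?p ^ Suc k * G"
      using divides by blast
    have "?p ^ k * (peval \<xi> L * transversal ^ Suc k) = peval \<xi> N * transversal ^ Suc k"
      unfolding pN by (simp only: mult_ac)
    also have "\<dots> = (F * transversal ^ Suc k) * ev g0 g1 g2"
      unfolding N(2)[symmetric] by (simp only: mult_ac)
    also have "\<dots> = ?p ^ k * (?p * (G * ev g0 g1 g2))"
      unfolding G(2) by (simp add: mult_ac)
    finally have eq: "peval \<xi> L * transversal ^ Suc k = ?p * (G * ev g0 g1 g2)"
      using p_nz by (simp only: mult_cancel_left) simp
    have "aff (ev g0 g1 g2) (pv g0 g1 g2)" unfolding aff_def by blast
    hence "aff (?p * (G * ev g0 g1 g2)) (0 * (\<gamma> * pv g0 g1 g2))"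
      by (intro aff_mult p G(1))
    moreover have "aff (peval \<xi> L * transversal ^ Suc k) (poly L a * ?\<delta> ^ Suc k)"
      by (intro aff_mult aff_peval T)
    ultimately have "poly L a * ?\<delta> ^ Suc k = 0"
      unfolding eq using aff_unique by fastforce
    thus False using L(2) \<delta> by simp
  qed
  thus ?thesis using that by blast
qed

end

section \<open>Forms and charts\<close>

lemma form_eval_scale:
  fixes x y z k :: "'a::comm_ring_1"
  shows "form_eval d c (k * x, k * y, k * z) = k ^ d * form_eval d c (x, y, z)"
proof -
  have "c i j * (k * x) ^ i * (k * y) ^ j * (k * z) ^ (d - i - j) =
      k ^ d * (c i j * x ^ i * y ^ j * z ^ (d - i - j))" if "i \<le> d" "j \<le> d - i" for i j
  proof -
    have "k ^ d = k ^ i * k ^ j * k ^ (d - i - j)"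
      using that by (simp flip: power_add)
    thus ?thesis by (simp add: power_mult_distrib mult_ac)
  qed
  thus ?thesis by (simp add: sum_distrib_left)
qed

text \<open>Multiplication by a coordinate shifts indices. For \<open>z\<close> the cutoff matters:
  the values of \<open>c\<close> with \<open>i + j = Suc d\<close> are arbitrary and would enter the
  sum of degree \<open>Suc d\<close>.\<close>

lemma form_eval_shift:
  fixes x y z :: "'a::comm_ring_1"
  shows form_eval_shift_x: "form_eval (Suc d) (\<lambda>i j. case i of 0 \<Rightarrow> 0 | Suc i' \<Rightarrow> c i' j) (x, y, z) = x * form_eval d c (x, y, z)"
    and form_eval_shift_y: "form_eval (Suc d) (\<lambda>i j. case j of 0 \<Rightarrow> 0 | Suc j' \<Rightarrow> c i j') (x, y, z) = y * form_eval d c (x, y, z)"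
    and form_eval_shift_z: "form_eval (Suc d) (\<lambda>i j. if i + j \<le> d then c i j else 0) (x, y, z) = z * form_eval d c (x, y, z)"
proof -
  show "form_eval (Suc d) (\<lambda>i j. case i of 0 \<Rightarrow> 0 | Suc i' \<Rightarrow> c i' j) (x, y, z) = x * form_eval d c (x, y, z)"
    by (simp add: sum.atMost_Suc_shift sum_distrib_left mult_ac del: sum.atMost_Suc)
  have "(\<Sum>j\<le>Suc d - i. (case j of 0 \<Rightarrow> 0 | Suc j' \<Rightarrow> c i j') * x ^ i * y ^ j * z ^ (Suc d - i - j)) =
      y * (\<Sum>j\<le>d - i. c i j * x ^ i * y ^ j * z ^ (d - i - j))" if "i \<le> d" for i
    using that by (simp add: Suc_diff_le sum.atMost_Suc_shift sum_distrib_left mult_ac del: sum.atMost_Suc)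
  thus "form_eval (Suc d) (\<lambda>i j. case j of 0 \<Rightarrow> 0 | Suc j' \<Rightarrow> c i j') (x, y, z) = y * form_eval d c (x, y, z)"
    by (simp add: sum_distrib_left)
  have "(\<Sum>j\<le>Suc d - i. (if i + j \<le> d then c i j else 0) * x ^ i * y ^ j * z ^ (Suc d - i - j)) =
      z * (\<Sum>j\<le>d - i. c i j * x ^ i * y ^ j * z ^ (d - i - j))" if "i \<le> d" for i
  proof -
    have "(\<Sum>j\<le>d - i. (if i + j \<le> d then c i j else 0) * x ^ i * y ^ j * z ^ (Suc d - i - j)) =
        (\<Sum>j\<le>d - i. z * (c i j * x ^ i * y ^ j * z ^ (d - i - j)))"
    proof (intro sum.cong refl)
      fix j assume "j \<in> {..d - i}"
      hence "i + j \<le> d" "Suc d - i - j = Suc (d - i - j)" using that by auto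
      thus "(if i + j \<le> d then c i j else 0) * x ^ i * y ^ j * z ^ (Suc d - i - j) =
          z * (c i j * x ^ i * y ^ j * z ^ (d - i - j))"
        by (simp add: mult_ac)
    qed
    thus ?thesis using that by (simp add: Suc_diff_le sum_distrib_left)
  qed
  thus "form_eval (Suc d) (\<lambda>i j. if i + j \<le> d then c i j else 0) (x, y, z) = z * form_eval d c (x, y, z)"
    by (simp add: sum_distrib_left)
qed

locale homogeneous =
  fixes y :: omega and u v w :: qbar
begin

text \<open>The homogeneous counterpart of \<open>aff\<close>; the second value depends on the
  triple and not only on the point.\<close>

definition form :: "nat \<Rightarrow> omega \<Rightarrow> qbar \<Rightarrow> bool" where
  "form d F \<alpha> \<longleftrightarrow> (\<exists>c. F = form_generic y d c \<and> \<alpha> = form_eval d c (u, v, w))"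

lemma form_const: "form 0 (const c) c"
  unfolding form_def by (intro exI[of _ "\<lambda>_ _. c"]) simp

lemma form_add: "form d F \<alpha> \<Longrightarrow> form d G \<beta> \<Longrightarrow> form d (F + G) (\<alpha> + \<beta>)"
proof -
  assume "form d F \<alpha>" "form d G \<beta>"
  then obtain c e where "F = form_generic y d c" "\<alpha> = form_eval d c (u, v, w)"
    "G = form_generic y d e" "\<beta> = form_eval d e (u, v, w)" unfolding form_def by blast
  thus ?thesis unfolding form_def
    by (intro exI[of _ "\<lambda>i j. c i j + e i j"]) (simp add: const_add sum.distrib distrib_right)
qed

lemma form_scale: "form d F \<alpha> \<Longrightarrow> form d (const k * F) (k * \<alpha>)"
proof -
  assume "form d F \<alpha>"
  then obtain c where "F = form_generic y d c" "\<alpha> = form_eval d c (u, v, w)"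
    unfolding form_def by blast
  thus ?thesis unfolding form_def
    by (intro exI[of _ "\<lambda>i j. k * c i j"]) (simp add: const_mult sum_distrib_left mult.assoc)
qed

lemma form_mult_coordinate:
  assumes "form d F \<alpha>"
  shows "form (Suc d) (var_x * F) (u * \<alpha>)" "form (Suc d) (y * F) (v * \<alpha>)" "form (Suc d) (1 * F) (w * \<alpha>)"
proof -
  obtain c where c: "F = form_generic y d c" "\<alpha> = form_eval d c (u, v, w)"
    using assms unfolding form_def by blast
  have 1: "(\<lambda>i j. const (case i of 0 \<Rightarrow> 0 | Suc i' \<Rightarrow> c i' j)) = (\<lambda>i j. case i of 0 \<Rightarrow> 0 | Suc i' \<Rightarrow> const (c i' j))"
    by (auto simp: fun_eq_iff split: nat.splits)
  have 2: "(\<lambda>i j. const (case j of 0 \<Rightarrow> 0 | Suc j' \<Rightarrow> c i j')) = (\<lambda>i j. case j of 0 \<Rightarrow> 0 | Suc j' \<Rightarrow> const (c i j'))"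
    by (auto simp: fun_eq_iff split: nat.splits)
  have 3: "(\<lambda>i j. const (if i + j \<le> d then c i j else 0)) = (\<lambda>i j. if i + j \<le> d then const (c i j) else 0)"
    by (auto simp: fun_eq_iff)
  show "form (Suc d) (var_x * F) (u * \<alpha>)"
    unfolding form_def c
    by (rule exI[of _ "\<lambda>i j. case i of 0 \<Rightarrow> 0 | Suc i' \<Rightarrow> c i' j"]) (simp only: 1 form_eval_shift_x simp_thms)
  show "form (Suc d) (y * F) (v * \<alpha>)"
    unfolding form_def c
    by (rule exI[of _ "\<lambda>i j. case j of 0 \<Rightarrow> 0 | Suc j' \<Rightarrow> c i j'"]) (simp only: 2 form_eval_shift_y simp_thms)
  show "form (Suc d) (1 * F) (w * \<alpha>)"
    unfolding form_def c
    by (rule exI[of _ "\<lambda>i j. if i + j \<le> d then c i j else 0"]) (simp only: 3 form_eval_shift_z simp_thms)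
qed

lemma form_linear:
  "form 1 (const k + const l * var_x + const m * y) (k * w + l * u + m * v)"
proof -
  have "form (Suc 0) (1 * const k + var_x * const l + y * const m) (w * k + u * l + v * m)"
    by (intro form_add form_mult_coordinate form_const)
  thus ?thesis by (simp add: mult_ac)
qed

end

text \<open>A chart of the projective curve at the point \<open>(u, v, w)\<close>: dividing the homogeneous
  coordinates of the generic and of the closed point by their coordinates \<open>k\<close> and \<open>l\<close> of the
  same index yields the affine points of the chart, up to the order of the coordinates.\<close>

locale point_chart = chart t \<xi> \<eta> a b + homogeneous y u v w
  for t \<xi> \<eta> a b y u v w +
  fixes k :: omega and l :: qbar
  assumes k_nz: "k \<noteq> 0" and l_nz: "l \<noteq> 0"
    and coordinates: "{(\<xi>, a), (\<eta>, b), (1, 1)} = {(var_x / k, u / l), (y / k, v / l), (1 / k, w / l)}"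
begin

lemma aff_coordinate: "(f, \<alpha>) \<in> {(\<xi>, a), (\<eta>, b), (1, 1)} \<Longrightarrow> aff f \<alpha>"
  using aff_\<xi> aff_\<eta> aff_const[of 1] by auto

lemma aff_sum: "(\<And>i. i \<in> I \<Longrightarrow> aff (f i) (g i)) \<Longrightarrow> aff (sum f I) (sum g I)"
  using aff_const[of 0] by (induction I rule: infinite_finite_induct) (simp_all add: aff_add)

lemma aff_form:
  assumes "form d F \<alpha>"
  shows "aff (F / k ^ d) (\<alpha> / l ^ d)"
proof -
  obtain c where c: "F = form_generic y d c" "\<alpha> = form_eval d c (u, v, w)"
    using assms unfolding form_def by blast
  have "aff (var_x / k) (u / l)" "aff (y / k) (v / l)" "aff (1 / k) (w / l)"
    by (rule aff_coordinate, unfold coordinates, simp)+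
  hence "aff (form_generic y d c / k ^ d) (form_eval d c (u, v, w) / l ^ d)"
  proof -
    assume *: "aff (var_x / k) (u / l)" "aff (y / k) (v / l)" "aff (1 / k) (w / l)"
    have "aff (form_eval d (\<lambda>i j. const (c i j)) (var_x / k, y / k, 1 / k)) (form_eval d c (u / l, v / l, w / l))"
      unfolding form_eval.simps by (intro aff_sum aff_mult aff_power aff_const *)
    moreover have "form_eval d (\<lambda>i j. const (c i j)) (var_x / k, y / k, 1 / k) = form_generic y d c / k ^ d"
      using form_eval_scale[of d "\<lambda>i j. const (c i j)" k "var_x / k" "y / k" "1 / k"] k_nz
      by (simp add: eq_divide_eq mult.commute del: form_eval.simps)
    moreover have "form_eval d c (u / l, v / l, w / l) = form_eval d c (u, v, w) / l ^ d"
      using form_eval_scale[of d c l "u / l" "v / l" "w / l"] l_nz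
      by (simp add: eq_divide_eq mult.commute del: form_eval.simps)
    ultimately show ?thesis by simp
  qed
  thus ?thesis unfolding c .
qed

text \<open>The direction opposite to \<open>aff_form\<close>: clearing the chart coordinate turns
  polynomials of the chart into forms.\<close>

definition homogenizable :: "nat \<Rightarrow> omega \<Rightarrow> qbar \<Rightarrow> bool" where
  "homogenizable d F \<alpha> \<longleftrightarrow> form d (k ^ d * F) (l ^ d * \<alpha>)"

lemma homogenizable_mult_coordinate:
  assumes "homogenizable d F \<alpha>" "(f, \<beta>) \<in> {(\<xi>, a), (\<eta>, b), (1, 1)}"
  shows "homogenizable (Suc d) (f * F) (\<beta> * \<alpha>)"
proof -
  have "(f, \<beta>) \<in> {(var_x / k, u / l), (y / k, v / l), (1 / k, w / l)}"
    using assms(2) coordinates by simp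
  then consider "k * f = var_x" "l * \<beta> = u" | "k * f = y" "l * \<beta> = v" | "k * f = 1" "l * \<beta> = w"
    using k_nz l_nz by auto
  hence "form (Suc d) ((k * f) * (k ^ d * F)) ((l * \<beta>) * (l ^ d * \<alpha>))"
    using form_mult_coordinate[OF assms(1)[unfolded homogenizable_def]] by cases simp_all
  thus ?thesis unfolding homogenizable_def by (simp add: mult_ac)
qed

text \<open>The pair \<open>(1, 1)\<close> is itself a coordinate of the chart, so degrees can be
  padded; this brings numerator and denominator to a common degree.\<close>

lemma homogenizable_raise: "homogenizable d F \<alpha> \<Longrightarrow> homogenizable (d + n) F \<alpha>"
  using homogenizable_mult_coordinate[of _ F \<alpha> 1 1] by (induction n) auto

lemma homogenizable_add:
  assumes "homogenizable d F \<alpha>" "homogenizable e G \<beta>"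
  shows "homogenizable (d + e) (F + G) (\<alpha> + \<beta>)"
  using form_add[OF homogenizable_raise[OF assms(1), of e, unfolded homogenizable_def]
      homogenizable_raise[OF assms(2), of d, unfolded homogenizable_def add.commute[of e d]]]
  by (simp add: homogenizable_def distrib_left)

lemma homogenizable_scale: "homogenizable d F \<alpha> \<Longrightarrow> homogenizable d (const c * F) (c * \<alpha>)"
  using form_scale[of d "k ^ d * F" "l ^ d * \<alpha>" c] by (simp add: homogenizable_def mult_ac)

lemma homogenizable_peval_mult:
  assumes "homogenizable d F \<alpha>"
  shows "\<exists>e. homogenizable e (peval \<xi> r * F) (poly r a * \<alpha>)"
proof (induction r)
  case 0
  show ?case using homogenizable_scale[OF assms, of 0] by auto
next
  case (pCons c r)
  then obtain e where "homogenizable e (peval \<xi> r * F) (poly r a * \<alpha>)" by blast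
  hence "homogenizable (Suc e) (\<xi> * (peval \<xi> r * F)) (a * (poly r a * \<alpha>))"
    by (rule homogenizable_mult_coordinate) simp
  from homogenizable_add[OF homogenizable_scale[OF assms, of c] this]
  show ?case by (intro exI) (simp add: distrib_right mult.assoc)
qed

lemma aff_homogenizable:
  assumes "aff F \<alpha>"
  obtains d where "homogenizable d F \<alpha>"
proof -
  obtain r0 r1 r2 where r: "F = ev r0 r1 r2" "\<alpha> = pv r0 r1 r2"
    using assms unfolding aff_def by blast
  have 0: "homogenizable 0 1 1"
    using form_const[of 1] by (simp add: homogenizable_def)
  have 1: "homogenizable (Suc 0) \<eta> b"
    using homogenizable_mult_coordinate[OF 0, of \<eta> b] by simp
  have 2: "homogenizable (Suc (Suc 0)) (\<eta> * \<eta>) (b * b)"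
    using homogenizable_mult_coordinate[OF 1, of \<eta> b] by simp
  obtain d0 d1 d2 where "homogenizable d0 (peval \<xi> r0 * 1) (poly r0 a * 1)"
    "homogenizable d1 (peval \<xi> r1 * \<eta>) (poly r1 a * b)"
    "homogenizable d2 (peval \<xi> r2 * (\<eta> * \<eta>)) (poly r2 a * (b * b))"
    using homogenizable_peval_mult[OF 0] homogenizable_peval_mult[OF 1] homogenizable_peval_mult[OF 2] by metis
  from homogenizable_add[OF homogenizable_add[OF this(1,2)] this(3)]
  show ?thesis using that unfolding r ev_def pv_def by (simp add: power2_eq_square)
qed

text \<open>Dictionary between quotients of forms and quotients of chart polynomials. The parameter
  \<open>S\<close> lets one proof serve \<open>function_field\<close>, \<open>local_ring\<close> and
  \<open>value_at\<close>.\<close>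

lemma represents_iff:
  "(\<exists>d c c'. represents y d c c' f \<and> S (form_eval d c (u, v, w) / l ^ d) (form_eval d c' (u, v, w) / l ^ d)) \<longleftrightarrow>
   (\<exists>F \<alpha> G \<beta>. aff F \<alpha> \<and> aff G \<beta> \<and> G \<noteq> 0 \<and> f = F / G \<and> S \<alpha> \<beta>)"
proof
  assume "\<exists>d c c'. represents y d c c' f \<and> S (form_eval d c (u, v, w) / l ^ d) (form_eval d c' (u, v, w) / l ^ d)"
  then obtain d c c' where *: "represents y d c c' f" "S (form_eval d c (u, v, w) / l ^ d) (form_eval d c' (u, v, w) / l ^ d)"
    by blast
  have "form d (form_generic y d c) (form_eval d c (u, v, w))" for c
    unfolding form_def by blast
  from aff_form[OF this] have "aff (form_generic y d c / k ^ d) (form_eval d c (u, v, w) / l ^ d)" for c .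
  moreover have "f = (form_generic y d c / k ^ d) / (form_generic y d c' / k ^ d)" "form_generic y d c' / k ^ d \<noteq> 0"
    using *(1) k_nz unfolding represents_def by (simp_all del: form_eval.simps)
  ultimately show "\<exists>F \<alpha> G \<beta>. aff F \<alpha> \<and> aff G \<beta> \<and> G \<noteq> 0 \<and> f = F / G \<and> S \<alpha> \<beta>"
    using *(2) by blast
next
  assume "\<exists>F \<alpha> G \<beta>. aff F \<alpha> \<and> aff G \<beta> \<and> G \<noteq> 0 \<and> f = F / G \<and> S \<alpha> \<beta>"
  then obtain F \<alpha> G \<beta> where *: "aff F \<alpha>" "aff G \<beta>" "G \<noteq> 0" "f = F / G" "S \<alpha> \<beta>" by blast
  from *(1,2) obtain d e where "homogenizable d F \<alpha>" "homogenizable e G \<beta>"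
    using aff_homogenizable by metis
  hence "homogenizable (d + e) F \<alpha>" "homogenizable (d + e) G \<beta>"
    using homogenizable_raise[of d F \<alpha> e] homogenizable_raise[of e G \<beta> d] by (simp_all add: add.commute)
  then obtain c c' where c: "k ^ (d + e) * F = form_generic y (d + e) c" "l ^ (d + e) * \<alpha> = form_eval (d + e) c (u, v, w)"
    "k ^ (d + e) * G = form_generic y (d + e) c'" "l ^ (d + e) * \<beta> = form_eval (d + e) c' (u, v, w)"
    unfolding homogenizable_def form_def by blast
  have "represents y (d + e) c c' f"
    unfolding represents_def c[symmetric] using *(3,4) k_nz by simp
  moreover have "form_eval (d + e) c (u, v, w) / l ^ (d + e) = \<alpha>" "form_eval (d + e) c' (u, v, w) / l ^ (d + e) = \<beta>"
    unfolding c(2,4)[symmetric] using l_nz by simp_all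
  ultimately show "\<exists>d c c'. represents y d c c' f \<and> S (form_eval d c (u, v, w) / l ^ d) (form_eval d c' (u, v, w) / l ^ d)"
    using *(5) by metis
qed

definition specializes :: "omega \<Rightarrow> qbar \<Rightarrow> bool" where
  "specializes f \<gamma> \<longleftrightarrow> (\<exists>F \<alpha> G \<beta>. aff F \<alpha> \<and> aff G \<beta> \<and> \<beta> \<noteq> 0 \<and> f = F / G \<and> \<gamma> = \<alpha> / \<beta>)"

lemma specializes_unique:
  assumes "specializes f \<gamma>" "specializes f \<delta>"
  shows "\<gamma> = \<delta>"
proof -
  obtain F \<alpha> G \<beta> where 1: "aff F \<alpha>" "aff G \<beta>" "\<beta> \<noteq> 0" "f = F / G" "\<gamma> = \<alpha> / \<beta>"
    using assms(1) unfolding specializes_def by blast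
  obtain F' \<alpha>' G' \<beta>' where 2: "aff F' \<alpha>'" "aff G' \<beta>'" "\<beta>' \<noteq> 0" "f = F' / G'" "\<delta> = \<alpha>' / \<beta>'"
    using assms(2) unfolding specializes_def by blast
  have "F * G' = F' * G"
    using 1(4) 2(4) aff_nonzero[OF 1(2,3)] aff_nonzero[OF 2(2,3)] by (simp add: frac_eq_eq)
  hence "\<alpha> * \<beta>' = \<alpha>' * \<beta>"
    using aff_mult[OF 1(1) 2(2)] aff_mult[OF 2(1) 1(2)] aff_unique by metis
  thus ?thesis using 1(3,5) 2(3,5) by (simp add: frac_eq_eq)
qed

lemma function_field_eq: "function_field y = {F / G | F \<alpha> G \<beta>. aff F \<alpha> \<and> aff G \<beta> \<and> G \<noteq> 0}"
  unfolding function_field_def using represents_iff[of _ "\<lambda>_ _. True"] by auto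

lemma local_ring_eq: "local_ring y (u, v, w) = {f. \<exists>\<gamma>. specializes f \<gamma>}"
proof -
  have "f \<in> local_ring y (u, v, w) \<longleftrightarrow> (\<exists>F \<alpha> G \<beta>. aff F \<alpha> \<and> aff G \<beta> \<and> G \<noteq> 0 \<and> f = F / G \<and> \<beta> \<noteq> 0)" for f
    unfolding local_ring_def mem_Collect_eq represents_iff[of f "\<lambda>_ \<beta>. \<beta> \<noteq> 0", symmetric]
    using l_nz by simp
  thus ?thesis unfolding specializes_def using aff_nonzero by blast
qed

lemma value_at_eq:
  assumes "specializes f \<gamma>"
  shows "value_at y (u, v, w) f = \<gamma>"
proof -
  have "(\<exists>d c c'. represents y d c c' f \<and> form_eval d c' (u, v, w) \<noteq> 0 \<and>
      \<delta> = form_eval d c (u, v, w) / form_eval d c' (u, v, w)) \<longleftrightarrow> specializes f \<delta>" for \<delta>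
  proof -
    have "(\<exists>d c c'. represents y d c c' f \<and> form_eval d c' (u, v, w) \<noteq> 0 \<and>
      \<delta> = form_eval d c (u, v, w) / form_eval d c' (u, v, w)) \<longleftrightarrow>
      (\<exists>F \<alpha> G \<beta>. aff F \<alpha> \<and> aff G \<beta> \<and> G \<noteq> 0 \<and> f = F / G \<and> (\<beta> \<noteq> 0 \<and> \<delta> = \<alpha> / \<beta>))"
      unfolding represents_iff[of f "\<lambda>\<alpha> \<beta>. \<beta> \<noteq> 0 \<and> \<delta> = \<alpha> / \<beta>", symmetric]
      using l_nz by simp
    thus ?thesis unfolding specializes_def using aff_nonzero by blast
  qed
  thus ?thesis unfolding value_at_def using assms specializes_unique by (intro the_equality) auto
qed

end

section \<open>The local rings of the cubic are discrete valuation rings\<close>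

context point_chart
begin

lemma function_fieldI: "aff F \<alpha> \<Longrightarrow> aff G \<beta> \<Longrightarrow> G \<noteq> 0 \<Longrightarrow> F / G \<in> function_field y"
  unfolding function_field_eq by blast

lemma function_fieldE:
  assumes "f \<in> function_field y"
  obtains F \<alpha> G \<beta> where "aff F \<alpha>" "aff G \<beta>" "G \<noteq> 0" "f = F / G"
  using assms unfolding function_field_eq by blast

lemma aff_in_function_field: "aff F \<alpha> \<Longrightarrow> F \<in> function_field y"
  using function_fieldI[OF _ aff_const[of 1], of F \<alpha>] by simp

lemma subfield_function_field: "subfield_set (function_field y)"
proof
  show "1 \<in> function_field y" using aff_in_function_field[OF aff_const[of 1]] by simp
next
  fix f g assume "f \<in> function_field y" "g \<in> function_field y"
  then obtain F \<alpha> G \<beta> F' \<alpha>' G' \<beta>' where *: "aff F \<alpha>" "aff G \<beta>" "G \<noteq> 0" "f = F / G"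
    "aff F' \<alpha>'" "aff G' \<beta>'" "G' \<noteq> 0" "g = F' / G'"
    using function_fieldE by metis
  have "(F * G' + F' * G) / (G * G') \<in> function_field y"
    by (rule function_fieldI[OF aff_add[OF aff_mult[OF *(1,6)] aff_mult[OF *(5,2)]] aff_mult[OF *(2,6)]])
      (use * in simp)
  thus "f + g \<in> function_field y" using * by (simp add: add_frac_eq)
  have "(F * F') / (G * G') \<in> function_field y"
    by (rule function_fieldI[OF aff_mult[OF *(1,5)] aff_mult[OF *(2,6)]]) (use * in simp)
  thus "f * g \<in> function_field y" using * by simp
next
  fix f assume "f \<in> function_field y"
  then obtain F \<alpha> G \<beta> where *: "aff F \<alpha>" "aff G \<beta>" "G \<noteq> 0" "f = F / G"
    using function_fieldE by metis
  have "(- F) / G \<in> function_field y"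
    by (rule function_fieldI[OF aff_uminus[OF *(1)] *(2,3)])
  thus "- f \<in> function_field y" using * by simp
  show "inverse f \<in> function_field y"
  proof (cases "F = 0")
    case True
    thus ?thesis using * aff_in_function_field[OF aff_const[of 0]] by simp
  next
    case False
    have "G / F \<in> function_field y" by (rule function_fieldI[OF *(2,1) False])
    thus ?thesis using * by simp
  qed
qed

lemma specializesI: "aff F \<alpha> \<Longrightarrow> aff G \<beta> \<Longrightarrow> \<beta> \<noteq> 0 \<Longrightarrow> specializes (F / G) (\<alpha> / \<beta>)"
  unfolding specializes_def by blast

lemma specializesE:
  assumes "specializes f \<gamma>"
  obtains F \<alpha> G \<beta> where "aff F \<alpha>" "aff G \<beta>" "\<beta> \<noteq> 0" "G \<noteq> 0" "f = F / G" "\<gamma> = \<alpha> / \<beta>"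
  using assms aff_nonzero unfolding specializes_def by blast

lemma specializes_aff: "aff F \<alpha> \<Longrightarrow> specializes F \<alpha>"
  using specializesI[OF _ aff_const[of 1], of F \<alpha>] by simp

lemma specializes_diff:
  assumes "specializes f \<gamma>" "specializes g \<delta>"
  shows "specializes (f - g) (\<gamma> - \<delta>)"
proof -
  obtain F \<alpha> G \<beta> where 1: "aff F \<alpha>" "aff G \<beta>" "\<beta> \<noteq> 0" "G \<noteq> 0" "f = F / G" "\<gamma> = \<alpha> / \<beta>"
    using assms(1) by (rule specializesE)
  obtain F' \<alpha>' G' \<beta>' where 2: "aff F' \<alpha>'" "aff G' \<beta>'" "\<beta>' \<noteq> 0" "G' \<noteq> 0" "g = F' / G'" "\<delta> = \<alpha>' / \<beta>'"
    using assms(2) by (rule specializesE)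
  have "specializes ((F * G' - F' * G) / (G * G')) ((\<alpha> * \<beta>' - \<alpha>' * \<beta>) / (\<beta> * \<beta>'))"
    by (rule specializesI[OF aff_diff[OF aff_mult[OF 1(1) 2(2)] aff_mult[OF 2(1) 1(2)]] aff_mult[OF 1(2) 2(2)]])
      (use 1 2 in simp)
  thus ?thesis using 1 2 by (simp add: diff_frac_eq)
qed

lemma specializes_mult:
  assumes "specializes f \<gamma>" "specializes g \<delta>"
  shows "specializes (f * g) (\<gamma> * \<delta>)"
proof -
  obtain F \<alpha> G \<beta> where 1: "aff F \<alpha>" "aff G \<beta>" "\<beta> \<noteq> 0" "G \<noteq> 0" "f = F / G" "\<gamma> = \<alpha> / \<beta>"
    using assms(1) by (rule specializesE)
  obtain F' \<alpha>' G' \<beta>' where 2: "aff F' \<alpha>'" "aff G' \<beta>'" "\<beta>' \<noteq> 0" "G' \<noteq> 0" "g = F' / G'" "\<delta> = \<alpha>' / \<beta>'"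
    using assms(2) by (rule specializesE)
  have "specializes ((F * F') / (G * G')) ((\<alpha> * \<alpha>') / (\<beta> * \<beta>'))"
    by (rule specializesI[OF aff_mult[OF 1(1) 2(1)] aff_mult[OF 1(2) 2(2)]]) (use 1 2 in simp)
  thus ?thesis using 1 2 by simp
qed

lemma specializes_inverse:
  assumes "specializes f \<gamma>" "\<gamma> \<noteq> 0"
  shows "specializes (inverse f) (inverse \<gamma>)"
proof -
  obtain F \<alpha> G \<beta> where 1: "aff F \<alpha>" "aff G \<beta>" "\<beta> \<noteq> 0" "G \<noteq> 0" "f = F / G" "\<gamma> = \<alpha> / \<beta>"
    using assms(1) by (rule specializesE)
  have "specializes (G / F) (\<beta> / \<alpha>)"
    by (rule specializesI[OF 1(2,1)]) (use 1 assms in simp)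
  thus ?thesis using 1 by simp
qed

lemma local_ring_iff: "f \<in> local_ring y (u, v, w) \<longleftrightarrow> specializes f (value_at y (u, v, w) f)"
  using value_at_eq[of f] unfolding local_ring_eq by auto

text \<open>\<open>aff_factor\<close> is applied to numerator and denominator; the powers of
  \<open>transversal\<close> that it introduces do not vanish at the point and go into the unit
  \<open>g\<close>.\<close>

lemma factorization:
  assumes "f \<in> function_field y" "f \<noteq> 0"
  shows "\<exists>n g. g \<in> local_ring y (u, v, w) \<and> value_at y (u, v, w) g \<noteq> 0 \<and> f = g * (\<xi> - const a) powi n"
proof -
  obtain F \<alpha> G \<beta> where *: "aff F \<alpha>" "aff G \<beta>" "G \<noteq> 0" "f = F / G"
    using assms function_fieldE by metis
  with assms have "F \<noteq> 0" by auto
  let ?T = "transversal" and ?p = "\<xi> - const a"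
  define \<delta> where "\<delta> = 3 * (b ^ 2 - t * a)"
  have "\<delta> \<noteq> 0" using smooth by (simp add: \<delta>_def)
  hence \<delta>: "\<delta> ^ j \<noteq> 0" for j by simp
  have T: "aff (?T ^ j) (\<delta> ^ j)" for j
    unfolding \<delta>_def by (rule aff_power[OF aff_transversal])
  with \<delta> have T_nz: "?T ^ j \<noteq> 0" for j using aff_nonzero by blast
  have p_nz: "?p \<noteq> 0" using \<xi>_generic by auto
  obtain n i F' \<alpha>' where F: "aff F' \<alpha>'" "\<alpha>' \<noteq> 0" "F * ?T ^ i = ?p ^ n * F'"
    using aff_factor[OF *(1) \<open>F \<noteq> 0\<close>] by metis
  obtain m j G' \<beta>' where G: "aff G' \<beta>'" "\<beta>' \<noteq> 0" "G * ?T ^ j = ?p ^ m * G'"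
    using aff_factor[OF *(2,3)] by metis
  have nz: "F' \<noteq> 0" "G' \<noteq> 0" using F G aff_nonzero by auto
  let ?g = "(F' * ?T ^ j) / (G' * ?T ^ i)"
  let ?v = "(\<alpha>' * \<delta> ^ j) / (\<beta>' * \<delta> ^ i)"
  have g: "specializes ?g ?v"
    by (rule specializesI[OF aff_mult[OF F(1) T] aff_mult[OF G(1) T]]) (use G \<delta> in simp)
  have "?v \<noteq> 0" using F(2) G(2) \<delta> by simp
  moreover have "f = ?g * ?p powi (int n - int m)"
  proof -
    have 1: "F = ?p ^ n * F' / ?T ^ i" "G = ?p ^ m * G' / ?T ^ j"
      using F(3) G(3) T_nz by (simp_all add: eq_divide_eq)
    show ?thesis
      unfolding *(4) 1 using p_nz nz T_nz by (simp add: power_int_diff mult_ac)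
  qed
  ultimately show ?thesis
    using g value_at_eq[OF g] local_ring_iff[of ?g] by (intro exI[of _ "int n - int m"] exI[of _ ?g]) simp
qed

lemma discrete_valuation:
  "discrete_valuation (function_field y) (local_ring y (u, v, w)) (value_at y (u, v, w)) (\<xi> - const a)"
proof (intro discrete_valuation.intro subfield_function_field discrete_valuation_axioms.intro)
  show "local_ring y (u, v, w) \<subseteq> function_field y"
    using aff_nonzero unfolding local_ring_eq specializes_def function_field_eq by blast
  have one: "specializes 1 1" using specializes_aff[OF aff_const[of 1]] by simp
  show "1 \<in> local_ring y (u, v, w)" "value_at y (u, v, w) 1 = 1"
    using one value_at_eq[OF one] by (auto simp: local_ring_eq)
  have "aff (\<xi> - const a) (a - a)" by (intro aff_diff aff_\<xi> aff_const)
  hence p: "specializes (\<xi> - const a) 0" using specializes_aff by simp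
  show "\<xi> - const a \<in> local_ring y (u, v, w)" "value_at y (u, v, w) (\<xi> - const a) = 0"
    using p value_at_eq[OF p] by (auto simp: local_ring_eq)
  show "\<xi> - const a \<noteq> 0" using \<xi>_generic by auto
next
  fix f g assume fg: "f \<in> local_ring y (u, v, w)" "g \<in> local_ring y (u, v, w)"
  hence "specializes (f - g) (value_at y (u, v, w) f - value_at y (u, v, w) g)"
    "specializes (f * g) (value_at y (u, v, w) f * value_at y (u, v, w) g)"
    unfolding local_ring_iff using specializes_diff specializes_mult by blast+
  from this value_at_eq[OF this(1)] value_at_eq[OF this(2)]
  show "f - g \<in> local_ring y (u, v, w)" "f * g \<in> local_ring y (u, v, w)"
    "value_at y (u, v, w) (f - g) = value_at y (u, v, w) f - value_at y (u, v, w) g"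
    "value_at y (u, v, w) (f * g) = value_at y (u, v, w) f * value_at y (u, v, w) g"
    unfolding local_ring_iff by simp_all
next
  fix f assume "f \<in> local_ring y (u, v, w)" "value_at y (u, v, w) f \<noteq> 0"
  hence "specializes (inverse f) (inverse (value_at y (u, v, w) f))"
    unfolding local_ring_iff by (intro specializes_inverse)
  thus "inverse f \<in> local_ring y (u, v, w)" unfolding local_ring_eq by blast
qed (rule factorization)

lemma form_ratio:
  assumes "form d F \<alpha>" "form d G \<beta>" "\<beta> \<noteq> 0"
  shows "F / G \<in> local_ring y (u, v, w)" "value_at y (u, v, w) (F / G) = \<alpha> / \<beta>"
proof -
  have "specializes ((F / k ^ d) / (G / k ^ d)) ((\<alpha> / l ^ d) / (\<beta> / l ^ d))"
    using assms l_nz by (intro specializesI aff_form) auto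
  hence "specializes (F / G) (\<alpha> / \<beta>)" using k_nz l_nz by simp
  thus "F / G \<in> local_ring y (u, v, w)" "value_at y (u, v, w) (F / G) = \<alpha> / \<beta>"
    using value_at_eq by (auto simp: local_ring_eq)
qed

lemma form_in_function_field:
  assumes "form d F \<alpha>" "form d G \<beta>"
  shows "F / G \<in> function_field y"
proof (cases "G = 0")
  case True
  thus ?thesis using aff_in_function_field[OF aff_const[of 0]] by simp
next
  case False
  have "(F / k ^ d) / (G / k ^ d) \<in> function_field y"
    using False k_nz by (intro function_fieldI[OF aff_form[OF assms(1)] aff_form[OF assms(2)]]) simp
  thus ?thesis using k_nz by simp
qed

end

text \<open>The equation is symmetric in the homogeneous coordinates, so a chart at any point arises by
  swapping \<open>\<xi>\<close> with \<open>\<eta>\<close> and replacing \<open>(\<xi>, \<eta>)\<close> by \<open>(1/\<xi>, \<eta>/\<xi>)\<close>.\<close>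

lemma generic_swap:
  assumes "\<xi> \<notin> range const" "\<xi> ^ 3 + \<eta> ^ 3 + 1 = 3 * const t * \<xi> * \<eta>"
  shows "\<eta> \<notin> range const"
proof
  assume "\<eta> \<in> range const"
  then obtain c where c: "\<eta> = const c" by blast
  have "peval \<xi> [:c ^ 3 + 1, - (3 * t * c), 0, 1:] = \<xi> ^ 3 + \<eta> ^ 3 + 1 - 3 * const t * \<xi> * \<eta>"
    unfolding c by (simp add: const_add const_mult const_power const_uminus const_numeral power3_eq_cube algebra_simps)
  also have "\<dots> = 0" using assms(2) by simp
  finally show False using const_algebraically_closed assms(1) by (metis pCons_eq_0_iff zero_neq_one)
qed

lemma generic_inverse:
  assumes "\<xi> \<notin> range const" "\<xi> ^ 3 + \<eta> ^ 3 + 1 = 3 * const t * \<xi> * \<eta>"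
  shows "1 / \<xi> \<notin> range const" "(1 / \<xi>) ^ 3 + (\<eta> / \<xi>) ^ 3 + 1 = 3 * const t * (1 / \<xi>) * (\<eta> / \<xi>)"
proof -
  show "1 / \<xi> \<notin> range const"
  proof
    assume "1 / \<xi> \<in> range const"
    then obtain c where "1 / \<xi> = const c" by blast
    hence "\<xi> = const (inverse c)" by (metis const_inverse inverse_eq_divide inverse_inverse_eq)
    with assms(1) show False by blast
  qed
  have "\<xi> \<noteq> 0" using assms(1) by (metis const_0 rangeI)
  have "1 + \<eta> ^ 3 + \<xi> ^ 3 = 3 * const t * \<eta> * \<xi>" using assms(2) by (simp add: add_ac mult_ac)
  hence "(1 + \<eta> ^ 3 + \<xi> ^ 3) / \<xi> ^ 3 = 3 * const t * \<eta> * \<xi> / \<xi> ^ 3" by simp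
  thus "(1 / \<xi>) ^ 3 + (\<eta> / \<xi>) ^ 3 + 1 = 3 * const t * (1 / \<xi>) * (\<eta> / \<xi>)"
    using \<open>\<xi> \<noteq> 0\<close> by (simp add: add_divide_distrib power_divide power3_eq_cube)
qed

lemma point_scale:
  fixes u v w :: qbar
  assumes "u ^ 3 + v ^ 3 + w ^ 3 = 3 * t * u * v * w" "w \<noteq> 0"
  shows "(u / w) ^ 3 + (v / w) ^ 3 + 1 = 3 * t * (u / w) * (v / w)"
proof -
  have "(u ^ 3 + v ^ 3 + w ^ 3) / w ^ 3 = 3 * t * u * v * w / w ^ 3" using assms by simp
  thus ?thesis using assms(2) by (simp add: add_divide_distrib power_divide power3_eq_cube)
qed

lemma smooth_scale:
  fixes u v w :: qbar
  assumes "v ^ 2 \<noteq> t * u * w" "w \<noteq> 0"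
  shows "(v / w) ^ 2 \<noteq> t * (u / w)"
  using assms by (simp add: power2_eq_square divide_simps mult_ac)

locale hesse_cubic =
  fixes t :: qbar and y :: omega
  assumes t: "t ^ 3 \<noteq> 1"
    and cubic: "var_x ^ 3 + y ^ 3 + 1 = 3 * const t * var_x * y"
begin

section \<open>Charts at every point of the cubic\<close>

lemma y_not_const: "y \<notin> range const"
  using generic_swap[OF var_x_not_const cubic] .

lemma xy_nonzero: "var_x \<noteq> 0" "y \<noteq> 0"
  using var_x_not_const y_not_const by (metis const_0 rangeI)+

lemma cubic': "y ^ 3 + var_x ^ 3 + 1 = 3 * const t * y * var_x"
  using cubic by (simp add: add_ac mult_ac)

text \<open>Solving for \<open>y\<close> would give a polynomial solution, excluded by
  \<open>cubic_no_polynomial_root\<close>.\<close>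

lemma linear_nonzero_y:
  assumes "m \<noteq> 0"
  shows "const k + const l * var_x + const m * y \<noteq> 0"
proof
  assume eq: "const k + const l * var_x + const m * y = 0"
  define p where "p = [:k / m, l / m:]"
  have "const m * (peval var_x p + y) = 0"
    using eq assms by (simp add: p_def const_divide algebra_simps)
  hence y: "y = - peval var_x p" using assms by (simp add: eq_neg_iff_add_eq_0 add.commute)
  have "peval var_x (p ^ 3 - ([:0, 3 * t:] * p + [:1, 0, 0, 1:])) =
      - (var_x ^ 3 + y ^ 3 + 1 - 3 * const t * var_x * y)"
    unfolding peval_diff peval_add peval_mult peval_power y
    by (simp add: const_mult const_numeral power3_eq_cube algebra_simps)
  also have "\<dots> = 0" using cubic by simp
  finally have "p ^ 3 - ([:0, 3 * t:] * p + [:1, 0, 0, 1:]) = 0"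
    using const_algebraically_closed var_x_not_const by blast
  thus False using cubic_no_polynomial_root[OF t] by simp
qed

lemma linear_nonzero_x:
  assumes "l \<noteq> 0"
  shows "const k + const l * var_x + const m * y \<noteq> 0"
proof (cases "m = 0")
  case True
  have "peval var_x [:k, l:] \<noteq> 0"
    using const_algebraically_closed[of var_x "[:k, l:]"] var_x_not_const assms by auto
  thus ?thesis using True by (simp add: mult.commute)
qed (rule linear_nonzero_y)

text \<open>Some partial derivative is nonzero. As at most one coordinate of the point vanishes, one
  of the two other coordinates can be divided by, which gives six cases.\<close>

lemma point_chart_exists:
  assumes P: "(u, v, w) \<in> hesse_points t"
  obtains \<xi> \<eta> a b k l where "point_chart t \<xi> \<eta> a b y u v w k l"
proof -
  have nz: "(u, v, w) \<noteq> (0, 0, 0)" and eq: "u ^ 3 + v ^ 3 + w ^ 3 = 3 * t * u * v * w"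
    using P by (auto simp: hesse_points_def)
  have smooth: "v ^ 2 \<noteq> t * u * w \<or> u ^ 2 \<noteq> t * v * w \<or> w ^ 2 \<noteq> t * u * v"
  proof (rule ccontr)
    assume "\<not> ?thesis"
    \<comment> \<open>If all partial derivatives vanish, the cubes of the coordinates all equal
      \<open>t * u * v * w\<close>; their product gives \<open>t ^ 3 = 1\<close> unless all
      coordinates are \<open>0\<close>.\<close>
    hence 1: "v ^ 2 = t * u * w" "u ^ 2 = t * v * w" "w ^ 2 = t * u * v" by auto
    have 2: "v ^ 3 = t * u * v * w" "u ^ 3 = t * u * v * w" "w ^ 3 = t * u * v * w"
      using 1 by (simp_all add: power3_eq_cube power2_eq_square mult_ac)
    show False
    proof (cases "t * u * v * w = 0")
      case True
      with 2 nz show False by simp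
    next
      case False
      have "(t * u * v * w) ^ 3 = t ^ 3 * (u ^ 3 * v ^ 3 * w ^ 3)"
        by (simp add: power_mult_distrib mult_ac)
      also have "\<dots> = t ^ 3 * (t * u * v * w) ^ 3" unfolding 2 by (simp add: power3_eq_cube mult_ac)
      finally show False using False t by simp
    qed
  qed
  have one_nz: "u = 0 \<Longrightarrow> v = 0 \<Longrightarrow> False" "u = 0 \<Longrightarrow> w = 0 \<Longrightarrow> False" "v = 0 \<Longrightarrow> w = 0 \<Longrightarrow> False"
    using eq nz by auto
  have eqs: "v ^ 3 + u ^ 3 + w ^ 3 = 3 * t * v * u * w" "w ^ 3 + v ^ 3 + u ^ 3 = 3 * t * w * v * u"
    "w ^ 3 + u ^ 3 + v ^ 3 = 3 * t * w * u * v" "v ^ 3 + w ^ 3 + u ^ 3 = 3 * t * v * w * u"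
    "u ^ 3 + w ^ 3 + v ^ 3 = 3 * t * u * w * v"
    using eq by (simp_all add: add_ac mult_ac)
  note gx = var_x_not_const cubic and gy = y_not_const cubic'
  note ix = generic_inverse[OF gx] and iy = generic_inverse[OF gy]
  have ix': "(y / var_x) \<notin> range const" "(y / var_x) ^ 3 + (1 / var_x) ^ 3 + 1 = 3 * const t * (y / var_x) * (1 / var_x)"
    using generic_swap[OF ix] ix(2) by (simp_all add: add_ac mult_ac)
  have iy': "(var_x / y) \<notin> range const" "(var_x / y) ^ 3 + (1 / y) ^ 3 + 1 = 3 * const t * (var_x / y) * (1 / y)"
    using generic_swap[OF iy] iy(2) by (simp_all add: add_ac mult_ac)
  note defs = point_chart_def point_chart_axioms_def chart_def
  consider "v ^ 2 \<noteq> t * u * w" "w \<noteq> 0" | "v ^ 2 \<noteq> t * u * w" "u \<noteq> 0"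
    | "u ^ 2 \<noteq> t * v * w" "w \<noteq> 0" | "u ^ 2 \<noteq> t * v * w" "v \<noteq> 0"
    | "w ^ 2 \<noteq> t * u * v" "u \<noteq> 0" | "w ^ 2 \<noteq> t * u * v" "v \<noteq> 0"
    using smooth one_nz by blast
  thus ?thesis
  proof cases
    case 1
    have "point_chart t var_x y (u / w) (v / w) y u v w 1 w"
      unfolding defs using 1 t gx point_scale[OF eq 1(2)] smooth_scale[OF 1] by simp
    thus ?thesis by (rule that)
  next
    case 2
    have "v ^ 2 \<noteq> t * w * u" using 2 by (simp add: mult_ac)
    hence "point_chart t (1 / var_x) (y / var_x) (w / u) (v / u) y u v w var_x u"
      unfolding defs using 2 t ix point_scale[OF eqs(2) 2(2)] smooth_scale[of v t w u] xy_nonzero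
      by (auto simp del: times_divide_eq_left times_divide_eq_right)
    thus ?thesis by (rule that)
  next
    case 3
    have "point_chart t y var_x (v / w) (u / w) y u v w 1 w"
      unfolding defs using 3 t gy point_scale[OF eqs(1) 3(2)] smooth_scale[OF 3] by auto
    thus ?thesis by (rule that)
  next
    case 4
    have "u ^ 2 \<noteq> t * w * v" using 4 by (simp add: mult_ac)
    hence "point_chart t (1 / y) (var_x / y) (w / v) (u / v) y u v w y v"
      unfolding defs using 4 t iy point_scale[OF eqs(3) 4(2)] smooth_scale[of u t w v] xy_nonzero
      by (auto simp del: times_divide_eq_left times_divide_eq_right)
    thus ?thesis by (rule that)
  next
    case 5
    have "w ^ 2 \<noteq> t * v * u" using 5 by (simp add: mult_ac)
    hence "point_chart t (y / var_x) (1 / var_x) (v / u) (w / u) y u v w var_x u"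
      unfolding defs using 5 t ix' point_scale[OF eqs(4) 5(2)] smooth_scale[of w t v u] xy_nonzero
      by (auto simp del: times_divide_eq_left times_divide_eq_right)
    thus ?thesis by (rule that)
  next
    case 6
    have "point_chart t (var_x / y) (1 / y) (u / v) (w / v) y u v w y v"
      unfolding defs using 6 t iy' point_scale[OF eqs(5) 6(2)] smooth_scale[of w t u v] xy_nonzero
      by (auto simp del: times_divide_eq_left times_divide_eq_right)
    thus ?thesis by (rule that)
  qed
qed

end

section \<open>Tame symbols of the Hesse symbols\<close>

lemma power_int_sixth: "(x :: 'k::field) ^ 6 = 1 \<Longrightarrow> (x powi n) ^ 6 = 1"
proof -
  assume "x ^ 6 = 1"
  have "(x powi n) ^ 6 = x powi (n * 6)" by (simp add: power_int_mult)
  also have "\<dots> = (x ^ 6) powi n" by (subst mult.commute) (simp add: power_int_mult)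
  finally show ?thesis using \<open>x ^ 6 = 1\<close> by simp
qed

context discrete_valuation
begin

text \<open>The exponent \<open>6\<close> covers cube roots of unity and signs, the latter from
  symbols \<open>{f, f}\<close> and from ratios with cube \<open>- 1\<close>.\<close>

lemma tame_symbol_torsion_left:
  "u \<in> units \<Longrightarrow> val u ^ 6 = 1 \<Longrightarrow> g \<in> K - {0} \<Longrightarrow> tame_symbol (u, g) ^ 6 = 1"
  by (simp add: tame_symbol_unit_left power_int_sixth)

lemma tame_symbol_torsion_right:
  "u \<in> units \<Longrightarrow> val u ^ 6 = 1 \<Longrightarrow> f \<in> K - {0} \<Longrightarrow> tame_symbol (f, u) ^ 6 = 1"
  by (simp add: tame_symbol_unit_right power_int_sixth del: power_int_minus)

lemma tame_symbol_units: "u \<in> units \<Longrightarrow> u' \<in> units \<Longrightarrow> tame_symbol (u, u') = 1"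
  using unitsD[of u'] by (simp add: tame_symbol_unit_left ord_unit)

lemma tame_symbol_self_sixth: "f \<in> K - {0} \<Longrightarrow> tame_symbol (f, f) ^ 6 = 1"
  using tame_symbol_self[of f] power_mult[of "tame_symbol (f, f)" 2 3] by simp

text \<open>Splits \<open>{f, g}\<close> as \<open>{f / g, g} + {g, g}\<close>, for points where
  both entries have the same order.\<close>

lemma tame_symbol_torsion_quotient:
  assumes f: "f \<in> K - {0}" and g: "g \<in> K - {0}" and q: "f / g \<in> units" "val (f / g) ^ 6 = 1"
  shows "tame_symbol (f, g) ^ 6 = 1"
proof -
  have "tame_symbol (f / g * g, g) = tame_symbol (f / g, g) * tame_symbol (g, g)"
    using f g K_divide by (intro tame_symbol_mult_left) auto
  thus ?thesis
    using g tame_symbol_torsion_left[OF q g] tame_symbol_self_sixth[OF g] by (simp add: power_mult_distrib)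
qed

text \<open>Splits \<open>{f, f * g}\<close> as \<open>{f, f} + {f, g}\<close>, for points where the
  entries have opposite orders.\<close>

lemma tame_symbol_torsion_product:
  assumes f: "f \<in> K - {0}" and g: "g \<in> K - {0}" and q: "f * g \<in> units" "val (f * g) ^ 6 = 1"
  shows "tame_symbol (f, g) ^ 6 = 1"
proof -
  have "tame_symbol (f, f * g) = tame_symbol (f, f) * tame_symbol (f, g)"
    by (rule tame_symbol_mult_right[OF f f g])
  hence "tame_symbol (f, f * g) ^ 6 = tame_symbol (f, f) ^ 6 * tame_symbol (f, g) ^ 6"
    by (simp add: power_mult_distrib)
  thus ?thesis
    using tame_symbol_torsion_right[OF q f] tame_symbol_self_sixth[OF f] by simp
qed

end

context point_chart
begin

sublocale V: discrete_valuation "function_field y" "local_ring y (u, v, w)" "value_at y (u, v, w)" "\<xi> - const a"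
  by (rule discrete_valuation)

lemma tame_eq: "tame y (u, v, w) = V.tame_symbol"
proof -
  have "order_at y (u, v, w) f = V.ord f" for f
    unfolding order_at_def V.ord_def max_ideal_def V.maximal_def ..
  thus ?thesis unfolding tame_def V.tame_symbol_def by simp
qed

lemma form_unit:
  assumes "form d F \<alpha>" "form d G \<beta>" "\<alpha> \<noteq> 0" "\<beta> \<noteq> 0"
  shows "F / G \<in> V.units" "value_at y (u, v, w) (F / G) = \<alpha> / \<beta>"
  using form_ratio[OF assms(1,2,4)] assms(3,4) by (auto intro!: V.unitsI)

end

lemma sum_of_cubes: "(p :: 'k::comm_ring_1) ^ 3 + q ^ 3 + r ^ 3 - 3 * p * q * r =
    (p + q + r) * (p ^ 2 + q ^ 2 + r ^ 2 - p * q - q * r - r * p)"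
  by (simp add: power3_eq_cube power2_eq_square algebra_simps)

context hesse_cubic
begin

text \<open>If no coordinate of the point is \<open>0\<close>, both entries are units. Otherwise the
  cubes of the two other coordinates are opposite, so the appropriate one of \<open>y\<close>,
  \<open>x\<close>, \<open>x / y\<close> is a unit whose value has sixth power
  \<open>1\<close>.\<close>

lemma tame_xy:
  assumes P: "(u, v, w) \<in> hesse_points t"
  shows "tame y (u, v, w) (var_x, y) ^ 6 = 1"
proof -
  obtain \<xi> \<eta> a b k l where "point_chart t \<xi> \<eta> a b y u v w k l"
    using point_chart_exists[OF P] .
  then interpret point_chart t \<xi> \<eta> a b y u v w k l .
  have eq: "u ^ 3 + v ^ 3 + w ^ 3 = 3 * t * u * v * w" and nz: "(u, v, w) \<noteq> (0, 0, 0)"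
    using P by (auto simp: hesse_points_def)
  have one_nz: "u = 0 \<Longrightarrow> v = 0 \<Longrightarrow> False" "u = 0 \<Longrightarrow> w = 0 \<Longrightarrow> False" "v = 0 \<Longrightarrow> w = 0 \<Longrightarrow> False"
    using eq nz by auto
  have X: "form 1 var_x u" and Y: "form 1 y v" and Z: "form 1 1 w"
    using form_linear[of 0 1 0] form_linear[of 0 0 1] form_linear[of 1 0 0] by simp_all
  have xK: "var_x \<in> function_field y - {0}" and yK: "y \<in> function_field y - {0}"
    using form_in_function_field[OF X Z] form_in_function_field[OF Y Z] xy_nonzero by simp_all
  have sixth: "(c / d) ^ 6 = 1" if "c ^ 3 + d ^ 3 = 0" "d \<noteq> 0" for c d :: qbar
  proof -
    have "c ^ 3 = - (d ^ 3)" using that by (simp add: eq_neg_iff_add_eq_0)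
    hence "(c / d) ^ 3 = - 1" using that by (simp add: power_divide)
    thus ?thesis using power_mult[of "c / d" 3 2] by simp
  qed
  consider "u = 0" "v \<noteq> 0" "w \<noteq> 0" | "v = 0" "u \<noteq> 0" "w \<noteq> 0" | "w = 0" "u \<noteq> 0" "v \<noteq> 0"
    | "u \<noteq> 0" "v \<noteq> 0" "w \<noteq> 0"
    using one_nz by blast
  thus ?thesis
  proof cases
    case 1
    thus ?thesis
      using form_unit[OF Y Z] sixth[of v w] eq xK
      unfolding tame_eq by (intro V.tame_symbol_torsion_right) auto
  next
    case 2
    thus ?thesis
      using form_unit[OF X Z] sixth[of u w] eq yK
      unfolding tame_eq by (intro V.tame_symbol_torsion_left) auto
  next
    case 3
    thus ?thesis
      using form_unit[OF X Y] sixth[of u v] eq xK yK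
      unfolding tame_eq by (intro V.tame_symbol_torsion_quotient) auto
  next
    case 4
    thus ?thesis
      using form_unit[OF X Z] form_unit[OF Y Z] V.tame_symbol_units[of var_x y]
      unfolding tame_eq by simp
  qed
qed

text \<open>Each tangent vanishes only at its own flex, where the ratio of the two other tangents is
  a cube root of unity up to sign.\<close>

lemma tame_flex:
  assumes P: "(u, v, w) \<in> hesse_points t" and z: "z ^ 3 = 1"
  defines "A \<equiv> const t + var_x + y" and "B \<equiv> const z + var_x + const z ^ 2 * const t * y"
    and "C \<equiv> const z ^ 2 + const t * var_x + const z * y"
  shows "tame y (u, v, w) (- (A / B), - (C / A)) ^ 6 = 1"
proof -
  obtain \<xi> \<eta> a b k l where "point_chart t \<xi> \<eta> a b y u v w k l"
    using point_chart_exists[OF P] .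
  then interpret point_chart t \<xi> \<eta> a b y u v w k l .
  have eq: "u ^ 3 + v ^ 3 + w ^ 3 = 3 * t * u * v * w" and nz: "(u, v, w) \<noteq> (0, 0, 0)"
    using P by (auto simp: hesse_points_def)
  have one_nz: "u = 0 \<Longrightarrow> v = 0 \<Longrightarrow> False" "u = 0 \<Longrightarrow> w = 0 \<Longrightarrow> False" "v = 0 \<Longrightarrow> w = 0 \<Longrightarrow> False"
    using eq nz by auto
  have z_nz: "z \<noteq> 0" "t \<noteq> z" using z t by auto
  have z3: "z * (z * z) = 1" "z * (z * (z * r)) = r" for r
    using z by (simp_all add: power3_eq_cube flip: mult.assoc)
  define \<alpha> \<beta> \<gamma> where "\<alpha> = t * w + u + v" and "\<beta> = z * w + u + z ^ 2 * t * v"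
    and "\<gamma> = z ^ 2 * w + t * u + z * v"
  have A: "form 1 A \<alpha>" and B: "form 1 B \<beta>" and C: "form 1 C \<gamma>"
    using form_linear[of t 1 1] form_linear[of z 1 "z ^ 2 * t"] form_linear[of "z ^ 2" t z]
    by (simp_all add: A_def B_def C_def \<alpha>_def \<beta>_def \<gamma>_def const_mult const_power)
  have minus: "form 1 (- F) (- \<delta>)" if "form 1 F \<delta>" for F \<delta>
    using form_scale[OF that, of "- 1"] by (simp add: const_uminus)
  \<comment> \<open>If the three terms of \<open>\<alpha>\<close> sum to \<open>0\<close>, their
    cubes sum to three times their product; the equation of the cubic then leaves
    \<open>(t ^ 3 - 1) * w ^ 3 = 0\<close>. The other two tangents are treated alike.\<close>
  have \<alpha>0: "w = 0 \<and> v = - u" if "\<alpha> = 0"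
  proof -
    have "(t * w) ^ 3 + u ^ 3 + v ^ 3 - 3 * (t * w) * u * v = 0"
      unfolding sum_of_cubes using that by (simp add: \<alpha>_def)
    moreover have "(t * w) ^ 3 + u ^ 3 + v ^ 3 - 3 * (t * w) * u * v = (t ^ 3 - 1) * w ^ 3"
      using eq by (simp add: power_mult_distrib algebra_simps)
    ultimately have "w = 0" using t by simp
    with that show ?thesis by (simp add: \<alpha>_def eq_neg_iff_add_eq_0 add.commute)
  qed
  have \<beta>0: "v = 0 \<and> u = - z * w" if "\<beta> = 0"
  proof -
    have "(z * w) ^ 3 + u ^ 3 + (z ^ 2 * t * v) ^ 3 - 3 * (z * w) * u * (z ^ 2 * t * v) = 0"
      unfolding sum_of_cubes using that by (simp add: \<beta>_def)
    moreover have "(z * w) ^ 3 + u ^ 3 + (z ^ 2 * t * v) ^ 3 - 3 * (z * w) * u * (z ^ 2 * t * v) = (t ^ 3 - 1) * v ^ 3"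
      using eq by (simp add: power3_eq_cube power2_eq_square algebra_simps z3)
    ultimately have "v = 0" using t by simp
    with that show ?thesis by (simp add: \<beta>_def eq_neg_iff_add_eq_0 add.commute)
  qed
  have \<gamma>0: "u = 0 \<and> v = - z * w" if "\<gamma> = 0"
  proof -
    have "(z ^ 2 * w) ^ 3 + (t * u) ^ 3 + (z * v) ^ 3 - 3 * (z ^ 2 * w) * (t * u) * (z * v) = 0"
      unfolding sum_of_cubes using that by (simp add: \<gamma>_def)
    moreover have "(z ^ 2 * w) ^ 3 + (t * u) ^ 3 + (z * v) ^ 3 - 3 * (z ^ 2 * w) * (t * u) * (z * v) = (t ^ 3 - 1) * u ^ 3"
      using eq by (simp add: power3_eq_cube power2_eq_square algebra_simps z3)
    ultimately have "u = 0" using t by simp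
    with that have "z * (z * w + v) = 0" by (simp add: \<gamma>_def power2_eq_square algebra_simps)
    hence "v = - z * w" using z_nz by (simp add: eq_neg_iff_add_eq_0 add.commute)
    with \<open>u = 0\<close> show ?thesis by simp
  qed
  have z6: "(- z) ^ 6 = 1" "z ^ 6 = 1"
    using z power_mult[of z 3 2] by simp_all
  have AB: "- A / B \<in> function_field y" and CA: "- C / A \<in> function_field y"
    using form_in_function_field[OF minus[OF A] B] form_in_function_field[OF minus[OF C] A] .
  have generic_nz: "A \<noteq> 0" "B \<noteq> 0" "C \<noteq> 0"
  proof -
    show "A \<noteq> 0" using linear_nonzero_x[of 1 t 1] by (simp add: A_def)
    show "B \<noteq> 0" using linear_nonzero_x[of 1 z "z ^ 2 * t"] by (simp add: B_def const_mult const_power)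
    show "C \<noteq> 0" using linear_nonzero_y[of z "z ^ 2" t] z_nz by (simp add: C_def const_power)
  qed
  hence mem: "- (A / B) \<in> function_field y - {0}" "- (C / A) \<in> function_field y - {0}"
    using AB CA by simp_all
  consider "\<alpha> = 0" | "\<alpha> \<noteq> 0" "\<beta> = 0" | "\<alpha> \<noteq> 0" "\<beta> \<noteq> 0" "\<gamma> = 0" | "\<alpha> \<noteq> 0" "\<beta> \<noteq> 0" "\<gamma> \<noteq> 0"
    by blast
  thus ?thesis
  proof cases
    \<comment> \<open>\<open>A\<close> is the numerator of one entry and the denominator of the
      other, so their product \<open>C / B\<close> is the unit to use.\<close>
    case 1
    hence P0: "w = 0" "v = - u" using \<alpha>0 by auto
    hence "u \<noteq> 0" using one_nz by auto
    have \<beta>: "\<beta> = - (z ^ 2) * (t - z) * u" and \<gamma>: "\<gamma> = (t - z) * u"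
      by (simp_all add: \<beta>_def \<gamma>_def P0 power2_eq_square algebra_simps z3)
    have "\<gamma> \<noteq> 0" "\<beta> \<noteq> 0" using \<open>u \<noteq> 0\<close> z_nz by (simp_all add: \<beta> \<gamma>)
    moreover have "\<gamma> / \<beta> = - z"
      using \<open>u \<noteq> 0\<close> z_nz by (simp add: \<beta> \<gamma> divide_eq_eq power2_eq_square z3 mult_ac)
    moreover have "- (A / B) * - (C / A) = C / B" using generic_nz by simp
    ultimately show ?thesis
      using form_unit[OF C B] z6 mem unfolding tame_eq by (intro V.tame_symbol_torsion_product) auto
  next
    case 2
    hence P0: "v = 0" "u = - z * w" using \<beta>0 by auto
    hence "w \<noteq> 0" using one_nz by auto
    have \<alpha>: "\<alpha> = (t - z) * w" and \<gamma>: "\<gamma> = - z * ((t - z) * w)"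
      by (simp_all add: \<alpha>_def \<gamma>_def P0 power2_eq_square algebra_simps)
    have "- \<gamma> \<noteq> 0" using \<open>w \<noteq> 0\<close> z_nz by (simp add: \<gamma>)
    moreover have "- \<gamma> / \<alpha> = z"
      using 2 \<open>w \<noteq> 0\<close> z_nz by (simp add: \<alpha> \<gamma>)
    ultimately show ?thesis
      using form_unit[OF minus[OF C] A] z6 mem 2 unfolding tame_eq
      by (intro V.tame_symbol_torsion_right) auto
  next
    case 3
    hence P0: "u = 0" "v = - z * w" using \<gamma>0 by auto
    have \<alpha>: "\<alpha> = (t - z) * w" and \<beta>: "\<beta> = - ((t - z) * w)"
      by (simp_all add: \<alpha>_def \<beta>_def P0 power2_eq_square algebra_simps z3)
    have "- \<alpha> / \<beta> = 1" using 3 unfolding \<alpha> \<beta> by simp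
    thus ?thesis
      using form_unit[OF minus[OF A] B] mem 3 unfolding tame_eq
      by (intro V.tame_symbol_torsion_left) auto
  next
    case 4
    thus ?thesis
      using form_unit[OF minus[OF A] B] form_unit[OF minus[OF C] A]
        V.tame_symbol_units[of "- A / B" "- C / A"]
      unfolding tame_eq by simp
  qed
qed

end

section \<open>The Hesse symbol in motivic cohomology\<close>

context hesse_cubic
begin

abbreviation "K \<equiv> function_field y"
abbreviation "M \<equiv> milnor_K2 K"
abbreviation "G \<equiv> tame_kernel t y"

sublocale subfield_set K
proof -
  \<comment> \<open>An arbitrary point, used only to have some chart in which closure of the
    function field can be read off.\<close>
  have "(- 1, 0, 1) \<in> hesse_points t" by (simp add: hesse_points_def)
  then obtain \<xi> \<eta> a b k l where "point_chart t \<xi> \<eta> a b y (- 1) 0 1 k l"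
    using point_chart_exists by metis
  thus "subfield_set K" by (rule point_chart.subfield_function_field)
qed

section \<open>The tame kernel and its rational tensor product\<close>

lemma tame_K2_character:
  assumes P: "P \<in> hesse_points t"
  shows "multiplicative_character M (tame_K2 y P)"
    and "f \<in> K - {0} \<Longrightarrow> g \<in> K - {0} \<Longrightarrow> tame_K2 y P (symbol K f g) = tame y P (f, g)"
proof -
  obtain u v w where P_eq: "P = (u, v, w)" by (cases P)
  then obtain \<xi> \<eta> a b k l where "point_chart t \<xi> \<eta> a b y u v w k l"
    using point_chart_exists P by metis
  then interpret point_chart t \<xi> \<eta> a b y u v w k l .
  have tame_K2_eq: "tame_K2 y P = (\<lambda>\<alpha>. the_elem ((\<lambda>c. the_elem (frag_prod (tame y P) ` c)) ` \<alpha>))"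
    by (simp add: tame_K2_def tame_formal_def frag_prod_def fun_eq_iff)
  show "multiplicative_character M (tame_K2 y P)"
    unfolding tame_K2_eq unfolding P_eq tame_eq
    by (rule K2_character) (simp_all only: V.tame_symbol_nonzero V.tame_symbol_mult_left
        V.tame_symbol_mult_right V.tame_symbol_steinberg not_False_eq_True)
  show "tame_K2 y P (symbol K f g) = tame y P (f, g)" if "f \<in> K - {0}" "g \<in> K - {0}"
    unfolding tame_K2_eq unfolding P_eq tame_eq
    by (rule K2_character(2)) (use that in \<open>simp_all only: V.tame_symbol_nonzero V.tame_symbol_mult_left
        V.tame_symbol_mult_right V.tame_symbol_steinberg not_False_eq_True\<close>)
qed

lemma kernel_subgroup: "subgroup {\<alpha> \<in> carrier M. \<forall>P\<in>hesse_points t. tame_K2 y P \<alpha> = 1} M"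
proof (rule K2.subgroupI)
  show "{\<alpha> \<in> carrier M. \<forall>P\<in>hesse_points t. tame_K2 y P \<alpha> = 1} \<noteq> {}"
    using multiplicative_character.h_one[OF tame_K2_character(1)] by blast
next
  fix \<alpha> assume "\<alpha> \<in> {\<alpha> \<in> carrier M. \<forall>P\<in>hesse_points t. tame_K2 y P \<alpha> = 1}"
  thus "inv\<^bsub>M\<^esub> \<alpha> \<in> {\<alpha> \<in> carrier M. \<forall>P\<in>hesse_points t. tame_K2 y P \<alpha> = 1}"
    using multiplicative_character.h_inv[OF tame_K2_character(1)] by auto
next
  fix \<alpha> \<beta> assume "\<alpha> \<in> {\<alpha> \<in> carrier M. \<forall>P\<in>hesse_points t. tame_K2 y P \<alpha> = 1}"
    "\<beta> \<in> {\<alpha> \<in> carrier M. \<forall>P\<in>hesse_points t. tame_K2 y P \<alpha> = 1}"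
  thus "\<alpha> \<otimes>\<^bsub>M\<^esub> \<beta> \<in> {\<alpha> \<in> carrier M. \<forall>P\<in>hesse_points t. tame_K2 y P \<alpha> = 1}"
    using multiplicative_character.h_mult[OF tame_K2_character(1)] by auto
qed auto

lemma comm_group_kernel: "comm_group G"
proof (rule group.group_comm_groupI)
  show "Group.group G"
    unfolding tame_kernel_def by (rule K2.subgroup_imp_group[OF kernel_subgroup])
qed (auto simp: tame_kernel_def K2.m_comm)

sublocale Q: rational_tensor G
  by (intro rational_tensor.intro comm_group_kernel)

lemma kernel_pow: "\<alpha> [^]\<^bsub>G\<^esub> (n::nat) = \<alpha> [^]\<^bsub>M\<^esub> n"
  unfolding tame_kernel_def by (rule K2.nat_pow_consistent[symmetric])

lemma kernel_mult: "\<alpha> \<otimes>\<^bsub>G\<^esub> \<beta> = \<alpha> \<otimes>\<^bsub>M\<^esub> \<beta>"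
  by (simp add: tame_kernel_def)

lemma symbol_in_carrier: "f \<in> K - {0} \<Longrightarrow> g \<in> K - {0} \<Longrightarrow> symbol K f g \<in> carrier M"
  unfolding symbol_eq by (intro K2_class_in_carrier) simp

text \<open>The factor \<open>n\<close> leaves room for a common exponent that also absorbs the
  torsion of \<open>flex_relation_torsion\<close>.\<close>

lemma symbol_sixth_power:
  assumes f: "f \<in> K - {0}" and g: "g \<in> K - {0}"
    and tame: "\<And>u v w. (u, v, w) \<in> hesse_points t \<Longrightarrow> tame y (u, v, w) (f, g) ^ 6 = 1"
  shows "symbol K f g [^]\<^bsub>M\<^esub> (6 * n :: nat) \<in> carrier G"
proof -
  have "tame_K2 y P (symbol K f g [^]\<^bsub>M\<^esub> m) = tame y P (f, g) ^ m" if P: "P \<in> hesse_points t" for P m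
  proof -
    interpret multiplicative_character M "tame_K2 y P" by (rule tame_K2_character(1)[OF P])
    show ?thesis
      using symbol_in_carrier[OF f g] tame_K2_character(2)[OF P f g]
      by (induction m) (simp_all add: h_one h_mult mult.commute)
  qed
  moreover have "tame y P (f, g) ^ (6 * n) = 1" if "P \<in> hesse_points t" for P
    using that tame by (cases P) (simp add: power_mult)
  ultimately show ?thesis
    using symbol_in_carrier[OF f g] by (simp add: tame_kernel_def)
qed

text \<open>Replaces the least exponent by any admissible one: the powers with exponents
  \<open>n\<close> and \<open>N\<close> are compared through \<open>n * N\<close>.\<close>

lemma motivic_class_eq:
  assumes \<alpha>: "\<alpha> \<in> carrier M" and N: "N > 0" "\<alpha> [^]\<^bsub>M\<^esub> N \<in> carrier G"
  shows "motivic_class t y \<alpha> = pure_tensor G rat_group (\<alpha> [^]\<^bsub>M\<^esub> N) (1 / of_nat N)"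
proof -
  define n where "n = (LEAST n::nat. n > 0 \<and> \<alpha> [^]\<^bsub>M\<^esub> n \<in> carrier G)"
  have n: "n > 0" "\<alpha> [^]\<^bsub>M\<^esub> n \<in> carrier G"
    using LeastI[of "\<lambda>n. n > 0 \<and> \<alpha> [^]\<^bsub>M\<^esub> n \<in> carrier G" N] N unfolding n_def by auto
  have "motivic_class t y \<alpha> = pure_tensor G rat_group (\<alpha> [^]\<^bsub>M\<^esub> n) (1 / of_nat n)"
    by (simp add: motivic_class_def n_def Let_def)
  also have "\<dots> = pure_tensor G rat_group ((\<alpha> [^]\<^bsub>M\<^esub> n) [^]\<^bsub>G\<^esub> N) (1 / of_nat (N * n))"
    by (rule Q.pure_pow_cancel[symmetric]) (use n N in auto)
  also have "\<dots> = pure_tensor G rat_group ((\<alpha> [^]\<^bsub>M\<^esub> N) [^]\<^bsub>G\<^esub> n) (1 / of_nat (n * N))"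
    using \<alpha> by (simp add: kernel_pow K2.nat_pow_pow mult.commute)
  also have "\<dots> = pure_tensor G rat_group (\<alpha> [^]\<^bsub>M\<^esub> N) (1 / of_nat N)"
    by (rule Q.pure_pow_cancel) (use n N in auto)
  finally show ?thesis .
qed

lemma coordinates_in_K: "const c \<in> K" "var_x \<in> K - {0}" "y \<in> K - {0}"
proof -
  have "(- 1, 0, 1) \<in> hesse_points t" by (simp add: hesse_points_def)
  then obtain \<xi> \<eta> a b k l where "point_chart t \<xi> \<eta> a b y (- 1) 0 1 k l"
    using point_chart_exists by metis
  then interpret point_chart t \<xi> \<eta> a b y "- 1" 0 1 k l .
  show "const c \<in> K" "var_x \<in> K - {0}" "y \<in> K - {0}"
    using form_in_function_field[OF form_linear[of c 0 0] form_linear[of 1 0 0]]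
      form_in_function_field[OF form_linear[of 0 1 0] form_linear[of 1 0 0]]
      form_in_function_field[OF form_linear[of 0 0 1] form_linear[of 1 0 0]] xy_nonzero by simp_all
qed

definition flex_left :: "qbar \<Rightarrow> omega" where
  "flex_left z = - ((const t + var_x + y) / (const z + var_x + const z ^ 2 * const t * y))"

definition flex_right :: "qbar \<Rightarrow> omega" where
  "flex_right z = - ((const z ^ 2 + const t * var_x + const z * y) / (const t + var_x + y))"

lemma xi_rho_eq: "xi_rho t y z = symbol K (flex_left z) (flex_right z)"
  by (simp add: xi_rho_def flex_left_def flex_right_def Let_def)

lemma flex_in_K:
  assumes "z ^ 3 = 1"
  shows "flex_left z \<in> K - {0}" "flex_right z \<in> K - {0}"
proof -
  have "z \<noteq> 0" using assms by auto
  hence nz: "const t + var_x + y \<noteq> 0" "const z + var_x + const z ^ 2 * const t * y \<noteq> 0"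
    "const z ^ 2 + const t * var_x + const z * y \<noteq> 0"
    using linear_nonzero_x[of 1 t 1] linear_nonzero_x[of 1 z "z ^ 2 * t"] linear_nonzero_y[of z "z ^ 2" t]
    by (simp_all add: const_mult const_power)
  have x: "var_x \<in> K" "y \<in> K" using coordinates_in_K by auto
  show "flex_left z \<in> K - {0}" "flex_right z \<in> K - {0}"
    using nz x coordinates_in_K(1) by (simp_all add: flex_left_def flex_right_def K_closed)
qed

lemma cube_root_of_unity:
  fixes \<omega> :: qbar
  assumes "\<omega> ^ 2 + \<omega> + 1 = 0"
  shows "\<omega> ^ 3 = 1" "(\<omega> ^ 2) ^ 3 = 1"
proof -
  have "\<omega> ^ 3 - 1 = (\<omega> - 1) * (\<omega> ^ 2 + \<omega> + 1)"
    by (simp add: power2_eq_square power3_eq_cube algebra_simps)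
  thus w3: "\<omega> ^ 3 = 1" using assms by simp
  thus "(\<omega> ^ 2) ^ 3 = 1" using power_mult[of \<omega> 3 2] by simp
qed

text \<open>\<open>s_xi_sum\<close> holds for every Steinberg functional, so the difference of the
  two sides is torsion in \<open>K\<^sub>2\<close>; \<open>n\<close> comes from
  \<open>K2_torsion\<close> without any bound.\<close>

lemma flex_relation_torsion:
  assumes \<omega>: "\<omega> ^ 2 + \<omega> + 1 = 0"
  obtains n :: nat where "n > 0"
    "(xi_rho t y 1 \<otimes>\<^bsub>M\<^esub> xi_rho t y \<omega> \<otimes>\<^bsub>M\<^esub> xi_rho t y (\<omega> ^ 2)) [^]\<^bsub>M\<^esub> n =
     (symbol K var_x y [^]\<^bsub>M\<^esub> (3::nat)) [^]\<^bsub>M\<^esub> n"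
proof -
  note w3 = cube_root_of_unity(1)[OF \<omega>] and w6 = cube_root_of_unity(2)[OF \<omega>]
  let ?f = "\<lambda>z. frag_of (flex_left z, flex_right z)" and ?g = "frag_of (var_x, y)"
  have mem: "?f 1 \<in> carrier U.F" "?f \<omega> \<in> carrier U.F" "?f (\<omega> ^ 2) \<in> carrier U.F" "?g \<in> carrier U.F"
    using flex_in_K[of 1] flex_in_K[OF w3] flex_in_K[OF w6] coordinates_in_K(2,3)
    by (simp_all del: power_mult_numeral)
  define L where "L = ?f 1 + ?f \<omega> + ?f (\<omega> ^ 2)"
  define Rt where "Rt = ?g + ?g + ?g"
  have L: "L \<in> carrier U.F" and Rt: "Rt \<in> carrier U.F"
    using U.F.m_closed mem unfolding L_def Rt_def mult_free_Abelian_group by blast+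
  have D: "L - Rt \<in> carrier U.F" using U.diff_in_F[OF L Rt] .
  have rel: "\<phi> (L - Rt) = 0" if add: "\<And>u v. \<phi> (u + v) = \<phi> u + \<phi> v"
    and "steinberg_functional K (\<lambda>f g. \<phi> (frag_of (f, g)))" for \<phi>
  proof -
    interpret steinberg_functional K "\<lambda>f g. \<phi> (frag_of (f, g))" by (rule that(2))
    have hf: "hesse_functional K (\<lambda>f g. \<phi> (frag_of (f, g))) (range const) var_x y (const t) (const \<omega>)"
    proof (unfold_locales, goal_cases)
      case 1 show ?case using coordinates_in_K(1) by auto
    next case 2 show ?case by (metis const_1 rangeI)
    next case (3 a b) thus ?case by (auto simp flip: const_add)
    next case (4 a) thus ?case by (auto simp flip: const_uminus)
    next case (5 a b) thus ?case by (auto simp flip: const_mult)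
    next case 6 show ?case using coordinates_in_K by simp
    next case 7 show ?case using coordinates_in_K by simp
    next case 8 show ?case by simp
    next case 9 show ?case by simp
    next case 10
      have "const (\<omega> ^ 2 + \<omega> + 1) = 0" using \<omega> by simp
      thus ?case by (simp add: const_add const_power)
    next case 11 show ?case using const_eq_0_iff[of 3] by (simp add: const_numeral)
    next case 12 show ?case by (rule cubic)
    next case 13 show ?case by (rule xy_nonzero)
    next case 14 show ?case by (rule xy_nonzero)
    next case (15 a b c) thus ?case using linear_nonzero_x by auto
    next case (16 a b c) thus ?case using linear_nonzero_y by auto
    next case 17 show ?case using t const_eq_iff[of "t ^ 3" 1] by (simp add: const_power)
    qed
    have "\<phi> (?f 1) + \<phi> (?f \<omega>) + \<phi> (?f (\<omega> ^ 2)) = 3 * \<phi> ?g"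
      using hesse_functional.s_xi_sum[OF hf] by (simp add: flex_left_def flex_right_def const_power)
    hence "\<phi> L = \<phi> Rt" by (simp add: L_def Rt_def add)
    moreover have "\<phi> (L - Rt) + \<phi> Rt = \<phi> L" by (metis add diff_add_cancel)
    ultimately show ?thesis by simp
  qed
  have "\<exists>n>0. K2_class K (L - Rt) [^]\<^bsub>M\<^esub> (n :: nat) = \<one>\<^bsub>M\<^esub>"
  proof (rule K2_torsion[OF D])
    fix \<phi> :: "(omega \<times> omega \<Rightarrow>\<^sub>0 int) \<Rightarrow> rat"
    assume "\<And>u v. \<phi> (u + v) = \<phi> u + \<phi> v" "steinberg_functional K (\<lambda>f g. \<phi> (frag_of (f, g)))"
    thus "\<phi> (L - Rt) = 0" by (rule rel)
  qed blast
  then obtain n :: nat where n: "n > 0" "K2_class K (L - Rt) [^]\<^bsub>M\<^esub> n = \<one>\<^bsub>M\<^esub>"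
    by blast
  have "K2_class K L = K2_class K (L - Rt) \<otimes>\<^bsub>M\<^esub> K2_class K Rt"
    using K2_class_add[OF D Rt] by simp
  hence "K2_class K L [^]\<^bsub>M\<^esub> n = K2_class K Rt [^]\<^bsub>M\<^esub> n"
    using n K2_class_in_carrier[OF D] K2_class_in_carrier[OF Rt] by (simp add: K2.nat_pow_distrib)
  moreover have "K2_class K L = xi_rho t y 1 \<otimes>\<^bsub>M\<^esub> xi_rho t y \<omega> \<otimes>\<^bsub>M\<^esub> xi_rho t y (\<omega> ^ 2)"
    using K2_class_add[OF U.F.m_closed[OF mem(1,2)] mem(3)] K2_class_add[OF mem(1,2)]
    by (simp add: L_def xi_rho_eq symbol_eq)
  moreover have "K2_class K Rt = symbol K var_x y [^]\<^bsub>M\<^esub> (3::nat)"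
    using K2_class_add[OF U.F.m_closed[OF mem(4,4)] mem(4)] K2_class_add[OF mem(4,4)] K2_class_in_carrier[OF mem(4)]
    by (simp add: Rt_def symbol_eq numeral_3_eq_3)
  ultimately show ?thesis using that n(1) by simp
qed

theorem hesse_symbol:
  "tame_torsion t y (symbol K var_x y) \<and> (\<forall>z\<in>mu3. tame_torsion t y (xi_rho t y z)) \<and>
   xi_Hes t y = motivic_class t y (symbol K var_x y)"
proof -
  let ?\<beta> = "symbol K var_x y"
  have \<beta>: "?\<beta> \<in> carrier M" "?\<beta> [^]\<^bsub>M\<^esub> (6 * n :: nat) \<in> carrier G" for n
    using symbol_in_carrier symbol_sixth_power coordinates_in_K(2,3) tame_xy by blast+
  have \<alpha>: "xi_rho t y z \<in> carrier M" "xi_rho t y z [^]\<^bsub>M\<^esub> (6 * n :: nat) \<in> carrier G" if "z ^ 3 = 1" for z n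
    unfolding xi_rho_eq using symbol_in_carrier symbol_sixth_power flex_in_K[OF that]
      tame_flex[OF _ that] unfolding flex_left_def flex_right_def by blast+
  have "tame_torsion t y ?\<beta>"
    unfolding tame_torsion_def using \<beta>(1) \<beta>(2)[of 1] by (auto intro!: exI[of _ 6])
  moreover have "tame_torsion t y (xi_rho t y z)" if "z \<in> mu3" for z
    unfolding tame_torsion_def using \<alpha>(1)[of z] \<alpha>(2)[of z 1] that by (auto simp: mu3_def intro!: exI[of _ 6])
  moreover have "xi_Hes t y = motivic_class t y ?\<beta>"
  proof -
    \<comment> \<open>A primitive cube root of unity: \<open>\<omega> \<noteq> 1\<close> because
      \<open>3 \<noteq> 0\<close> in \<open>qbar\<close>.\<close>
    have "\<exists>\<omega>::qbar. poly [:1, 1, 1:] \<omega> = 0"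
      by (rule alg_closed_imp_poly_has_root) simp
    then obtain \<omega> :: qbar where \<omega>: "\<omega> ^ 2 + \<omega> + 1 = 0"
      by (auto simp: power2_eq_square algebra_simps)
    note w3 = cube_root_of_unity(1)[OF \<omega>] and w6 = cube_root_of_unity(2)[OF \<omega>]
    have "z ^ 3 - 1 = (z - 1) * (z - \<omega>) * (z - \<omega> ^ 2) + (\<omega> ^ 2 + \<omega> + 1) * z * (z - \<omega>) + (\<omega> ^ 3 - 1)" for z
      by (simp add: power2_eq_square power3_eq_cube algebra_simps)
    hence factor: "z ^ 3 - 1 = (z - 1) * (z - \<omega>) * (z - \<omega> ^ 2)" for z
      using \<omega> w3 by simp
    have mu3: "mu3 = {1, \<omega>, \<omega> ^ 2}"
    proof -
      have "z ^ 3 = 1 \<longleftrightarrow> z \<in> {1, \<omega>, \<omega> ^ 2}" for z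
        using factor[of z] by auto
      thus ?thesis by (auto simp: mu3_def)
    qed
    have w1: "\<omega> \<noteq> 1" using \<omega> by auto
    have distinct: "\<omega> \<noteq> 1" "\<omega> ^ 2 \<noteq> 1" "\<omega> ^ 2 \<noteq> \<omega>"
    proof -
      show "\<omega> \<noteq> 1" by (rule w1)
      show "\<omega> ^ 2 \<noteq> 1"
      proof
        assume "\<omega> ^ 2 = 1"
        hence "\<omega> ^ 3 = \<omega>" by (simp add: power3_eq_cube power2_eq_square)
        with w3 w1 show False by simp
      qed
      show "\<omega> ^ 2 \<noteq> \<omega>"
      proof
        assume "\<omega> ^ 2 = \<omega>"
        hence "\<omega> * (\<omega> - 1) = 0" by (simp add: power2_eq_square algebra_simps)
        moreover have "\<omega> \<noteq> 0" using w3 by auto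
        ultimately show False using w1 by simp
      qed
    qed
    obtain n :: nat where n: "n > 0"
      "(xi_rho t y 1 \<otimes>\<^bsub>M\<^esub> xi_rho t y \<omega> \<otimes>\<^bsub>M\<^esub> xi_rho t y (\<omega> ^ 2)) [^]\<^bsub>M\<^esub> n = (?\<beta> [^]\<^bsub>M\<^esub> (3::nat)) [^]\<^bsub>M\<^esub> n"
      using flex_relation_torsion[OF \<omega>] by metis
    \<comment> \<open>The factor \<open>6\<close> puts all terms into the tame kernel and
      \<open>n\<close> removes the torsion discrepancy, so the relation becomes an equality in
      \<open>G\<close> before tensoring.\<close>
    define N where "N = 6 * n"
    have N: "N > 0" using n by (simp add: N_def)
    define \<alpha>1 \<alpha>2 \<alpha>3 where "\<alpha>1 = xi_rho t y 1" and "\<alpha>2 = xi_rho t y \<omega>" and "\<alpha>3 = xi_rho t y (\<omega> ^ 2)"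
    have \<alpha>M: "\<alpha>1 \<in> carrier M" "\<alpha>2 \<in> carrier M" "\<alpha>3 \<in> carrier M"
      using \<alpha>(1)[of 1] \<alpha>(1)[OF w3] \<alpha>(1)[OF w6] by (simp_all add: \<alpha>1_def \<alpha>2_def \<alpha>3_def)
    have \<alpha>G: "xi_rho t y z [^]\<^bsub>M\<^esub> N \<in> carrier G" if "z \<in> mu3" for z
      unfolding N_def using \<alpha>(2) that by (simp add: mu3_def)
    have \<beta>G: "?\<beta> [^]\<^bsub>M\<^esub> N \<in> carrier G" unfolding N_def by (rule \<beta>)
    have motivic: "motivic_class t y (xi_rho t y z) = pure_tensor G rat_group (xi_rho t y z [^]\<^bsub>M\<^esub> N) (1 / of_nat N)"
      if "z \<in> mu3" for z
      using motivic_class_eq[OF _ N \<alpha>G[OF that]] \<alpha>(1) that by (simp add: mu3_def)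
    have "(\<Otimes>\<^bsub>motivic_H2 t y\<^esub>z\<in>mu3. motivic_class t y (xi_rho t y z)) =
        (\<Otimes>\<^bsub>tensor G rat_group\<^esub>z\<in>mu3. pure_tensor G rat_group (xi_rho t y z [^]\<^bsub>M\<^esub> N) (1 / of_nat N))"
      unfolding motivic_H2_def
      by (rule Q.T.finprod_cong') (auto simp: motivic intro!: Q.pure_in_carrier \<alpha>G)
    also have "\<dots> = pure_tensor G rat_group (\<Otimes>\<^bsub>G\<^esub>z\<in>mu3. xi_rho t y z [^]\<^bsub>M\<^esub> N) (1 / of_nat N)"
      by (rule Q.finprod_pure) (use \<alpha>G in \<open>auto simp: mu3\<close>)
    also have "(\<Otimes>\<^bsub>G\<^esub>z\<in>mu3. xi_rho t y z [^]\<^bsub>M\<^esub> N) = (?\<beta> [^]\<^bsub>M\<^esub> N) [^]\<^bsub>G\<^esub> (3::nat)"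
    proof -
      have G3: "\<alpha>1 [^]\<^bsub>M\<^esub> N \<in> carrier G" "\<alpha>2 [^]\<^bsub>M\<^esub> N \<in> carrier G" "\<alpha>3 [^]\<^bsub>M\<^esub> N \<in> carrier G"
        using \<alpha>G by (simp_all add: mu3 \<alpha>1_def \<alpha>2_def \<alpha>3_def)
      have "(\<Otimes>\<^bsub>G\<^esub>z\<in>mu3. xi_rho t y z [^]\<^bsub>M\<^esub> N) = \<alpha>1 [^]\<^bsub>M\<^esub> N \<otimes>\<^bsub>G\<^esub> (\<alpha>2 [^]\<^bsub>M\<^esub> N \<otimes>\<^bsub>G\<^esub> \<alpha>3 [^]\<^bsub>M\<^esub> N)"
        unfolding mu3 using distinct G3
        by (simp add: Q.G.finprod_insert Pi_def \<alpha>1_def \<alpha>2_def \<alpha>3_def)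
      also have "\<dots> = (\<alpha>1 \<otimes>\<^bsub>M\<^esub> \<alpha>2 \<otimes>\<^bsub>M\<^esub> \<alpha>3) [^]\<^bsub>M\<^esub> N"
        using \<alpha>M by (simp add: kernel_mult K2.nat_pow_distrib K2.m_assoc)
      also have "\<dots> = ((\<alpha>1 \<otimes>\<^bsub>M\<^esub> \<alpha>2 \<otimes>\<^bsub>M\<^esub> \<alpha>3) [^]\<^bsub>M\<^esub> n) [^]\<^bsub>M\<^esub> (6::nat)"
        using \<alpha>M by (simp add: K2.nat_pow_pow N_def mult.commute)
      also have "\<dots> = ((?\<beta> [^]\<^bsub>M\<^esub> (3::nat)) [^]\<^bsub>M\<^esub> n) [^]\<^bsub>M\<^esub> (6::nat)"
        unfolding \<alpha>1_def \<alpha>2_def \<alpha>3_def n(2) ..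
      also have "\<dots> = (?\<beta> [^]\<^bsub>M\<^esub> N) [^]\<^bsub>G\<^esub> (3::nat)"
        using \<beta>(1) by (simp add: kernel_pow K2.nat_pow_pow N_def mult_ac)
      finally show ?thesis .
    qed
    finally have "xi_Hes t y = rat_scale G (1 / 3) (pure_tensor G rat_group ((?\<beta> [^]\<^bsub>M\<^esub> N) [^]\<^bsub>G\<^esub> (3::nat)) (1 / of_nat N))"
      by (simp add: xi_Hes_def)
    also have "\<dots> = pure_tensor G rat_group ((?\<beta> [^]\<^bsub>M\<^esub> N) [^]\<^bsub>G\<^esub> (3::nat)) (1 / of_nat (3 * N))"
      using Q.G.nat_pow_closed[OF \<beta>G] by (simp add: Q.rat_scale_pure)
    also have "\<dots> = pure_tensor G rat_group (?\<beta> [^]\<^bsub>M\<^esub> N) (1 / of_nat N)"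
      by (rule Q.pure_pow_cancel) (use \<beta>G in auto)
    also have "\<dots> = motivic_class t y ?\<beta>"
      by (rule motivic_class_eq[OF \<beta>(1) N \<beta>G, symmetric])
    finally show ?thesis .
  qed
  ultimately show ?thesis by blast
qed

end

text \<open>The clauses on \<open>tame_torsion\<close> ensure that each \<open>LEAST\<close> in
  \<open>motivic_class\<close> ranges over a nonempty set, so that both sides of the equation are
  the intended classes. Any root \<open>y\<close> of the cubic in \<open>omega\<close> is allowed,
  each giving a copy of the function field.\<close>

theorem proposition4p17:
  fixes t :: qbar and y :: omega
  assumes "t \<notin> mu3"
    and "var_x ^ 3 + y ^ 3 + 1 = 3 * const t * var_x * y"
  shows "tame_torsion t y (symbol (function_field y) var_x y) \<and>
         (\<forall>z\<in>mu3. tame_torsion t y (xi_rho t y z)) \<and>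
         xi_Hes t y = motivic_class t y (symbol (function_field y) var_x y)"
proof -
  interpret hesse_cubic t y
    using assms by unfold_locales (simp_all add: mu3_def)
  show ?thesis by (rule hesse_symbol)
qed

end
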